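(* Suppose that the distribution of $Z$ is circularly symmetric, i.e., that $Z$ and $\mathrm{e}^{\mathrm{i}\vartheta}Z$ have the same distribution for each $\vartheta\in\Theta$ (hypothesis $H_0$). For $w_1,\ldots,w_n\in\mathbb{R}^{2d}$, let \[ V_n^\ast(s,\vartheta):=\frac1{\sqrt n}\sum_{j=1}^n\ell(M_{\Phi_j}w_j,s,\vartheta),\qquad s\in\mathbb{R}^{2d},\ \vartheta\in\Theta, \] and put $T_n^\ast:=\|V_n^\ast\|_{\mathbb{H}}^2$. Then, for $\mathbb{P}$-almost all sample sequences $W_1(\omega)=w_1,\,W_2(\omega)=w_2,\ldots$ (the sequence $w_1,w_2,\ldots$ being held fixed and the randomness of $V_n^\ast$ and $T_n^\ast$ coming only from $\Phi_1,\Phi_2,\ldots$), we have, as $n\to\infty$, that $V_n^\ast$ converges in distribution to $V$ in $\mathbb{H}$ and $T_n^\ast$ converges in distribution to $\|V\|_{\mathbb{H}}^2$, where $V$ is a centred Gaussian random element of $\mathbb{H}$ with covariance kernel \[ K(s,\vartheta;t,\eta)=\mathbb{E}[V(s,\vartheta)V(t,\eta)]=\mathbb{E}\big[\ell(W,s,\vartheta)\,\ell(W,t,\eta)\big],\qquad s,t\in\mathbb{R}^{2d},\ \vartheta,\eta\in\Theta . \]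
   Context: Let $d\ge 1$ be a fixed integer, $\Theta:=[-\pi,\pi)$, and let $Z,Z_1,Z_2,\ldots$ be independent and identically distributed $\mathbb{C}^d$-valued random vectors. For $z=(z_1,\ldots,z_d)^\top\in\mathbb{C}^d$ put $\mathrm{RI}(z):=(\mathrm{Re}\,z_1,\ldots,\mathrm{Re}\,z_d,\mathrm{Im}\,z_1,\ldots,\mathrm{Im}\,z_d)^\top\in\mathbb{R}^{2d}$, and set $W:=\mathrm{RI}(Z)$, $W_j:=\mathrm{RI}(Z_j)$. Independently of $W,W_1,W_2,\ldots$, let $\Phi_1,\Phi_2,\ldots$ be a sequence of i.i.d. random variables, uniformly distributed on $[-\pi,\pi)$. All random variables are defined on a common probability space $(\Omega,\mathcal{A},\mathbb{P})$. For an angle $\vartheta$ let \[ M_\vartheta=\begin{pmatrix}\cos\vartheta\,\mathrm{I}_d&-\sin\vartheta\,\mathrm{I}_d\\ \sin\vartheta\,\mathrm{I}_d&\cos\vartheta\,\mathrm{I}_d\end{pmatrix}, \] where $\mathrm{I}_d$ is the unit matrix of order $d$ (so $\mathrm{RI}(\mathrm{e}^{\mathrm{i}\vartheta}Z)=M_\vartheta W$). Let $\mathrm{CS}^+(\xi):=\cos\xi+\sin\xi$, $\xi\in\mathbb{R}$, and \[ \ell(w,s,\vartheta):=\mathrm{CS}^+(s^\top w)-\mathrm{CS}^+(s^\top M_\vartheta w),\qquad w,s\in\mathbb{R}^{2d},\ \vartheta\in\Theta . \] Let $\|\cdot\|$ be the Euclidean norm on $\mathbb{R}^{2d}$, and let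 $w:[0,\infty)\to(0,\infty)$ be a measurable function (the weight function) such that $s\mapsto w(\|s\|)$ is (Lebesgue) integrable on $\mathbb{R}^{2d}$. $\mathbb{H}=L^2(\mathbb{R}^{2d}\times\Theta,\mathcal{B}(\mathbb{R}^{2d}\times\Theta),w(\|s\|)\,\mathrm{d}s\,\mathrm{d}\vartheta)$ is the separable Hilbert space of (equivalence classes of) real-valued measurable functions on $\mathbb{R}^{2d}\times\Theta$ that are square integrable with respect to $w(\|s\|)\,\mathrm{d}s\,\mathrm{d}\vartheta$, with norm $\|f\|_{\mathbb{H}}=\big(\int_\Theta\int_{\mathbb{R}^{2d}}f^2(s,\vartheta)w(\|s\|)\,\mathrm{d}s\,\mathrm{d}\vartheta\big)^{1/2}$. *)

theory Defs
  imports "HOL-Probability.Probability"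
begin

section \<open>The space $L^2$ of a measure as a metric space of equivalence classes\<close>

definition L2_fun :: "'a measure \<Rightarrow> ('a \<Rightarrow> real) set" where
  "L2_fun \<mu> = {f \<in> borel_measurable \<mu>. integrable \<mu> (\<lambda>x. (f x)\<^sup>2)}"

definition L2_rel :: "'a measure \<Rightarrow> (('a \<Rightarrow> real) \<times> ('a \<Rightarrow> real)) set" where
  "L2_rel \<mu> = {(f, g). f \<in> L2_fun \<mu> \<and> g \<in> L2_fun \<mu> \<and> (AE x in \<mu>. f x = g x)}"

definition L2_space :: "'a measure \<Rightarrow> ('a \<Rightarrow> real) set set" where
  "L2_space \<mu> = L2_fun \<mu> // L2_rel \<mu>"

definition L2_class :: "'a measure \<Rightarrow> ('a \<Rightarrow> real) \<Rightarrow> ('a \<Rightarrow> real) set" where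
  "L2_class \<mu> f = L2_rel \<mu> `` {f}"

definition L2_rep :: "('a \<Rightarrow> real) set \<Rightarrow> 'a \<Rightarrow> real" where
  "L2_rep F = (SOME f. f \<in> F)"

text \<open>The following three notions do not depend on the chosen representatives, see
  \<open>L2_inner_class\<close>, \<open>L2_norm_class\<close> and \<open>L2_dist_class\<close> below.\<close>

definition L2_inner :: "'a measure \<Rightarrow> ('a \<Rightarrow> real) set \<Rightarrow> ('a \<Rightarrow> real) set \<Rightarrow> real" where
  "L2_inner \<mu> F G = (\<integral>x. L2_rep F x * L2_rep G x \<partial>\<mu>)"

definition L2_norm :: "'a measure \<Rightarrow> ('a \<Rightarrow> real) set \<Rightarrow> real" where
  "L2_norm \<mu> F = sqrt (\<integral>x. (L2_rep F x)\<^sup>2 \<partial>\<mu>)"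

definition L2_dist :: "'a measure \<Rightarrow> ('a \<Rightarrow> real) set \<Rightarrow> ('a \<Rightarrow> real) set \<Rightarrow> real" where
  "L2_dist \<mu> F G = sqrt (\<integral>x. (L2_rep F x - L2_rep G x)\<^sup>2 \<partial>\<mu>)"

definition L2_topology :: "'a measure \<Rightarrow> ('a \<Rightarrow> real) set topology" where
  "L2_topology \<mu> = Metric_space.mtopology (L2_space \<mu>) (L2_dist \<mu>)"

lemma equiv_L2_rel: "equiv (L2_fun \<mu>) (L2_rel \<mu>)"
proof (rule equivI)
  show "L2_rel \<mu> \<subseteq> L2_fun \<mu> \<times> L2_fun \<mu>"
    by (auto simp: L2_rel_def)
  show "refl_on (L2_fun \<mu>) (L2_rel \<mu>)"
    by (auto simp: refl_on_def L2_rel_def)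
  show "sym (L2_rel \<mu>)"
    by (rule symI) (auto simp: L2_rel_def elim: eventually_mono)
  show "trans (L2_rel \<mu>)"
    by (rule transI) (auto simp: L2_rel_def elim: eventually_elim2)
qed

lemma L2_class_in_space: "f \<in> L2_fun \<mu> \<Longrightarrow> L2_class \<mu> f \<in> L2_space \<mu>"
  by (simp add: L2_space_def L2_class_def quotientI)

lemma L2_rep_in_class:
  assumes "F \<in> L2_space \<mu>"
  shows "L2_rep F \<in> F" "L2_rep F \<in> L2_fun \<mu>"
proof -
  have "F \<noteq> {}" "F \<subseteq> L2_fun \<mu>"
    using assms equiv_L2_rel[of \<mu>] unfolding L2_space_def
    by (auto simp: in_quotient_imp_non_empty dest: in_quotient_imp_subset)
  moreover from this show "L2_rep F \<in> F"
    by (simp add: L2_rep_def some_in_eq)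
  ultimately show "L2_rep F \<in> L2_fun \<mu>"
    by blast
qed

lemma L2_rep_class:
  assumes "f \<in> L2_fun \<mu>"
  shows "L2_rep (L2_class \<mu> f) \<in> L2_fun \<mu>" "AE x in \<mu>. L2_rep (L2_class \<mu> f) x = f x"
proof -
  have "L2_rep (L2_class \<mu> f) \<in> L2_class \<mu> f"
    using L2_rep_in_class(1)[OF L2_class_in_space[OF assms]] .
  then have "(f, L2_rep (L2_class \<mu> f)) \<in> L2_rel \<mu>"
    by (simp add: L2_class_def)
  then show "L2_rep (L2_class \<mu> f) \<in> L2_fun \<mu>" "AE x in \<mu>. L2_rep (L2_class \<mu> f) x = f x"
    by (auto simp: L2_rel_def elim: eventually_mono)
qed

lemma L2_inner_class:
  assumes "f \<in> L2_fun \<mu>" "g \<in> L2_fun \<mu>"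
  shows "L2_inner \<mu> (L2_class \<mu> f) (L2_class \<mu> g) = (\<integral>x. f x * g x \<partial>\<mu>)"
  unfolding L2_inner_def using L2_rep_class[OF assms(1)] L2_rep_class[OF assms(2)] assms
  by (intro integral_cong_AE) (auto simp: L2_fun_def)

lemma L2_norm_class:
  assumes "f \<in> L2_fun \<mu>"
  shows "L2_norm \<mu> (L2_class \<mu> f) = sqrt (\<integral>x. (f x)\<^sup>2 \<partial>\<mu>)"
  unfolding L2_norm_def using L2_rep_class[OF assms] assms
  by (intro arg_cong[of _ _ sqrt] integral_cong_AE) (auto simp: L2_fun_def)

lemma L2_dist_class:
  assumes "f \<in> L2_fun \<mu>" "g \<in> L2_fun \<mu>"
  shows "L2_dist \<mu> (L2_class \<mu> f) (L2_class \<mu> g) = sqrt (\<integral>x. (f x - g x)\<^sup>2 \<partial>\<mu>)"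
  unfolding L2_dist_def using L2_rep_class[OF assms(1)] L2_rep_class[OF assms(2)] assms
  by (intro arg_cong[of _ _ sqrt] integral_cong_AE) (auto simp: L2_fun_def)

lemma L2_fun_integrable_mult:
  assumes "f \<in> L2_fun \<mu>" "g \<in> L2_fun \<mu>"
  shows "integrable \<mu> (\<lambda>x. f x * g x)"
proof (rule Bochner_Integration.integrable_bound)
  show "integrable \<mu> (\<lambda>x. (f x)\<^sup>2 + (g x)\<^sup>2)"
    using assms by (auto simp: L2_fun_def)
  show "(\<lambda>x. f x * g x) \<in> borel_measurable \<mu>"
    using assms by (auto simp: L2_fun_def)
  have "\<bar>a * b\<bar> \<le> a\<^sup>2 + b\<^sup>2" for a b :: real
    using sum_squares_bound[of "\<bar>a\<bar>" "\<bar>b\<bar>"] mult_nonneg_nonneg[of "\<bar>a\<bar>" "\<bar>b\<bar>"]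
    unfolding abs_mult power2_abs by linarith
  then show "AE x in \<mu>. norm (f x * g x) \<le> norm ((f x)\<^sup>2 + (g x)\<^sup>2)"
    by (auto intro!: AE_I2 order_trans[OF _ abs_ge_self])
qed

lemma L2_fun_diff:
  assumes "f \<in> L2_fun \<mu>" "g \<in> L2_fun \<mu>"
  shows "(\<lambda>x. f x - g x) \<in> L2_fun \<mu>"
  using assms L2_fun_integrable_mult[OF assms]
  by (auto simp: L2_fun_def power2_diff mult.assoc)

lemma L2_fun_Cauchy_Schwarz:
  assumes f: "f \<in> L2_fun \<mu>" and g: "g \<in> L2_fun \<mu>"
  shows "(\<integral>x. f x * g x \<partial>\<mu>) \<le> sqrt (\<integral>x. (f x)\<^sup>2 \<partial>\<mu>) * sqrt (\<integral>x. (g x)\<^sup>2 \<partial>\<mu>)"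
proof -
  define a b c where "a = sqrt (\<integral>x. (f x)\<^sup>2 \<partial>\<mu>)" and "b = sqrt (\<integral>x. (g x)\<^sup>2 \<partial>\<mu>)"
    and "c = (\<integral>x. f x * g x \<partial>\<mu>)"
  have fi: "integrable \<mu> (\<lambda>x. (f x)\<^sup>2)" and gi: "integrable \<mu> (\<lambda>x. (g x)\<^sup>2)"
    using f g by (auto simp: L2_fun_def)
  note fgi = L2_fun_integrable_mult[OF f g]
  have ab: "a \<ge> 0" "b \<ge> 0" "a\<^sup>2 = (\<integral>x. (f x)\<^sup>2 \<partial>\<mu>)" "b\<^sup>2 = (\<integral>x. (g x)\<^sup>2 \<partial>\<mu>)"
    by (auto simp: a_def b_def)
  have "c \<le> a * b"
  proof (cases "a = 0 \<or> b = 0")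
    case True
    then have "(AE x in \<mu>. (f x)\<^sup>2 = 0) \<or> (AE x in \<mu>. (g x)\<^sup>2 = 0)"
      using integral_nonneg_eq_0_iff_AE[OF fi] integral_nonneg_eq_0_iff_AE[OF gi]
      by (auto simp: a_def b_def)
    then have "AE x in \<mu>. f x * g x = 0"
      by (auto elim: eventually_mono)
    then have "c = 0"
      unfolding c_def by (simp add: integral_eq_zero_AE)
    with ab show ?thesis by simp
  next
    case False
    have "0 \<le> (\<integral>x. (b * f x - a * g x)\<^sup>2 \<partial>\<mu>)"
      by simp
    also have "\<dots> = (\<integral>x. b\<^sup>2 * (f x)\<^sup>2 + a\<^sup>2 * (g x)\<^sup>2 - (2 * a * b) * (f x * g x) \<partial>\<mu>)"
      by (intro Bochner_Integration.integral_cong) (auto simp: power2_eq_square algebra_simps)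
    also have "\<dots> = b\<^sup>2 * a\<^sup>2 + a\<^sup>2 * b\<^sup>2 - (2 * a * b) * c"
      using fi gi fgi by (simp add: ab c_def)
    finally have "(2 * a * b) * c \<le> (2 * a * b) * (a * b)"
      by (simp add: power2_eq_square algebra_simps)
    with False ab show ?thesis
      by (simp add: mult_le_cancel_left)
  qed
  then show ?thesis by (simp add: a_def b_def c_def)
qed

lemma L2_fun_triangle:
  assumes f: "f \<in> L2_fun \<mu>" and g: "g \<in> L2_fun \<mu>"
  shows "sqrt (\<integral>x. (f x + g x)\<^sup>2 \<partial>\<mu>) \<le> sqrt (\<integral>x. (f x)\<^sup>2 \<partial>\<mu>) + sqrt (\<integral>x. (g x)\<^sup>2 \<partial>\<mu>)"
proof (rule real_le_lsqrt)
  have fi: "integrable \<mu> (\<lambda>x. (f x)\<^sup>2)" and gi: "integrable \<mu> (\<lambda>x. (g x)\<^sup>2)"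
    using f g by (auto simp: L2_fun_def)
  note fgi = L2_fun_integrable_mult[OF f g]
  have "(\<integral>x. (f x + g x)\<^sup>2 \<partial>\<mu>) = (\<integral>x. (f x)\<^sup>2 + (g x)\<^sup>2 + 2 * (f x * g x) \<partial>\<mu>)"
    by (intro Bochner_Integration.integral_cong) (auto simp: power2_sum)
  also have "\<dots> = (\<integral>x. (f x)\<^sup>2 \<partial>\<mu>) + (\<integral>x. (g x)\<^sup>2 \<partial>\<mu>) + 2 * (\<integral>x. f x * g x \<partial>\<mu>)"
    using fi gi fgi by simp
  also have "\<dots> \<le> (sqrt (\<integral>x. (f x)\<^sup>2 \<partial>\<mu>) + sqrt (\<integral>x. (g x)\<^sup>2 \<partial>\<mu>))\<^sup>2"
    using L2_fun_Cauchy_Schwarz[OF f g] by (simp add: power2_sum)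
  finally show "(\<integral>x. (f x + g x)\<^sup>2 \<partial>\<mu>) \<le> (sqrt (\<integral>x. (f x)\<^sup>2 \<partial>\<mu>) + sqrt (\<integral>x. (g x)\<^sup>2 \<partial>\<mu>))\<^sup>2" .
qed auto

lemma Metric_space_L2: "Metric_space (L2_space \<mu>) (L2_dist \<mu>)"
proof
  fix F G H :: "('a \<Rightarrow> real) set"
  show "0 \<le> L2_dist \<mu> F G"
    by (simp add: L2_dist_def)
  show "L2_dist \<mu> F G = L2_dist \<mu> G F"
    by (simp add: L2_dist_def power2_commute)
  assume F: "F \<in> L2_space \<mu>" and G: "G \<in> L2_space \<mu>"
  let ?f = "L2_rep F" and ?g = "L2_rep G" and ?h = "L2_rep H"
  note FG = L2_rep_in_class[OF F] L2_rep_in_class[OF G]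
  show "L2_dist \<mu> F G = 0 \<longleftrightarrow> F = G"
  proof
    assume "L2_dist \<mu> F G = 0"
    then have "(\<integral>x. (?f x - ?g x)\<^sup>2 \<partial>\<mu>) = 0"
      by (simp add: L2_dist_def)
    moreover have "integrable \<mu> (\<lambda>x. (?f x - ?g x)\<^sup>2)"
      using L2_fun_diff[OF FG(2,4)] by (simp add: L2_fun_def)
    ultimately have "AE x in \<mu>. (?f x - ?g x)\<^sup>2 = 0"
      by (subst (asm) integral_nonneg_eq_0_iff_AE) auto
    then have "(?f, ?g) \<in> L2_rel \<mu>"
      using FG by (auto simp: L2_rel_def)
    then show "F = G"
      using quotient_eqI[OF equiv_L2_rel] F G FG unfolding L2_space_def by blast
  qed (simp add: L2_dist_def)
  assume H: "H \<in> L2_space \<mu>"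
  note Hh = L2_rep_in_class[OF H]
  show "L2_dist \<mu> F H \<le> L2_dist \<mu> F G + L2_dist \<mu> G H"
    using L2_fun_triangle[OF L2_fun_diff[OF FG(2,4)] L2_fun_diff[OF FG(4) Hh(2)]]
    by (simp add: L2_dist_def)
qed


section \<open>Random elements, convergence in distribution, Gaussian elements\<close>

definition borel_of_topology :: "'a topology \<Rightarrow> 'a measure" where
  "borel_of_topology T = sigma (topspace T) {U. openin T U}"

text \<open>The elements \<open>X n\<close> live on the probability space \<open>M\<close>, the limit \<open>Y\<close> on the possibly
  different probability space \<open>N\<close>.\<close>

definition conv_in_distr ::
  "'b topology \<Rightarrow> 'a measure \<Rightarrow> (nat \<Rightarrow> 'a \<Rightarrow> 'b) \<Rightarrow> 'c measure \<Rightarrow> ('c \<Rightarrow> 'b) \<Rightarrow> bool" where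
  "conv_in_distr T M X N Y \<longleftrightarrow>
     (\<forall>n. X n \<in> M \<rightarrow>\<^sub>M borel_of_topology T) \<and> Y \<in> N \<rightarrow>\<^sub>M borel_of_topology T \<and>
     (\<forall>f. continuous_map T euclideanreal f \<and> bounded (f ` topspace T) \<longrightarrow>
        (\<lambda>n. \<integral>\<omega>. f (X n \<omega>) \<partial>M) \<longlonglongrightarrow> (\<integral>\<omega>. f (Y \<omega>) \<partial>N))"

text \<open>As usual, the point mass at \<open>0\<close> counts as a (degenerate) centred normal distribution.\<close>

definition centred_normal_law :: "real measure \<Rightarrow> bool" where
  "centred_normal_law \<nu> \<longleftrightarrow>
     \<nu> = return borel 0 \<or> (\<exists>\<sigma>>0. \<nu> = density lborel (normal_density 0 \<sigma>))"

definition centred_gaussian_element ::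
  "'a measure \<Rightarrow> 'c measure \<Rightarrow> ('c \<Rightarrow> ('a \<Rightarrow> real) set) \<Rightarrow> bool" where
  "centred_gaussian_element \<mu> N V \<longleftrightarrow>
     V \<in> N \<rightarrow>\<^sub>M borel_of_topology (L2_topology \<mu>) \<and>
     (\<forall>h\<in>L2_space \<mu>. centred_normal_law (distr N borel (\<lambda>\<omega>. L2_inner \<mu> (V \<omega>) h)))"

text \<open>Elements of $L^2$ have no point values. That \<open>V\<close> has covariance kernel \<open>K\<close> therefore means
  that the classes \<open>V \<omega>\<close> have representatives \<open>v \<omega>\<close>, jointly measurable in
  \<open>\<omega>\<close> and the argument, such that $E[v(x) v(y)] = K(x,y)$ for all points \<open>x\<close> and \<open>y\<close>.\<close>

definition has_covariance_kernel ::
  "'a measure \<Rightarrow> 'c measure \<Rightarrow> ('c \<Rightarrow> ('a \<Rightarrow> real) set) \<Rightarrow> ('a \<Rightarrow> 'a \<Rightarrow> real) \<Rightarrow> bool" where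
  "has_covariance_kernel \<mu> N V K \<longleftrightarrow>
     (\<exists>v. (\<lambda>(\<omega>, x). v \<omega> x) \<in> borel_measurable (N \<Otimes>\<^sub>M \<mu>) \<and>
          (\<forall>\<omega>\<in>space N. v \<omega> \<in> V \<omega>) \<and>
          (\<forall>x\<in>space \<mu>. \<forall>y\<in>space \<mu>.
             integrable N (\<lambda>\<omega>. v \<omega> x * v \<omega> y) \<and> (\<integral>\<omega>. v \<omega> x * v \<omega> y \<partial>N) = K x y))"

text \<open>Library constant \<open>indep_var\<close> requires both random variables to take values in the
  same type; this is its version for two different types.\<close>

definition (in prob_space) indep_rvs ::
  "'b measure \<Rightarrow> ('a \<Rightarrow> 'b) \<Rightarrow> 'c measure \<Rightarrow> ('a \<Rightarrow> 'c) \<Rightarrow> bool" where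
  "indep_rvs Ma X Mb Y \<longleftrightarrow>
     random_variable Ma X \<and> random_variable Mb Y \<and>
     indep_set {X -` A \<inter> space M | A. A \<in> sets Ma} {Y -` B \<inter> space M | B. B \<in> sets Mb}"


section \<open>The test for circular symmetry\<close>

text \<open>The index type \<open>'d + 'd\<close> represents the $2d$ coordinates, \<open>Inl\<close> for the real and
  \<open>Inr\<close> for the imaginary parts.\<close>

definition Theta :: "real set" where
  "Theta = {-pi..<pi}"

definition RI :: "complex ^ 'd \<Rightarrow> real ^ ('d::finite + 'd)" where
  "RI z = (\<chi> i. case i of Inl k \<Rightarrow> Re (z $ k) | Inr k \<Rightarrow> Im (z $ k))"

definition rotM :: "real \<Rightarrow> real ^ ('d::finite + 'd) ^ ('d + 'd)" where
  "rotM \<theta> = (\<chi> i j.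
     case i of
       Inl k \<Rightarrow> (case j of Inl l \<Rightarrow> cos \<theta> * (mat 1 :: real ^ 'd ^ 'd) $ k $ l
                         | Inr l \<Rightarrow> - sin \<theta> * (mat 1 :: real ^ 'd ^ 'd) $ k $ l)
     | Inr k \<Rightarrow> (case j of Inl l \<Rightarrow> sin \<theta> * (mat 1 :: real ^ 'd ^ 'd) $ k $ l
                         | Inr l \<Rightarrow> cos \<theta> * (mat 1 :: real ^ 'd ^ 'd) $ k $ l))"

lemma RI_cis: "RI (cis \<theta> *s z) = rotM \<theta> *v RI z"
proof -
  have "(RI (cis \<theta> *s z)) $ i = (rotM \<theta> *v RI z) $ i" for i
  proof -
    have U: "(UNIV :: ('a + 'a) set) = Inl ` UNIV \<union> Inr ` UNIV"
      by (metis UNIV_Plus_UNIV Plus_def)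
    have S: "(\<Sum>j\<in>UNIV. g j) = (\<Sum>k\<in>UNIV. g (Inl k)) + (\<Sum>k\<in>UNIV. g (Inr k))"
      for g :: "'a + 'a \<Rightarrow> real"
      unfolding U by (subst sum.union_disjoint) (auto simp: sum.reindex)
    show ?thesis
      by (cases i) (simp_all add: RI_def rotM_def matrix_vector_mult_def S mat_def
          if_distrib[of "\<lambda>x. _ * x"] if_distrib[of "\<lambda>x. x * _"] cong: if_cong)
  qed
  then show ?thesis by (simp add: vec_eq_iff)
qed

definition CSp :: "real \<Rightarrow> real" where
  "CSp \<xi> = cos \<xi> + sin \<xi>"

definition ell :: "real ^ ('d::finite + 'd) \<Rightarrow> real ^ ('d + 'd) \<Rightarrow> real \<Rightarrow> real" where
  "ell w s \<theta> = CSp (s \<bullet> w) - CSp (s \<bullet> (rotM \<theta> *v w))"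

definition weighted_measure :: "(real \<Rightarrow> real) \<Rightarrow> ((real ^ ('d::finite + 'd)) \<times> real) measure" where
  "weighted_measure wt =
     density (lborel \<Otimes>\<^sub>M restrict_space lborel Theta) (\<lambda>(s, \<theta>). ennreal (wt (norm s)))"

text \<open>Sequences are indexed from \<open>0\<close>: \<open>\<phi> j\<close> and \<open>w j\<close> are the $(j+1)$-st members.\<close>

definition V_star ::
  "(real \<Rightarrow> real) \<Rightarrow> nat \<Rightarrow> (nat \<Rightarrow> real ^ ('d::finite + 'd)) \<Rightarrow> (nat \<Rightarrow> real) \<Rightarrow>
     ((real ^ ('d + 'd)) \<times> real \<Rightarrow> real) set" where
  "V_star wt n w \<phi> = L2_class (weighted_measure wt)
     (\<lambda>(s, \<theta>). 1 / sqrt (real n) * (\<Sum>j<n. ell (rotM (\<phi> j) *v w j) s \<theta>))"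

definition T_star ::
  "(real \<Rightarrow> real) \<Rightarrow> nat \<Rightarrow> (nat \<Rightarrow> real ^ ('d::finite + 'd)) \<Rightarrow> (nat \<Rightarrow> real) \<Rightarrow> real" where
  "T_star wt n w \<phi> = (L2_norm (weighted_measure wt) (V_star wt n w \<phi>))\<^sup>2"

end

theory Submission
  imports Defs
begin

text \<open>Given the sample, the summands of \<open>V_star\<close> are independent, bounded and, since the angles are
  uniform, centred random fields. By circular symmetry and the strong law of large numbers their
  averaged covariances converge, for almost every sample, to the kernel of the limit. Two facts are
  needed on the Hilbert space side.

  The Gaussian limit is constructed by hand: the Cholesky decomposition of the kernel along a dense
  sequence of points yields functions \<open>e\<^sub>k\<close> with \<open>K x y = (\<Sum>k. e\<^sub>k x * e\<^sub>k y)\<close> at all points, and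
  the limit is \<open>\<Sum>k. \<omega>\<^sub>k * e\<^sub>k\<close> with independent standard normal \<open>\<omega>\<^sub>k\<close>.

  Convergence in distribution needs no tightness argument: bounded Lipschitz functions suffice as
  test functions, and for these the fields may be replaced by their values at the finitely many points
  of a simple approximation of the identity. In finite dimensions, convergence of the
  characteristic functions is upgraded one coordinate at a time by Levy's continuity theorem.\<close>

section \<open>Random elements of metric spaces and of $L^2$\<close>

text \<open>The exceptional null set must be chosen before the test functional. The sample therefore
  enters \<open>field_clt\<close> only through \<open>cov\<close> and \<open>disc\<close>: the
  simple functions \<open>F m\<close> are fixed beforehand and have finite ranges, so what is asked
  of the sample is the convergence of countably many averages of bounded functions of one
  observation. Circular symmetry identifies the limits: the covariance of a randomly rotated summand
  averages over all rotations of its observation, and the mean of this average over \<open>W\<close>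
  is the covariance of the unrotated \<open>ell\<close>. The covariance identity is demanded at
  every pair of points, whereas an element of L2 fixes values only almost everywhere. The Gaussian
  field is therefore built point by point; that its paths lie in L2 and that its class is measurable
  is shown afterwards. Second moments take the place of tightness: they control both the tails of
  the finite-dimensional laws and the cost of replacing a field by its values at finitely many
  points.\<close>

lemma space_borel_of_topology: "space (borel_of_topology T) = topspace T"
  unfolding borel_of_topology_def by (rule space_measure_of) (auto dest: openin_subset)

lemma openin_in_borel_of_topology:
  assumes "openin T U"
  shows "U \<in> sets (borel_of_topology T)"
proof -
  have "{U. openin T U} \<subseteq> Pow (topspace T)"
    by (auto dest: openin_subset)
  from sets_measure_of[OF this] show ?thesis
    using assms by (simp add: borel_of_topology_def sigma_sets.Basic)
qed

lemma measurable_borel_of_topology_iff: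
  "X \<in> M \<rightarrow>\<^sub>M borel_of_topology T \<longleftrightarrow>
    X \<in> space M \<rightarrow> topspace T \<and> (\<forall>U. openin T U \<longrightarrow> X -` U \<inter> space M \<in> sets M)"
proof
  assume X: "X \<in> M \<rightarrow>\<^sub>M borel_of_topology T"
  then show "X \<in> space M \<rightarrow> topspace T \<and> (\<forall>U. openin T U \<longrightarrow> X -` U \<inter> space M \<in> sets M)"
    using measurable_sets[OF X openin_in_borel_of_topology] measurable_space[OF X]
    by (auto simp: space_borel_of_topology)
next
  assume "X \<in> space M \<rightarrow> topspace T \<and> (\<forall>U. openin T U \<longrightarrow> X -` U \<inter> space M \<in> sets M)"
  then show "X \<in> M \<rightarrow>\<^sub>M borel_of_topology T"
    unfolding borel_of_topology_def
    by (intro measurable_measure_of) (auto dest: openin_subset)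
qed

lemma measurable_borel_of_topologyI:
  assumes "\<And>\<omega>. \<omega> \<in> space M \<Longrightarrow> X \<omega> \<in> topspace T"
    and "\<And>U. openin T U \<Longrightarrow> X -` U \<inter> space M \<in> sets M"
  shows "X \<in> M \<rightarrow>\<^sub>M borel_of_topology T"
  using assms by (auto simp: measurable_borel_of_topology_iff)

lemma continuous_map_borel_of_topology:
  fixes f :: "'a \<Rightarrow> 'b::topological_space"
  assumes "continuous_map T euclidean f"
  shows "f \<in> borel_of_topology T \<rightarrow>\<^sub>M borel"
proof (rule borel_measurableI)
  fix S :: "'b set" assume "open S"
  then have "openin T {x \<in> topspace T. f x \<in> S}"
    using assms by (simp add: continuous_map_def)
  moreover have "f -` S \<inter> space (borel_of_topology T) = {x \<in> topspace T. f x \<in> S}"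
    by (auto simp: space_borel_of_topology)
  ultimately show "f -` S \<inter> space (borel_of_topology T) \<in> sets (borel_of_topology T)"
    by (simp add: openin_in_borel_of_topology)
qed

context Metric_space
begin

lemma continuous_map_mtopology_lipschitz:
  fixes f :: "'a \<Rightarrow> real"
  assumes "\<And>x y. x \<in> M \<Longrightarrow> y \<in> M \<Longrightarrow> \<bar>f x - f y\<bar> \<le> L * d x y"
  shows "continuous_map mtopology euclideanreal f"
proof -
  have "Lipschitz_continuous_map (metric (M, d)) (metric (UNIV, dist)) f"
    unfolding Lipschitz_continuous_map_def
    using assms by (auto simp: Metric_space_axioms dist_real_def intro!: exI[of _ L])
  then have "continuous_map mtopology (mtopology_of euclidean_metric) f"
    using Lipschitz_continuous_imp_continuous_map Metric_space_axioms
    by (fastforce simp: mtopology_of_def euclidean_metric_def)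
  then show ?thesis
    by simp
qed

text \<open>An open set \<open>U\<close> is exhausted by the sets \<open>V m\<close> of points that
  have more than \<open>1 / Suc m\<close> of room inside \<open>U\<close>. The limit lies in
  \<open>U\<close> exactly if, for some \<open>m\<close>, the approximants stay in
  \<open>V m\<close> from some index on, and this is a countable combination of measurable
  conditions.\<close>

lemma measurable_borel_of_mtopology_LIMSEQ:
  assumes X: "\<And>k. X k \<in> N \<rightarrow>\<^sub>M borel_of_topology mtopology"
    and Y: "\<And>\<omega>. \<omega> \<in> space N \<Longrightarrow> Y \<omega> \<in> M"
    and lim: "\<And>\<omega>. \<omega> \<in> space N \<Longrightarrow> (\<lambda>k. d (X k \<omega>) (Y \<omega>)) \<longlonglongrightarrow> 0"
  shows "Y \<in> N \<rightarrow>\<^sub>M borel_of_topology mtopology"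
proof (rule measurable_borel_of_topologyI)
  fix U assume U: "openin mtopology U"
  \<comment> \<open>The strict inequality makes \<open>V m\<close> open, and a point of the space
    closer than \<open>1 / Suc m\<close> to a point of \<open>V m\<close> still lies in
    \<open>U\<close>.\<close>
  define V where "V m = {x \<in> M. \<exists>s. s > 1 / Suc m \<and> mball x s \<subseteq> U}" for m :: nat
  have XM: "X k \<omega> \<in> M" if "\<omega> \<in> space N" for k \<omega>
    using X[of k] that by (auto simp: measurable_borel_of_topology_iff)
  have V: "openin mtopology (V m)" for m
    unfolding openin_mtopology
  proof safe
    fix x assume "x \<in> V m"
    then obtain s where s: "x \<in> M" "s > 1 / Suc m" "mball x s \<subseteq> U"
      by (auto simp: V_def)
    have "y \<in> V m" if y: "y \<in> mball x (s - 1 / Suc m)" for y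
    proof -
      have "s - d x y > 1 / Suc m" using y by auto
      moreover have "mball y (s - d x y) \<subseteq> mball x s"
        using y by (intro mball_subset) (auto simp: commute)
      ultimately show ?thesis
        using y s unfolding V_def by (auto intro!: exI[of _ "s - d x y"])
    qed
    then show "\<exists>r>0. mball x r \<subseteq> V m"
      using s by (intro exI[of _ "s - 1 / Suc m"]) auto
  qed (auto simp: V_def)
  have "Y -` U \<inter> space N = (\<Union>m. \<Union>n. \<Inter>k\<in>{n..}. X k -` V m \<inter> space N)"
  proof (intro equalityI subsetI)
    fix \<omega> assume \<omega>: "\<omega> \<in> Y -` U \<inter> space N"
    then obtain r where r: "r > 0" "mball (Y \<omega>) r \<subseteq> U"
      using U by (auto simp: openin_mtopology)
    \<comment> \<open>Half of the room \<open>r\<close> is spent on the distance between approximant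
      and limit; the other half is the ball that witnesses membership in \<open>V m\<close>.\<close>
    obtain m where m: "1 / real (Suc m) < r / 2"
      using r nat_approx_posE[of "r / 2"] by auto
    have "\<forall>\<^sub>F k in sequentially. d (X k \<omega>) (Y \<omega>) < r / 2"
      using lim[of \<omega>] \<omega> r by (intro order_tendstoD) auto
    then obtain n where n: "\<And>k. k \<ge> n \<Longrightarrow> d (X k \<omega>) (Y \<omega>) < r / 2"
      by (auto simp: eventually_sequentially)
    have "X k \<omega> \<in> V m" if "k \<ge> n" for k
    proof -
      have "mball (X k \<omega>) (r / 2) \<subseteq> mball (Y \<omega>) r"
        using n[OF that] \<omega> Y XM by (intro mball_subset) (auto simp: commute)
      then show ?thesis
        using m r XM[of \<omega> k] \<omega> unfolding V_def by blast
    qed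
    then show "\<omega> \<in> (\<Union>m. \<Union>n. \<Inter>k\<in>{n..}. X k -` V m \<inter> space N)"
      using \<omega> by auto
  next
    fix \<omega> assume "\<omega> \<in> (\<Union>m. \<Union>n. \<Inter>k\<in>{n..}. X k -` V m \<inter> space N)"
    then obtain m n where mn: "\<And>k. k \<ge> n \<Longrightarrow> X k \<omega> \<in> V m" and \<omega>: "\<omega> \<in> space N"
      by auto
    have "\<forall>\<^sub>F k in sequentially. d (X k \<omega>) (Y \<omega>) < 1 / Suc m \<and> k \<ge> n"
      using lim[of \<omega>] \<omega> by (intro eventually_conj order_tendstoD eventually_ge_at_top) auto
    then obtain k where k: "d (X k \<omega>) (Y \<omega>) < 1 / Suc m" "k \<ge> n"
      using eventually_happens'[OF sequentially_bot] by blast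
    then obtain s where "s > 1 / Suc m" "mball (X k \<omega>) s \<subseteq> U"
      using mn[of k] by (auto simp: V_def)
    then have "Y \<omega> \<in> U"
      using k Y[of \<omega>] XM[of \<omega> k] \<omega> by (auto simp: subset_iff)
    with \<omega> show "\<omega> \<in> Y -` U \<inter> space N" by simp
  qed
  also have "\<dots> \<in> sets N"
  proof -
    have "X k -` V m \<inter> space N \<in> sets N" for k m
      using X V by (auto simp: measurable_borel_of_topology_iff)
    then have "(\<Inter>k\<in>{n..}. X k -` V m \<inter> space N) \<in> sets N" for m n
      by (intro sets.countable_INT') auto
    then show ?thesis
      by (intro sets.countable_UN'' countableI_type) blast
  qed
  finally show "Y -` U \<inter> space N \<in> sets N" .
qed (use Y in auto)

text \<open>A bounded continuous \<open>f\<close> is the increasing limit of the bounded Lipschitz functions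
  \<open>f\<^sub>k x = (INF y. f y + k * d x y)\<close>; applied to \<open>f\<close> and \<open>- f\<close> this reduces convergence in
  distribution to Lipschitz test functions.\<close>

lemma bounded_continuous_Lipschitz_approx:
  fixes f :: "'a \<Rightarrow> real"
  assumes f: "continuous_map mtopology euclideanreal f" and B: "\<And>x. x \<in> M \<Longrightarrow> \<bar>f x\<bar> \<le> B"
  obtains g where "\<And>k x. x \<in> M \<Longrightarrow> \<bar>g k x\<bar> \<le> B" "\<And>k x. x \<in> M \<Longrightarrow> g k x \<le> f x"
    "\<And>k x y. x \<in> M \<Longrightarrow> y \<in> M \<Longrightarrow> \<bar>g k x - g k y\<bar> \<le> real k * d x y"
    "\<And>x. x \<in> M \<Longrightarrow> (\<lambda>k. g k x) \<longlonglongrightarrow> f x"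
proof -
  define g where "g k x = (INF y\<in>M. f y + real k * d x y)" for k x
  have bdd: "bdd_below ((\<lambda>y. f y + real k * d x y) ` M)" if "x \<in> M" for k x
    using B by (intro bdd_belowI[of _ "- B"]) (fastforce simp: abs_le_iff intro: add_increasing2)
  have upper: "g k x \<le> f y + real k * d x y" if "x \<in> M" "y \<in> M" for k x y
    unfolding g_def by (rule cINF_lower[OF bdd]) (use that in auto)
  have lower: "c \<le> g k x" if "x \<in> M" "\<And>y. y \<in> M \<Longrightarrow> c \<le> f y + real k * d x y" for c k x
    unfolding g_def by (rule cINF_greatest) (use that in auto)
  have le: "g k x \<le> f x" if "x \<in> M" for k x
    using upper[OF that that, of k] that by simp
  have ge: "- B \<le> g k x" if "x \<in> M" for k x
    using B by (intro lower that) (fastforce simp: abs_le_iff intro: add_increasing2)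
  have lip: "g k x \<le> g k y + real k * d x y" if "x \<in> M" "y \<in> M" for k x y
  proof -
    have "g k x - real k * d x y \<le> g k y"
    proof (rule lower)
      fix z assume z: "z \<in> M"
      have "real k * d x z \<le> real k * (d x y + d y z)"
        using triangle that z by (intro mult_left_mono) auto
      then show "g k x - real k * d x y \<le> f z + real k * d y z"
        using upper[OF that(1) z, of k] by (simp add: algebra_simps)
    qed (use that in auto)
    then show ?thesis by simp
  qed
  show thesis
  proof (rule that[of g])
    show "\<bar>g k x\<bar> \<le> B" if "x \<in> M" for k x
      using ge[OF that] le[OF that] B[OF that] by (smt (verit))
    show "\<bar>g k x - g k y\<bar> \<le> real k * d x y" if "x \<in> M" "y \<in> M" for k x y
      using lip[OF that, of k] lip[OF that(2,1), of k] by (simp add: commute)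
    show "(\<lambda>k. g k x) \<longlonglongrightarrow> f x" if x: "x \<in> M" for x
    proof (rule LIMSEQ_I)
      fix e :: real assume e: "e > 0"
      have "openin mtopology {y \<in> M. f y \<in> ball (f x) (e/2)}"
        using f unfolding continuous_map_def by (metis open_ball open_openin topspace_mtopology)
      then obtain r where r: "r > 0" "mball x r \<subseteq> {y \<in> M. f y \<in> ball (f x) (e/2)}"
        using x e unfolding openin_mtopology by force
      \<comment> \<open>Outside the ball of radius \<open>r\<close> the penalty
        \<open>k * d x y\<close> then exceeds \<open>2 * B\<close>, the largest possible oscillation
        of \<open>f\<close>; inside the ball continuity of \<open>f\<close> gives the bound.\<close>
      obtain n :: nat where n: "2 * B < real n * r"
        using reals_Archimedean3[OF r(1)] by blast
      have "norm (g k x - f x) < e" if "k \<ge> n" for k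
      proof -
        have "f x - e/2 \<le> g k x"
        proof (rule lower[OF x])
          fix y assume y: "y \<in> M"
          show "f x - e/2 \<le> f y + real k * d x y"
          proof (cases "d x y < r")
            case True
            then have "y \<in> mball x r" using x y by auto
            then have "\<bar>f x - f y\<bar> < e/2"
              using r by (auto simp: dist_real_def)
            then show ?thesis
              by (smt (verit) mult_nonneg_nonneg nonneg of_nat_0_le_iff)
          next
            case False
            then have "real n * r \<le> real k * d x y"
              using that r by (intro mult_mono) auto
            then show ?thesis
              using n B[OF x] B[OF y] e by linarith
          qed
        qed
        then show ?thesis using le[OF x, of k] e by simp
      qed
      then show "\<exists>no. \<forall>k\<ge>no. norm (g k x - f x) < e" by blast
    qed
  qed (use le in auto)
qed

lemma conv_in_distr_mtopologyI:
  fixes X :: "nat \<Rightarrow> 'b \<Rightarrow> 'a" and Y :: "'c \<Rightarrow> 'a"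
  assumes "prob_space P" "prob_space N"
    and X: "\<And>n. X n \<in> P \<rightarrow>\<^sub>M borel_of_topology mtopology"
    and Y: "Y \<in> N \<rightarrow>\<^sub>M borel_of_topology mtopology"
    and lip: "\<And>f B L. (\<And>x. x \<in> M \<Longrightarrow> \<bar>f x\<bar> \<le> B) \<Longrightarrow>
      (\<And>x y. x \<in> M \<Longrightarrow> y \<in> M \<Longrightarrow> \<bar>f x - f y\<bar> \<le> L * d x y) \<Longrightarrow>
      (\<lambda>n. \<integral>\<omega>. f (X n \<omega>) \<partial>P) \<longlonglongrightarrow> (\<integral>\<omega>. f (Y \<omega>) \<partial>N)"
  shows "conv_in_distr mtopology P X N Y"
proof -
  interpret P: prob_space P by fact
  interpret N: prob_space N by fact
  have XM: "X n \<omega> \<in> M" if "\<omega> \<in> space P" for n \<omega>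
    using X[of n] that by (auto simp: measurable_borel_of_topology_iff)
  have YM: "Y \<omega> \<in> M" if "\<omega> \<in> space N" for \<omega>
    using Y that by (auto simp: measurable_borel_of_topology_iff)
  \<comment> \<open>Only a one-sided bound is available: the gap between \<open>g k\<close> and
    \<open>f\<close> is small under the limit law, but not uniformly under the laws of the
    \<open>X n\<close>. There only \<open>g k \<le> f\<close> can be used.\<close>
  have lower: "\<forall>\<^sub>F n in sequentially. (\<integral>\<omega>. f (Y \<omega>) \<partial>N) - e < (\<integral>\<omega>. f (X n \<omega>) \<partial>P)"
    if f: "continuous_map mtopology euclideanreal f" and B: "\<And>x. x \<in> M \<Longrightarrow> \<bar>f x\<bar> \<le> B"
      and e: "e > 0" for f :: "'a \<Rightarrow> real" and B e
  proof -
    obtain g where g: "\<And>k x. x \<in> M \<Longrightarrow> \<bar>g k x\<bar> \<le> B" "\<And>k x. x \<in> M \<Longrightarrow> g k x \<le> f x"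
      "\<And>k x y. x \<in> M \<Longrightarrow> y \<in> M \<Longrightarrow> \<bar>g k x - g k y\<bar> \<le> real k * d x y"
      "\<And>x. x \<in> M \<Longrightarrow> (\<lambda>k. g k x) \<longlonglongrightarrow> f x"
      using bounded_continuous_Lipschitz_approx[OF f B] by blast
    have g_cont: "continuous_map mtopology euclideanreal (g k)" for k
      by (rule continuous_map_mtopology_lipschitz) (rule g(3))
    note meas = measurable_compose[OF X continuous_map_borel_of_topology]
      measurable_compose[OF Y continuous_map_borel_of_topology]
    have "(\<lambda>k. \<integral>\<omega>. g k (Y \<omega>) \<partial>N) \<longlonglongrightarrow> (\<integral>\<omega>. f (Y \<omega>) \<partial>N)"
      by (rule integral_dominated_convergence[where w = "\<lambda>_. B"])
         (auto intro!: meas f g_cont AE_I2 simp: YM g)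
    then have "\<forall>\<^sub>F k in sequentially. (\<integral>\<omega>. f (Y \<omega>) \<partial>N) - e < (\<integral>\<omega>. g k (Y \<omega>) \<partial>N)"
      using e by (intro order_tendstoD) auto
    then obtain k where k: "(\<integral>\<omega>. f (Y \<omega>) \<partial>N) - e < (\<integral>\<omega>. g k (Y \<omega>) \<partial>N)"
      using eventually_happens'[OF sequentially_bot] by blast
    have "\<forall>\<^sub>F n in sequentially. (\<integral>\<omega>. f (Y \<omega>) \<partial>N) - e < (\<integral>\<omega>. g k (X n \<omega>) \<partial>P)"
      by (rule order_tendstoD(1)[OF lip k]) (use g in auto)
    moreover have "(\<integral>\<omega>. g k (X n \<omega>) \<partial>P) \<le> (\<integral>\<omega>. f (X n \<omega>) \<partial>P)" for n
      by (intro integral_mono P.integrable_const_bound[where B = B])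
         (auto intro!: meas f g_cont AE_I2 simp: XM g B)
    ultimately show ?thesis
      by (auto elim!: eventually_mono intro: less_le_trans)
  qed
  have "(\<lambda>n. \<integral>\<omega>. f (X n \<omega>) \<partial>P) \<longlonglongrightarrow> (\<integral>\<omega>. f (Y \<omega>) \<partial>N)"
    if f: "continuous_map mtopology euclideanreal f" and bdd: "bounded (f ` topspace mtopology)" for f
  proof -
    obtain B where B: "\<And>x. x \<in> M \<Longrightarrow> \<bar>f x\<bar> \<le> B"
      using bdd by (auto simp: bounded_iff)
    have f': "continuous_map mtopology euclideanreal (\<lambda>x. - f x)"
      using f by (rule continuous_map_minus)
    show ?thesis
    proof (rule order_tendstoI)
      fix a assume "a < (\<integral>\<omega>. f (Y \<omega>) \<partial>N)"
      then show "\<forall>\<^sub>F n in sequentially. a < (\<integral>\<omega>. f (X n \<omega>) \<partial>P)"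
        using lower[OF f B, of "(\<integral>\<omega>. f (Y \<omega>) \<partial>N) - a"] by simp
    next
      fix a assume "(\<integral>\<omega>. f (Y \<omega>) \<partial>N) < a"
      then show "\<forall>\<^sub>F n in sequentially. (\<integral>\<omega>. f (X n \<omega>) \<partial>P) < a"
        using lower[OF f', of B "a - (\<integral>\<omega>. f (Y \<omega>) \<partial>N)"] B by simp
    qed
  qed
  then show ?thesis
    unfolding conv_in_distr_def using X Y by blast
qed

end

lemma topspace_L2: "topspace (L2_topology \<mu>) = L2_space \<mu>"
  using Metric_space.topspace_mtopology[OF Metric_space_L2] by (simp add: L2_topology_def)

text \<open>By dominated convergence the map into L2 is continuous, so preimages of open sets are
  open. The bound \<open>b\<close> may depend on the parameter, because partial sums of a Gaussian
  series are bounded in the argument but not in the random coefficients.\<close>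

lemma L2_class_continuous_measurable:
  fixes g :: "'w::first_countable_topology \<Rightarrow> 'x \<Rightarrow> real"
  assumes "finite_measure \<mu>"
    and g[measurable]: "\<And>w. g w \<in> borel_measurable \<mu>"
    and cont: "\<And>x. x \<in> space \<mu> \<Longrightarrow> continuous_on UNIV (\<lambda>w. g w x)"
    and b_cont: "continuous_on UNIV b"
    and b: "\<And>w x. x \<in> space \<mu> \<Longrightarrow> \<bar>g w x\<bar> \<le> b w"
  shows "(\<lambda>w. L2_class \<mu> (g w)) \<in> borel \<rightarrow>\<^sub>M borel_of_topology (L2_topology \<mu>)"
proof (rule measurable_borel_of_topologyI)
  interpret finite_measure \<mu> by fact
  interpret L2: Metric_space "L2_space \<mu>" "L2_dist \<mu>" by (rule Metric_space_L2)
  have L2: "g w \<in> L2_fun \<mu>" for w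
    using b[of _ w] by (auto simp: L2_fun_def intro!: integrable_const_bound[where B="(b w)\<^sup>2"] AE_I2
        abs_le_square_iff[THEN iffD1] order_trans[OF _ abs_ge_self])
  show "L2_class \<mu> (g w) \<in> topspace (L2_topology \<mu>)" for w
    using L2_class_in_space[OF L2] by (simp add: topspace_L2)
  fix U assume "openin (L2_topology \<mu>) U"
  then have U: "openin L2.mtopology U" by (simp add: L2_topology_def)
  have "open {w. L2_class \<mu> (g w) \<in> U}"
  proof (subst open_subopen, safe)
    fix w0 assume "L2_class \<mu> (g w0) \<in> U"
    then obtain r where r: "r > 0" "L2.mball (L2_class \<mu> (g w0)) r \<subseteq> U"
      using U by (auto simp: L2.openin_mtopology)
    have "\<forall>\<^sub>F w in nhds w0. L2_dist \<mu> (L2_class \<mu> (g w0)) (L2_class \<mu> (g w)) < r"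
      unfolding eventually_nhds_iff_sequentially
    proof safe
      fix w :: "nat \<Rightarrow> 'w" assume w: "w \<longlonglongrightarrow> w0"
      \<comment> \<open>Along a convergent sequence of parameters the bounds stay bounded, which
        provides a constant dominating function.\<close>
      have "(\<lambda>k. b (w k)) \<longlonglongrightarrow> b w0"
        using continuous_on_tendsto_compose[OF b_cont w] by simp
      then have "Bseq (\<lambda>k. b (w k))" by (intro convergent_imp_Bseq convergentI)
      then obtain B where B: "\<And>k. \<bar>b (w k)\<bar> \<le> B" by (auto simp: Bseq_def)
      have "(\<lambda>k. \<integral>x. (g w0 x - g (w k) x)\<^sup>2 \<partial>\<mu>) \<longlonglongrightarrow> (\<integral>x. 0 \<partial>\<mu>)"
      proof (rule integral_dominated_convergence[where w = "\<lambda>_. (b w0 + B)\<^sup>2"])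
        show "AE x in \<mu>. (\<lambda>k. (g w0 x - g (w k) x)\<^sup>2) \<longlonglongrightarrow> 0"
        proof (rule AE_I2)
          fix x assume x: "x \<in> space \<mu>"
          have "(\<lambda>k. g (w k) x) \<longlonglongrightarrow> g w0 x"
            using continuous_on_tendsto_compose[OF cont[OF x] w] by simp
          then show "(\<lambda>k. (g w0 x - g (w k) x)\<^sup>2) \<longlonglongrightarrow> 0"
            by (auto intro!: tendsto_eq_intros)
        qed
        show "AE x in \<mu>. norm ((g w0 x - g (w k) x)\<^sup>2) \<le> (b w0 + B)\<^sup>2" for k
        proof (rule AE_I2)
          fix x assume x: "x \<in> space \<mu>"
          have "\<bar>g w0 x - g (w k) x\<bar> \<le> \<bar>b w0 + B\<bar>"
            using b[OF x, of w0] b[OF x, of "w k"] B[of k] by linarith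
          then show "norm ((g w0 x - g (w k) x)\<^sup>2) \<le> (b w0 + B)\<^sup>2"
            by (simp add: abs_le_square_iff)
        qed
      qed auto
      then have "(\<lambda>k. sqrt (\<integral>x. (g w0 x - g (w k) x)\<^sup>2 \<partial>\<mu>)) \<longlonglongrightarrow> 0"
        by (auto intro!: tendsto_eq_intros)
      then show "\<forall>\<^sub>F k in sequentially. L2_dist \<mu> (L2_class \<mu> (g w0)) (L2_class \<mu> (g (w k))) < r"
        unfolding L2_dist_class[OF L2 L2] using r(1) by (rule order_tendstoD)
    qed
    then have "\<forall>\<^sub>F w in nhds w0. w \<in> {w. L2_class \<mu> (g w) \<in> U}"
      by (rule eventually_mono) (use r L2_class_in_space[OF L2] in auto)
    then show "\<exists>T. open T \<and> w0 \<in> T \<and> T \<subseteq> {w. L2_class \<mu> (g w) \<in> U}"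
      by (auto simp: eventually_nhds)
  qed
  then show "(\<lambda>w. L2_class \<mu> (g w)) -` U \<inter> space borel \<in> sets borel"
    by (simp add: vimage_def)
qed

lemma L2_norm_diff_le_dist:
  assumes F: "F \<in> L2_space \<mu>" and G: "G \<in> L2_space \<mu>"
  shows "\<bar>L2_norm \<mu> F - L2_norm \<mu> G\<bar> \<le> L2_dist \<mu> F G"
proof -
  note F' = L2_rep_in_class(2)[OF F] and G' = L2_rep_in_class(2)[OF G]
  show ?thesis
    using L2_fun_triangle[OF L2_fun_diff[OF F' G'] G'] L2_fun_triangle[OF L2_fun_diff[OF G' F'] F']
    by (simp add: L2_norm_def L2_dist_def power2_commute abs_le_iff)
qed

lemma continuous_map_L2_norm: "continuous_map (L2_topology \<mu>) euclideanreal (L2_norm \<mu>)"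
proof -
  interpret L2: Metric_space "L2_space \<mu>" "L2_dist \<mu>" by (rule Metric_space_L2)
  show ?thesis
    unfolding L2_topology_def
    by (rule L2.continuous_map_mtopology_lipschitz[where L = 1]) (simp add: L2_norm_diff_le_dist)
qed

text \<open>Continuous mapping theorem: a bounded continuous test function composed with
  \<open>f\<close> is again an admissible one. It carries the convergence of the field over to its
  squared norm.\<close>

lemma conv_in_distr_continuous_map_weak_conv:
  fixes f :: "'b \<Rightarrow> real"
  assumes "prob_space M" "prob_space N"
    and conv: "conv_in_distr T M X N Y" and f: "continuous_map T euclideanreal f"
  shows "weak_conv_m (\<lambda>n. distr M borel (\<lambda>\<omega>. f (X n \<omega>))) (distr N borel (\<lambda>\<omega>. f (Y \<omega>)))"
proof -
  interpret M: prob_space M by fact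
  interpret N: prob_space N by fact
  have [measurable]: "(\<lambda>\<omega>. f (X n \<omega>)) \<in> borel_measurable M" "(\<lambda>\<omega>. f (Y \<omega>)) \<in> borel_measurable N" for n
    using conv measurable_compose[OF _ continuous_map_borel_of_topology[OF f]]
    by (auto simp: conv_in_distr_def)
  show ?thesis
  proof (rule integral_bdd_continuous_conv_imp_weak_conv)
    fix h :: "real \<Rightarrow> real"
    assume h: "\<And>x. isCont h x" and bdd: "\<And>x. \<bar>h x\<bar> \<le> 1"
    have h_cont: "continuous_on UNIV h"
      using h by (simp add: continuous_on_eq_continuous_at)
    then have [measurable]: "h \<in> borel_measurable borel"
      by (rule borel_measurable_continuous_onI)
    have "continuous_map T euclideanreal (\<lambda>x. h (f x))"
      using continuous_map_compose[OF f, of euclideanreal h] h_cont by (simp add: o_def)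
    moreover have "bounded ((\<lambda>x. h (f x)) ` topspace T)"
      using bdd by (auto simp: bounded_iff)
    ultimately have "(\<lambda>n. \<integral>\<omega>. h (f (X n \<omega>)) \<partial>M) \<longlonglongrightarrow> (\<integral>\<omega>. h (f (Y \<omega>)) \<partial>N)"
      using conv[unfolded conv_in_distr_def, THEN conjunct2, THEN conjunct2, rule_format, of "\<lambda>x. h (f x)"] by simp
    then show "(\<lambda>n. integral\<^sup>L (distr M borel (\<lambda>\<omega>. f (X n \<omega>))) h)
        \<longlonglongrightarrow> integral\<^sup>L (distr N borel (\<lambda>\<omega>. f (Y \<omega>))) h"
      by (simp add: integral_distr)
  qed (auto intro!: M.real_distribution_distr N.real_distribution_distr)
qed

text \<open>The level \<open>k\<close> of approximation is fixed before \<open>n\<close> grows, so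
  the error \<open>e k n\<close> need not be small for every \<open>n\<close>; it suffices that its
  limit \<open>d k\<close> is small for some \<open>k\<close>.\<close>

lemma LIMSEQ_uniform_approx:
  fixes a :: "nat \<Rightarrow> real"
  assumes c: "\<And>k. (\<lambda>n. c k n) \<longlonglongrightarrow> c' k"
    and a: "\<And>k. \<forall>\<^sub>F n in sequentially. \<bar>a n - c k n\<bar> \<le> e k n"
    and e: "\<And>k. (\<lambda>n. e k n) \<longlonglongrightarrow> d k"
    and b: "\<And>k. \<bar>b - c' k\<bar> \<le> d k"
    and d: "d \<longlonglongrightarrow> 0"
  shows "a \<longlonglongrightarrow> b"
proof (rule LIMSEQ_I)
  fix r :: real assume r: "r > 0"
  have "\<forall>\<^sub>F k in sequentially. d k < r / 4"
    using d r by (intro order_tendstoD) auto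
  then obtain k where k: "d k < r / 4"
    using eventually_happens'[OF sequentially_bot] by blast
  have "\<forall>\<^sub>F n in sequentially. e k n < r / 4"
    using e[of k] k by (rule order_tendstoD)
  moreover have "\<forall>\<^sub>F n in sequentially. dist (c k n) (c' k) < r / 4"
    using c[of k] r by (intro tendstoD) auto
  ultimately have "\<forall>\<^sub>F n in sequentially. norm (a n - b) < r"
    using a[of k] by eventually_elim (use b[of k] k in \<open>unfold dist_real_def real_norm_def, linarith\<close>)
  then show "\<exists>no. \<forall>n\<ge>no. norm (a n - b) < r"
    by (auto simp: eventually_sequentially)
qed

section \<open>Interpolation on a grid by tent functions\<close>

definition hat :: "real \<Rightarrow> real" where
  "hat u = max 0 (min 1 (u + 1)) - max 0 (min 1 u)"

lemma hat_bounds: "0 \<le> hat u" "hat u \<le> 1"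
  by (auto simp: hat_def)

lemma hat_eq_0: "\<bar>u\<bar> \<ge> 1 \<Longrightarrow> hat u = 0"
  by (auto simp: hat_def)

lemma continuous_on_hat: "continuous_on A hat"
  unfolding hat_def by (intro continuous_intros)

lemma hat_measurable [measurable]: "hat \<in> borel_measurable borel"
  by (intro borel_measurable_continuous_onI continuous_on_hat)

text \<open>\<open>hat\<close> is the tent with peak \<open>1\<close> at \<open>0\<close> that
  vanishes outside the interval from \<open>-1\<close> to \<open>1\<close>. Being the difference of
  one ramp at two neighbouring shifts, it telescopes when summed over integer shifts.\<close>

lemma sum_hat: "(\<Sum>j<n. hat (v - real j)) = max 0 (min 1 (v + 1)) - max 0 (min 1 (v - real n + 1))"
  by (induction n) (auto simp: hat_def algebra_simps)

text \<open>The grid has mesh \<open>1 / k\<close> and covers the interval from \<open>- k\<close>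
  to \<open>k\<close>, which takes \<open>2 * k\<^sup>2 + 1\<close> points. Inside, the tents sum to
  \<open>1\<close> and only grid points within \<open>1 / k\<close> of \<open>x\<close> contribute,
  which costs \<open>L / k\<close>. Outside, the error is at most \<open>2 * B\<close>, and the
  factor \<open>x\<^sup>2 / k\<^sup>2 \<ge> 1\<close> puts it into a form that a second moment
  controls.\<close>

lemma hat_grid_approx:
  fixes h :: "real \<Rightarrow> real"
  assumes B: "\<And>x. \<bar>h x\<bar> \<le> B" and L: "\<And>x y. \<bar>h x - h y\<bar> \<le> L * \<bar>x - y\<bar>" and k: "k > 0"
  shows "\<bar>h x - (\<Sum>j<2 * k\<^sup>2 + 1. hat (real k * x + real k ^ 2 - real j) * h ((real j - real k ^ 2) / real k))\<bar>
    \<le> L / real k + 2 * B * x\<^sup>2 / (real k)\<^sup>2" (is "\<bar>_ - ?s\<bar> \<le> _")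
proof -
  let ?w = "\<lambda>j. hat (real k * x + real k ^ 2 - real j)"
  let ?y = "\<lambda>j::nat. (real j - real k ^ 2) / real k"
  have sum_w: "(\<Sum>j<2 * k\<^sup>2 + 1. ?w j) =
      max 0 (min 1 (real k * x + real k ^ 2 + 1)) - max 0 (min 1 (real k * x - real k ^ 2))"
    by (subst sum_hat) (simp add: algebra_simps)
  have B0: "B \<ge> 0" using B[of 0] by linarith
  have L0: "L \<ge> 0" using L[of 0 1] by simp
  show ?thesis
  proof (cases "\<bar>x\<bar> \<le> real k")
    case True
    then have "\<bar>real k * x\<bar> \<le> real k ^ 2"
      using k by (simp add: abs_mult power2_eq_square mult_left_mono)
    then have sum1: "(\<Sum>j<2 * k\<^sup>2 + 1. ?w j) = 1"
      unfolding sum_w by (auto simp: abs_le_iff)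
    have "\<bar>h x - ?s\<bar> = \<bar>\<Sum>j<2 * k\<^sup>2 + 1. ?w j * (h x - h (?y j))\<bar>"
      using sum1 by (simp only: right_diff_distrib sum_subtractf sum_distrib_right[symmetric])
    also have "\<dots> \<le> (\<Sum>j<2 * k\<^sup>2 + 1. ?w j * (L / real k))"
    proof (rule order_trans[OF sum_abs], rule sum_mono)
      fix j
      show "\<bar>?w j * (h x - h (?y j))\<bar> \<le> ?w j * (L / real k)"
      proof (cases "\<bar>real k * x + real k ^ 2 - real j\<bar> \<ge> 1")
        case True
        then show ?thesis by (simp add: hat_eq_0)
      next
        case False
        have "x - ?y j = (real k * x + real k ^ 2 - real j) / real k"
          using k by (simp add: field_simps)
        then have "\<bar>x - ?y j\<bar> \<le> 1 / real k"
          using False k by (simp add: divide_right_mono)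
        then have "L * \<bar>x - ?y j\<bar> \<le> L / real k"
          using L0 mult_left_mono by fastforce
        then have "\<bar>h x - h (?y j)\<bar> \<le> L / real k"
          using L[of x "?y j"] by linarith
        then show ?thesis
          unfolding abs_mult abs_of_nonneg[OF hat_bounds(1)] by (intro mult_left_mono hat_bounds)
      qed
    qed
    also have "\<dots> = L / real k"
      by (simp only: sum_distrib_right[symmetric] sum1)
    also have "\<dots> \<le> L / real k + 2 * B * x\<^sup>2 / (real k)\<^sup>2"
      using B0 by simp
    finally show ?thesis .
  next
    case False
    have "\<bar>?s\<bar> \<le> (\<Sum>j<2 * k\<^sup>2 + 1. ?w j * B)"
      by (rule order_trans[OF sum_abs], rule sum_mono) (simp add: abs_mult hat_bounds mult_left_mono B)
    also have "\<dots> \<le> 1 * B"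
      unfolding sum_distrib_right[symmetric] sum_w using B0 by (intro mult_right_mono) auto
    finally have "\<bar>h x - ?s\<bar> \<le> 2 * B * 1"
      using B[of x] by linarith
    also have "1 \<le> x\<^sup>2 / (real k)\<^sup>2"
    proof -
      have "(real k)\<^sup>2 \<le> \<bar>x\<bar>\<^sup>2" using False by (intro power_mono) auto
      then show ?thesis using k by simp
    qed
    then have "2 * B * 1 \<le> 2 * B * (x\<^sup>2 / (real k)\<^sup>2)"
      using B0 by (intro mult_left_mono) auto
    finally show ?thesis
      using L0 by (simp add: add_increasing)
  qed
qed

section \<open>Finite-dimensional convergence from trigonometric test functions\<close>

text \<open>Law of \<open>X\<close> after the change of measure with density proportional to
  \<open>U\<close>; a weighted expectation becomes an expectation under a genuine probability law
  times a normalising constant.\<close>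

definition tilted_distr :: "'a measure \<Rightarrow> ('a \<Rightarrow> real) \<Rightarrow> ('a \<Rightarrow> real) \<Rightarrow> real measure" where
  "tilted_distr Q X U = distr (density Q (\<lambda>\<omega>. ennreal (U \<omega> / (\<integral>\<omega>. U \<omega> \<partial>Q)))) borel X"

text \<open>The lower bound \<open>1\<close> on the weight keeps the normalising constant away from
  zero, so that it can be divided out in limits.\<close>

lemma tilted_distr:
  assumes "prob_space Q" and [measurable]: "X \<in> borel_measurable Q" "U \<in> borel_measurable Q"
    and U: "\<forall>\<omega>\<in>space Q. 1 \<le> U \<omega> \<and> U \<omega> \<le> B"
  shows "real_distribution (tilted_distr Q X U)"
    "\<And>f::real \<Rightarrow> real. f \<in> borel_measurable borel \<Longrightarrow>
      (\<integral>x. f x \<partial>tilted_distr Q X U) = (\<integral>\<omega>. U \<omega> * f (X \<omega>) \<partial>Q) / (\<integral>\<omega>. U \<omega> \<partial>Q)"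
    "(\<integral>\<omega>. U \<omega> \<partial>Q) \<ge> 1"
proof -
  interpret Q: prob_space Q by fact
  have int: "integrable Q U"
    using U by (intro Q.integrable_const_bound[where B=B]) fastforce+
  have "(\<integral>\<omega>. 1 \<partial>Q) \<le> (\<integral>\<omega>. U \<omega> \<partial>Q)"
    using U int by (intro integral_mono) auto
  then show u: "(\<integral>\<omega>. U \<omega> \<partial>Q) \<ge> 1" by (simp add: Q.prob_space)
  have pos: "AE \<omega> in Q. 0 \<le> U \<omega> / (\<integral>\<omega>. U \<omega> \<partial>Q)"
    using U u by (intro AE_I2) (fastforce intro!: divide_nonneg_nonneg)
  have "emeasure (density Q (\<lambda>\<omega>. ennreal (U \<omega> / (\<integral>\<omega>. U \<omega> \<partial>Q)))) (space Q)
      = (\<integral>\<^sup>+\<omega>. ennreal (U \<omega> / (\<integral>\<omega>. U \<omega> \<partial>Q)) \<partial>Q)"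
    by (subst emeasure_density) (auto intro!: nn_integral_cong)
  also have "\<dots> = ennreal (\<integral>\<omega>. U \<omega> / (\<integral>\<omega>. U \<omega> \<partial>Q) \<partial>Q)"
    by (rule nn_integral_eq_integral) (use int pos in auto)
  also have "\<dots> = 1" using u by simp
  finally have "prob_space (density Q (\<lambda>\<omega>. ennreal (U \<omega> / (\<integral>\<omega>. U \<omega> \<partial>Q))))"
    by (intro prob_spaceI) simp
  then show "real_distribution (tilted_distr Q X U)"
    unfolding tilted_distr_def by (intro prob_space.real_distribution_distr) auto
  show "(\<integral>x. f x \<partial>tilted_distr Q X U) = (\<integral>\<omega>. U \<omega> * f (X \<omega>) \<partial>Q) / (\<integral>\<omega>. U \<omega> \<partial>Q)"
    if [measurable]: "f \<in> borel_measurable borel" for f :: "real \<Rightarrow> real"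
    unfolding tilted_distr_def using pos by (simp add: integral_distr integral_density)
qed

text \<open>The weight functions are turned into densities, which makes the one-dimensional continuity
  theorem applicable.\<close>

lemma weighted_levy_continuity_pos:
  fixes X U :: "nat \<Rightarrow> 'a \<Rightarrow> real" and Y V :: "'b \<Rightarrow> real" and g :: "real \<Rightarrow> real"
  assumes "prob_space P" "prob_space N"
    and [measurable]: "\<And>n. X n \<in> borel_measurable P" "\<And>n. U n \<in> borel_measurable P"
      "Y \<in> borel_measurable N" "V \<in> borel_measurable N"
    and U: "\<And>n \<omega>. \<omega> \<in> space P \<Longrightarrow> 1 \<le> U n \<omega> \<and> U n \<omega> \<le> B"
    and V: "\<And>\<omega>. \<omega> \<in> space N \<Longrightarrow> 1 \<le> V \<omega> \<and> V \<omega> \<le> B"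
    and cos_conv: "\<And>t c. (\<lambda>n. \<integral>\<omega>. U n \<omega> * cos (t * X n \<omega> + c) \<partial>P) \<longlonglongrightarrow> (\<integral>\<omega>. V \<omega> * cos (t * Y \<omega> + c) \<partial>N)"
    and g: "continuous_on UNIV g" and g_bdd: "\<And>x. \<bar>g x\<bar> \<le> C"
  shows "(\<lambda>n. \<integral>\<omega>. U n \<omega> * g (X n \<omega>) \<partial>P) \<longlonglongrightarrow> (\<integral>\<omega>. V \<omega> * g (Y \<omega>) \<partial>N)"
proof -
  have [measurable]: "g \<in> borel_measurable borel"
    using g by (rule borel_measurable_continuous_onI)
  have U': "\<forall>\<omega>\<in>space P. 1 \<le> U n \<omega> \<and> U n \<omega> \<le> B" and V': "\<forall>\<omega>\<in>space N. 1 \<le> V \<omega> \<and> V \<omega> \<le> B" for n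
    using U V by auto
  note P = tilted_distr[OF assms(1) assms(3,4) U'] and N = tilted_distr[OF assms(2) assms(5,6) V']
  \<comment> \<open>The choice \<open>t = 0\<close>, \<open>c = 0\<close> of the cosine test
    function is the constant \<open>1\<close> and yields the normalising constants.\<close>
  have mean: "(\<lambda>n. \<integral>\<omega>. U n \<omega> \<partial>P) \<longlonglongrightarrow> (\<integral>\<omega>. V \<omega> \<partial>N)"
    using cos_conv[of 0 0] by simp
  \<comment> \<open>The phase \<open>- pi / 2\<close> turns the cosine into the sine, so cosines
    with free phase determine the whole characteristic function.\<close>
  have char_eq: "char R t = complex_of_real (\<integral>x. cos (t * x + 0) \<partial>R) + \<i> * complex_of_real (\<integral>x. cos (t * x + (- pi / 2)) \<partial>R)"
    if "real_distribution R" for R t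
  proof -
    interpret R: real_distribution R by fact
    have "iexp (t * x) = complex_of_real (cos (t * x)) + \<i> * complex_of_real (sin (t * x))" for x
      using cis_conv_exp[of "t * x"] by (simp add: complex_eq_iff)
    then have "char R t = (\<integral>x. complex_of_real (cos (t * x)) + \<i> * complex_of_real (sin (t * x)) \<partial>R)"
      by (simp add: char_def)
    also have "\<dots> = complex_of_real (\<integral>x. cos (t * x) \<partial>R) + \<i> * complex_of_real (\<integral>x. sin (t * x) \<partial>R)"
      by (subst Bochner_Integration.integral_add)
         (auto intro!: R.integrable_const_bound[where B=1] integrable_mult_right integrable_of_real)
    finally show ?thesis
      by (simp add: cos_diff[of _ "pi/2", simplified] minus_divide_left[symmetric])
  qed
  have "weak_conv_m (\<lambda>n. tilted_distr P (X n) (U n)) (tilted_distr N Y V)"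
  proof (rule levy_continuity)
    fix t
    have "(\<lambda>n. \<integral>x. cos (t * x + c) \<partial>tilted_distr P (X n) (U n)) \<longlonglongrightarrow> (\<integral>x. cos (t * x + c) \<partial>tilted_distr N Y V)" for c
      unfolding P(2)[of "\<lambda>x. cos (t * x + c)", simplified] N(2)[of "\<lambda>x. cos (t * x + c)", simplified]
      using N(3) by (intro tendsto_divide cos_conv mean) auto
    then show "(\<lambda>n. char (tilted_distr P (X n) (U n)) t) \<longlonglongrightarrow> char (tilted_distr N Y V) t"
      unfolding char_eq[OF P(1)] char_eq[OF N(1)] by (intro tendsto_intros)
  qed (use P N in auto)
  then have "(\<lambda>n. \<integral>x. g x \<partial>tilted_distr P (X n) (U n)) \<longlonglongrightarrow> (\<integral>x. g x \<partial>tilted_distr N Y V)"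
    by (rule weak_conv_imp_integral_bdd_continuous_conv[OF P(1) N(1)])
       (use g g_bdd in \<open>auto simp: continuous_on_eq_continuous_at\<close>)
  then have lim: "(\<lambda>n. (\<integral>x. g x \<partial>tilted_distr P (X n) (U n)) * (\<integral>\<omega>. U n \<omega> \<partial>P))
      \<longlonglongrightarrow> (\<integral>x. g x \<partial>tilted_distr N Y V) * (\<integral>\<omega>. V \<omega> \<partial>N)"
    by (intro tendsto_mult mean)
  have "(\<integral>x. g x \<partial>tilted_distr P (X n) (U n)) * (\<integral>\<omega>. U n \<omega> \<partial>P) = (\<integral>\<omega>. U n \<omega> * g (X n \<omega>) \<partial>P)" for n
    using P(3)[of n] by (subst P(2)) auto
  moreover have "(\<integral>x. g x \<partial>tilted_distr N Y V) * (\<integral>\<omega>. V \<omega> \<partial>N) = (\<integral>\<omega>. V \<omega> * g (Y \<omega>) \<partial>N)"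
    using N(3) by (subst N(2)) auto
  ultimately show ?thesis
    using lim by simp
qed

text \<open>A weight bounded by \<open>B\<close> in absolute value becomes at least \<open>1\<close>
  after adding \<open>B + 1\<close>. The positive case applies to the shifted weight and to the
  constant weight \<open>1\<close>, and the added part is subtracted again.\<close>

lemma weighted_levy_continuity:
  fixes X U :: "nat \<Rightarrow> 'a \<Rightarrow> real" and Y V :: "'b \<Rightarrow> real" and g :: "real \<Rightarrow> real"
  assumes "prob_space P" "prob_space N"
    and [measurable]: "\<And>n. X n \<in> borel_measurable P" "\<And>n. U n \<in> borel_measurable P"
      "Y \<in> borel_measurable N" "V \<in> borel_measurable N"
    and U: "\<And>n \<omega>. \<omega> \<in> space P \<Longrightarrow> \<bar>U n \<omega>\<bar> \<le> B"
    and V: "\<And>\<omega>. \<omega> \<in> space N \<Longrightarrow> \<bar>V \<omega>\<bar> \<le> B"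
    and U_conv: "\<And>t c. (\<lambda>n. \<integral>\<omega>. U n \<omega> * cos (t * X n \<omega> + c) \<partial>P) \<longlonglongrightarrow> (\<integral>\<omega>. V \<omega> * cos (t * Y \<omega> + c) \<partial>N)"
    and cos_conv: "\<And>t c. (\<lambda>n. \<integral>\<omega>. cos (t * X n \<omega> + c) \<partial>P) \<longlonglongrightarrow> (\<integral>\<omega>. cos (t * Y \<omega> + c) \<partial>N)"
    and g: "continuous_on UNIV g" and g_bdd: "\<And>x. \<bar>g x\<bar> \<le> C"
  shows "(\<lambda>n. \<integral>\<omega>. U n \<omega> * g (X n \<omega>) \<partial>P) \<longlonglongrightarrow> (\<integral>\<omega>. V \<omega> * g (Y \<omega>) \<partial>N)"
proof -
  interpret P: prob_space P by fact
  interpret N: prob_space N by fact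
  have [measurable]: "g \<in> borel_measurable borel"
    using g by (rule borel_measurable_continuous_onI)
  obtain \<omega>0 where "\<omega>0 \<in> space N" using N.not_empty by auto
  then have B0: "B \<ge> 0" using V[of \<omega>0] by linarith
  have split: "(\<integral>\<omega>. (U \<omega> + (B + 1)) * f (X \<omega>) \<partial>Q) = (\<integral>\<omega>. U \<omega> * f (X \<omega>) \<partial>Q) + (B + 1) * (\<integral>\<omega>. f (X \<omega>) \<partial>Q)"
    if "prob_space Q" and [measurable]: "X \<in> borel_measurable Q" "U \<in> borel_measurable Q" "f \<in> borel_measurable borel"
      and U: "\<forall>\<omega>\<in>space Q. \<bar>U \<omega>\<bar> \<le> B" and f: "\<And>x. \<bar>f x\<bar> \<le> D"
    for Q :: "'c measure" and X U :: "'c \<Rightarrow> real" and f :: "real \<Rightarrow> real" and D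
  proof -
    interpret Q: prob_space Q by fact
    have "\<bar>U \<omega> * f (X \<omega>)\<bar> \<le> B * D" if "\<omega> \<in> space Q" for \<omega>
      unfolding abs_mult using U that f[of "X \<omega>"] B0 by (intro mult_mono) auto
    then have "integrable Q (\<lambda>\<omega>. U \<omega> * f (X \<omega>))"
      by (intro Q.integrable_const_bound[where B="B * D"] AE_I2) auto
    moreover have "integrable Q (\<lambda>\<omega>. f (X \<omega>))"
      by (intro Q.integrable_const_bound[where B=D] AE_I2) (auto simp: f)
    ultimately show ?thesis
      by (simp add: distrib_right)
  qed
  have U': "\<forall>\<omega>\<in>space P. \<bar>U n \<omega>\<bar> \<le> B" and V': "\<forall>\<omega>\<in>space N. \<bar>V \<omega>\<bar> \<le> B" for n
    using U V by auto
  note splitP = split[OF assms(1,3,4) _ U'] and splitN = split[OF assms(2,5,6) _ V']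
  have "(\<lambda>n. \<integral>\<omega>. (U n \<omega> + (B + 1)) * g (X n \<omega>) \<partial>P) \<longlonglongrightarrow> (\<integral>\<omega>. (V \<omega> + (B + 1)) * g (Y \<omega>) \<partial>N)"
  proof (rule weighted_levy_continuity_pos[where B="2 * B + 1", OF assms(1,2) _ _ _ _ _ _ _ g g_bdd])
    show "(\<lambda>n. \<integral>\<omega>. (U n \<omega> + (B + 1)) * cos (t * X n \<omega> + c) \<partial>P)
      \<longlonglongrightarrow> (\<integral>\<omega>. (V \<omega> + (B + 1)) * cos (t * Y \<omega> + c) \<partial>N)" for t c
      using tendsto_add[OF U_conv[of t c] tendsto_mult_left[OF cos_conv[of t c], of "B + 1"]]
      by (subst splitP[of "\<lambda>x. cos (t * x + c)" 1], simp_all, subst splitN[of "\<lambda>x. cos (t * x + c)" 1], simp_all)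
    show "1 \<le> U n \<omega> + (B + 1) \<and> U n \<omega> + (B + 1) \<le> 2 * B + 1" if "\<omega> \<in> space P" for n \<omega>
      using U[OF that, of n] by auto
    show "1 \<le> V \<omega> + (B + 1) \<and> V \<omega> + (B + 1) \<le> 2 * B + 1" if "\<omega> \<in> space N" for \<omega>
      using V[OF that] by auto
  qed auto
  moreover have "(\<lambda>n. \<integral>\<omega>. 1 * g (X n \<omega>) \<partial>P) \<longlonglongrightarrow> (\<integral>\<omega>. 1 * g (Y \<omega>) \<partial>N)"
    by (rule weighted_levy_continuity_pos[where B=1, OF assms(1,2) _ _ _ _ _ _ _ g g_bdd])
       (use cos_conv in auto)
  ultimately have "(\<lambda>n. (\<integral>\<omega>. (U n \<omega> + (B + 1)) * g (X n \<omega>) \<partial>P) - (B + 1) * (\<integral>\<omega>. 1 * g (X n \<omega>) \<partial>P))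
     \<longlonglongrightarrow> (\<integral>\<omega>. (V \<omega> + (B + 1)) * g (Y \<omega>) \<partial>N) - (B + 1) * (\<integral>\<omega>. 1 * g (Y \<omega>) \<partial>N)"
    by (intro tendsto_intros)
  moreover have "(\<integral>\<omega>. (U n \<omega> + (B + 1)) * g (X n \<omega>) \<partial>P) - (B + 1) * (\<integral>\<omega>. 1 * g (X n \<omega>) \<partial>P)
      = (\<integral>\<omega>. U n \<omega> * g (X n \<omega>) \<partial>P)" for n
    by (subst splitP[of g C]) (auto simp: g_bdd)
  moreover have "(\<integral>\<omega>. (V \<omega> + (B + 1)) * g (Y \<omega>) \<partial>N) - (B + 1) * (\<integral>\<omega>. 1 * g (Y \<omega>) \<partial>N)
      = (\<integral>\<omega>. V \<omega> * g (Y \<omega>) \<partial>N)"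
    by (subst splitN[of g C]) (auto simp: g_bdd)
  ultimately show ?thesis by simp
qed

section \<open>Functions of finitely many coordinates\<close>

lemma Lipschitz_coord_upd:
  fixes g :: "('i \<Rightarrow> real) \<Rightarrow> real"
  assumes "i \<notin> I" "finite I"
    and "\<And>x y. \<bar>g x - g y\<bar> \<le> L * (\<Sum>j\<in>insert i I. \<bar>x j - y j\<bar>)"
  shows "\<bar>g (x(i := s)) - g (y(i := s))\<bar> \<le> L * (\<Sum>j\<in>I. \<bar>x j - y j\<bar>)"
    and "\<bar>g (x(i := s)) - g (x(i := t))\<bar> \<le> L * \<bar>s - t\<bar>"
proof -
  have "(\<Sum>j\<in>I. \<bar>(x(i := s)) j - (y(i := t)) j\<bar>) = (\<Sum>j\<in>I. \<bar>x j - y j\<bar>)" for x y :: "'i \<Rightarrow> real" and s t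
    using assms(1) by (intro sum.cong) auto
  then show "\<bar>g (x(i := s)) - g (y(i := s))\<bar> \<le> L * (\<Sum>j\<in>I. \<bar>x j - y j\<bar>)"
    and "\<bar>g (x(i := s)) - g (x(i := t))\<bar> \<le> L * \<bar>s - t\<bar>"
    using assms(3)[of "x(i := s)" "y(i := s)"] assms(3)[of "x(i := s)" "x(i := t)"] assms(1,2)
    by auto
qed

text \<open>Interpolation in coordinate \<open>i\<close> with the others frozen. Each term of the
  sum is a function of coordinate \<open>i\<close> times a function of the remaining coordinates,
  and this separation drives the inductions over \<open>I\<close>.\<close>

lemma Lipschitz_coord_grid_approx:
  fixes g :: "('i \<Rightarrow> real) \<Rightarrow> real"
  assumes "i \<notin> I" "finite I" and B: "\<And>x. \<bar>g x\<bar> \<le> B"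
    and L: "\<And>x y. \<bar>g x - g y\<bar> \<le> L * (\<Sum>j\<in>insert i I. \<bar>x j - y j\<bar>)" and k: "k > 0"
  shows "\<bar>g x - (\<Sum>j<2 * k\<^sup>2 + 1. hat (real k * x i + real k ^ 2 - real j) * g (x(i := (real j - real k ^ 2) / real k)))\<bar>
    \<le> L / real k + 2 * B * (x i)\<^sup>2 / (real k)\<^sup>2"
  using hat_grid_approx[of "\<lambda>s. g (x(i := s))" B L k "x i"] B Lipschitz_coord_upd(2)[OF assms(1,2) L] k
  by simp

lemma tendsto_over_n_add_over_n_square: "(\<lambda>k. a / real k + b / (real k)\<^sup>2) \<longlonglongrightarrow> 0"
proof -
  have "(\<lambda>k. a / real k + b / real k * (1 / real k)) \<longlonglongrightarrow> 0 + 0 * 0"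
    by (intro tendsto_intros lim_const_over_n)
  then show ?thesis by (simp add: power2_eq_square)
qed

text \<open>The Lipschitz bound forces \<open>g\<close> to depend on the coordinates in
  \<open>I\<close> alone. Induction over \<open>I\<close> writes it as a pointwise limit of grid
  sums; for empty \<open>I\<close> it is constant.\<close>

lemma Lipschitz_coord_measurable:
  fixes g :: "('i \<Rightarrow> real) \<Rightarrow> real" and X :: "'a \<Rightarrow> 'i \<Rightarrow> real"
  assumes "finite I"
    and "\<And>i. i \<in> I \<Longrightarrow> (\<lambda>\<omega>. X \<omega> i) \<in> borel_measurable P"
    and "\<And>x. \<bar>g x\<bar> \<le> B" "\<And>x y. \<bar>g x - g y\<bar> \<le> L * (\<Sum>j\<in>I. \<bar>x j - y j\<bar>)"
  shows "(\<lambda>\<omega>. g (X \<omega>)) \<in> borel_measurable P"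
  using assms
proof (induction I arbitrary: g rule: finite_induct)
  case empty
  then have "g (X \<omega>) = g undefined" for \<omega>
    using empty.prems(3)[of "X \<omega>" undefined] by simp
  then show ?case by simp
next
  case (insert i I)
  have [measurable]: "(\<lambda>\<omega>. X \<omega> i) \<in> borel_measurable P"
    using insert.prems(1) by simp
  have [measurable]: "(\<lambda>\<omega>. g ((X \<omega>)(i := s))) \<in> borel_measurable P" for s
  proof (rule insert.IH[where g="\<lambda>x. g (x(i := s))"])
    show "\<bar>g (x(i := s)) - g (y(i := s))\<bar> \<le> L * (\<Sum>j\<in>I. \<bar>x j - y j\<bar>)" for x y
      by (rule Lipschitz_coord_upd(1)[OF insert.hyps(2,1) insert.prems(3)])
  qed (use insert.prems in auto)
  let ?s = "\<lambda>k \<omega>. \<Sum>j<2 * k\<^sup>2 + 1. hat (real k * X \<omega> i + real k ^ 2 - real j) * g ((X \<omega>)(i := (real j - real k ^ 2) / real k))"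
  show ?case
  proof (rule borel_measurable_LIMSEQ_metric[where f="\<lambda>k. ?s k"])
    fix \<omega>
    have "\<forall>\<^sub>F k in sequentially. norm (?s k \<omega> - g (X \<omega>)) \<le> L / real k + 2 * B * (X \<omega> i)\<^sup>2 / (real k)\<^sup>2"
      using eventually_gt_at_top[of 0]
    proof eventually_elim
      case (elim k)
      show ?case
        using Lipschitz_coord_grid_approx[OF insert.hyps(2,1) insert.prems(2,3) elim, of "X \<omega>"]
        by (simp only: real_norm_def abs_minus_commute)
    qed
    moreover have "(\<lambda>k. L / real k + 2 * B * (X \<omega> i)\<^sup>2 / (real k)\<^sup>2) \<longlonglongrightarrow> 0"
      by (rule tendsto_over_n_add_over_n_square)
    ultimately have "(\<lambda>k. ?s k \<omega> - g (X \<omega>)) \<longlonglongrightarrow> 0"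
      by (rule Lim_null_comparison)
    then show "(\<lambda>k. ?s k \<omega>) \<longlonglongrightarrow> g (X \<omega>)"
      by (rule LIM_zero_cancel)
  qed measurable
qed

lemma (in prob_space) expectation_abs_diff_le:
  fixes A B e :: "'a \<Rightarrow> real"
  assumes A: "integrable M A" and B: "integrable M B" and e: "integrable M e"
    and le: "\<And>\<omega>. \<omega> \<in> space M \<Longrightarrow> \<bar>A \<omega> - B \<omega>\<bar> \<le> e \<omega>"
  shows "\<bar>expectation A - expectation B\<bar> \<le> expectation e"
proof -
  have "\<bar>expectation A - expectation B\<bar> = \<bar>expectation (\<lambda>\<omega>. A \<omega> - B \<omega>)\<bar>"
    using A B by simp
  also have "\<dots> \<le> expectation (\<lambda>\<omega>. \<bar>A \<omega> - B \<omega>\<bar>)"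
    by (rule integral_abs_bound)
  also have "\<dots> \<le> expectation e"
    using A B e le by (intro integral_mono) auto
  finally show ?thesis .
qed

lemma (in prob_space) integrable_bounded_mult:
  fixes U V :: "'a \<Rightarrow> real"
  assumes [measurable]: "U \<in> borel_measurable M" "V \<in> borel_measurable M"
    and "\<And>\<omega>. \<omega> \<in> space M \<Longrightarrow> \<bar>U \<omega>\<bar> \<le> D" "\<And>\<omega>. \<omega> \<in> space M \<Longrightarrow> \<bar>V \<omega>\<bar> \<le> B"
  shows "integrable M (\<lambda>\<omega>. U \<omega> * V \<omega>)"
proof (rule integrable_const_bound[where B="D * B"])
  have "\<bar>U \<omega> * V \<omega>\<bar> \<le> D * B" if "\<omega> \<in> space M" for \<omega>
    unfolding abs_mult using assms(3,4)[OF that] by (intro mult_mono) auto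
  then show "AE \<omega> in M. norm (U \<omega> * V \<omega>) \<le> D * B" by auto
qed auto

text \<open>The product-to-sum formula keeps cosines of linear forms closed under multiplication.
  Thus a cosine in some coordinates can be part of the weight while another cosine tests the
  remaining coordinate.\<close>

lemma (in prob_space) weighted_cos_mult_cos:
  fixes U A B :: "'a \<Rightarrow> real"
  assumes [measurable]: "U \<in> borel_measurable M" "A \<in> borel_measurable M" "B \<in> borel_measurable M"
    and "\<And>\<omega>. \<omega> \<in> space M \<Longrightarrow> \<bar>U \<omega>\<bar> \<le> D"
  shows "expectation (\<lambda>\<omega>. U \<omega> * cos (A \<omega>) * cos (B \<omega>))
    = (expectation (\<lambda>\<omega>. U \<omega> * cos (A \<omega> - B \<omega>)) + expectation (\<lambda>\<omega>. U \<omega> * cos (A \<omega> + B \<omega>))) / 2"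
proof -
  have "expectation (\<lambda>\<omega>. U \<omega> * cos (A \<omega>) * cos (B \<omega>))
      = expectation (\<lambda>\<omega>. (U \<omega> * cos (A \<omega> - B \<omega>) + U \<omega> * cos (A \<omega> + B \<omega>)) / 2)"
    by (intro Bochner_Integration.integral_cong) (auto simp: cos_add cos_diff algebra_simps)
  also have "\<dots> = (expectation (\<lambda>\<omega>. U \<omega> * cos (A \<omega> - B \<omega>)) + expectation (\<lambda>\<omega>. U \<omega> * cos (A \<omega> + B \<omega>))) / 2"
    using integrable_bounded_mult[of U "\<lambda>\<omega>. cos (A \<omega> - B \<omega>)" D 1] integrable_bounded_mult[of U "\<lambda>\<omega>. cos (A \<omega> + B \<omega>)" D 1] assms(4)
    by simp
  finally show ?thesis .
qed

text \<open>The weights \<open>U\<close> and \<open>V\<close> are what makes induction over the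
  coordinates possible: after interpolation in coordinate \<open>i\<close> the tent function of that
  coordinate is absorbed into the weight, and the induction hypothesis handles the other
  coordinates. The common bound \<open>C\<close> on the second moments makes the interpolation error
  uniform in \<open>n\<close>.\<close>

lemma weighted_finite_dim_cos_conv:
  fixes X :: "nat \<Rightarrow> 'a \<Rightarrow> 'i \<Rightarrow> real" and Y :: "'b \<Rightarrow> 'i \<Rightarrow> real"
    and U :: "nat \<Rightarrow> 'a \<Rightarrow> real" and V :: "'b \<Rightarrow> real"
  assumes "finite I" "prob_space P" "prob_space N"
    and "\<And>n i. i \<in> I \<Longrightarrow> (\<lambda>\<omega>. X n \<omega> i) \<in> borel_measurable P" "\<And>i. i \<in> I \<Longrightarrow> (\<lambda>\<omega>. Y \<omega> i) \<in> borel_measurable N"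
    and "\<And>n i. i \<in> I \<Longrightarrow> integrable P (\<lambda>\<omega>. (X n \<omega> i)\<^sup>2)" "\<And>i. i \<in> I \<Longrightarrow> integrable N (\<lambda>\<omega>. (Y \<omega> i)\<^sup>2)"
    and "\<And>n i. i \<in> I \<Longrightarrow> (\<integral>\<omega>. (X n \<omega> i)\<^sup>2 \<partial>P) \<le> C" "\<And>i. i \<in> I \<Longrightarrow> (\<integral>\<omega>. (Y \<omega> i)\<^sup>2 \<partial>N) \<le> C"
    and "\<And>t c. (\<lambda>n. \<integral>\<omega>. cos ((\<Sum>i\<in>I. t i * X n \<omega> i) + c) \<partial>P) \<longlonglongrightarrow> (\<integral>\<omega>. cos ((\<Sum>i\<in>I. t i * Y \<omega> i) + c) \<partial>N)"
    and "\<And>n. U n \<in> borel_measurable P" "V \<in> borel_measurable N"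
    and "\<And>n \<omega>. \<omega> \<in> space P \<Longrightarrow> \<bar>U n \<omega>\<bar> \<le> D" "\<And>\<omega>. \<omega> \<in> space N \<Longrightarrow> \<bar>V \<omega>\<bar> \<le> D"
    and "\<And>t c. (\<lambda>n. \<integral>\<omega>. U n \<omega> * cos ((\<Sum>i\<in>I. t i * X n \<omega> i) + c) \<partial>P) \<longlonglongrightarrow> (\<integral>\<omega>. V \<omega> * cos ((\<Sum>i\<in>I. t i * Y \<omega> i) + c) \<partial>N)"
    and "\<And>x. \<bar>g x\<bar> \<le> B" "\<And>x y. \<bar>g x - g y\<bar> \<le> L * (\<Sum>i\<in>I. \<bar>x i - y i\<bar>)"
  shows "(\<lambda>n. \<integral>\<omega>. U n \<omega> * g (X n \<omega>) \<partial>P) \<longlonglongrightarrow> (\<integral>\<omega>. V \<omega> * g (Y \<omega>) \<partial>N)"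
  using assms(1,4-)
proof (induction I arbitrary: g U V rule: finite_induct)
  case empty
  have g: "g = (\<lambda>_. g undefined)"
    using empty.prems(14)[of _ undefined] by auto
  show ?case
    using tendsto_mult[OF empty.prems(12)[of _ 0] tendsto_const[of "g undefined"]]
    by (subst (1 2) g) simp
next
  case (insert i I)
  interpret P: prob_space P by fact
  interpret N: prob_space N by fact
  note [measurable] = insert.prems(8,9)
  have [measurable]: "(\<lambda>\<omega>. X n \<omega> j) \<in> borel_measurable P" "(\<lambda>\<omega>. Y \<omega> j) \<in> borel_measurable N" if "j \<in> insert i I" for n j
    using insert.prems(1)[OF that] insert.prems(2)[OF that] by auto
  have [measurable]: "(\<lambda>\<omega>. X n \<omega> i) \<in> borel_measurable P" "(\<lambda>\<omega>. Y \<omega> i) \<in> borel_measurable N" for n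
    by auto
  have [measurable]: "(\<lambda>\<omega>. \<Sum>j\<in>I. t j * X n \<omega> j) \<in> borel_measurable P" "(\<lambda>\<omega>. \<Sum>j\<in>I. t j * Y \<omega> j) \<in> borel_measurable N" for n t
    by (auto intro!: borel_measurable_sum borel_measurable_times)
  note U = insert.prems(10) and V = insert.prems(11)
  note g_bdd = insert.prems(13) and g_lip = insert.prems(14)
  define y where "y k j = (real j - real k ^ 2) / real k" for k j :: nat
  define w where "w k j x = hat (real k * x + real k ^ 2 - real j)" for k j :: nat and x :: real
  have w: "\<bar>w k j x\<bar> \<le> 1" for k j x
    using hat_bounds[of "real k * x + real k ^ 2 - real j"] by (simp add: w_def)
  have w_cont: "continuous_on UNIV (w k j)" for k j
    unfolding w_def by (intro continuous_on_compose2[OF continuous_on_hat[of UNIV]] continuous_intros) auto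
  have [measurable]: "w k j \<in> borel_measurable borel" for k j
    by (rule borel_measurable_continuous_onI[OF w_cont])
  have gy_meas [measurable]: "(\<lambda>\<omega>. g ((X n \<omega>)(i := s))) \<in> borel_measurable P"
    "(\<lambda>\<omega>. g ((Y \<omega>)(i := s))) \<in> borel_measurable N" for n s
    by (rule Lipschitz_coord_measurable[OF insert.hyps(1) _ _ Lipschitz_coord_upd(1)[OF insert.hyps(2,1) g_lip]];
        use g_bdd in \<open>auto intro: g_bdd\<close>)+
  have g_meas [measurable]: "(\<lambda>\<omega>. g (X n \<omega>)) \<in> borel_measurable P" "(\<lambda>\<omega>. g (Y \<omega>)) \<in> borel_measurable N" for n
    using insert.hyps(1) insert.prems(1,2)
    by (intro Lipschitz_coord_measurable[OF _ _ g_bdd g_lip]; simp)+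
  have sum_upd: "(\<Sum>j\<in>I. t j * x j) + s * x i + c = (\<Sum>j\<in>insert i I. (t(i := s)) j * x j) + c" for t x :: "'i \<Rightarrow> real" and s c
    using insert.hyps by (auto intro!: sum.cong)
  have X_cos: "(\<lambda>n. \<integral>\<omega>. cos (s * X n \<omega> i + c) \<partial>P) \<longlonglongrightarrow> (\<integral>\<omega>. cos (s * Y \<omega> i + c) \<partial>N)" for s c
    using insert.prems(7)[of "(\<lambda>_. 0)(i := s)" c] unfolding sum_upd[symmetric] by simp
  \<comment> \<open>The cosine hypothesis for the new weight. Here the roles are exchanged: the
    cosine in the remaining coordinates joins the weight, and the tent in coordinate
    \<open>i\<close> is the continuous test function of the one-dimensional theorem.\<close>
  have Uw_cos: "(\<lambda>n. \<integral>\<omega>. (U n \<omega> * w k j (X n \<omega> i)) * cos ((\<Sum>i\<in>I. t i * X n \<omega> i) + c) \<partial>P)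
      \<longlonglongrightarrow> (\<integral>\<omega>. (V \<omega> * w k j (Y \<omega> i)) * cos ((\<Sum>i\<in>I. t i * Y \<omega> i) + c) \<partial>N)" for k j t c
  proof -
    have "(\<lambda>n. \<integral>\<omega>. (U n \<omega> * cos ((\<Sum>i\<in>I. t i * X n \<omega> i) + c)) * w k j (X n \<omega> i) \<partial>P)
      \<longlonglongrightarrow> (\<integral>\<omega>. (V \<omega> * cos ((\<Sum>i\<in>I. t i * Y \<omega> i) + c)) * w k j (Y \<omega> i) \<partial>N)"
    proof (rule weighted_levy_continuity[where B=D, OF assms(2,3) _ _ _ _ _ _ _ X_cos w_cont w])
      fix s c'
      have conv: "(\<lambda>n. \<integral>\<omega>. U n \<omega> * cos (((\<Sum>i\<in>I. t i * X n \<omega> i) + c) + (s * X n \<omega> i + c')) \<partial>P)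
          \<longlonglongrightarrow> (\<integral>\<omega>. V \<omega> * cos (((\<Sum>i\<in>I. t i * Y \<omega> i) + c) + (s * Y \<omega> i + c')) \<partial>N)" for s c'
        using insert.prems(12)[of "t(i := s)" "c + c'"] unfolding sum_upd[symmetric] by (simp add: algebra_simps)
      show "(\<lambda>n. \<integral>\<omega>. U n \<omega> * cos ((\<Sum>i\<in>I. t i * X n \<omega> i) + c) * cos (s * X n \<omega> i + c') \<partial>P)
        \<longlonglongrightarrow> (\<integral>\<omega>. V \<omega> * cos ((\<Sum>i\<in>I. t i * Y \<omega> i) + c) * cos (s * Y \<omega> i + c') \<partial>N)"
      proof -
        have "(\<integral>\<omega>. U n \<omega> * cos ((\<Sum>i\<in>I. t i * X n \<omega> i) + c) * cos (s * X n \<omega> i + c') \<partial>P)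
          = ((\<integral>\<omega>. U n \<omega> * cos ((\<Sum>i\<in>I. t i * X n \<omega> i) + c - (s * X n \<omega> i + c')) \<partial>P) +
             (\<integral>\<omega>. U n \<omega> * cos ((\<Sum>i\<in>I. t i * X n \<omega> i) + c + (s * X n \<omega> i + c')) \<partial>P)) / 2" for n
          by (rule P.weighted_cos_mult_cos[OF _ _ _ U]) auto
        moreover have "(\<integral>\<omega>. V \<omega> * cos ((\<Sum>i\<in>I. t i * Y \<omega> i) + c) * cos (s * Y \<omega> i + c') \<partial>N)
          = ((\<integral>\<omega>. V \<omega> * cos ((\<Sum>i\<in>I. t i * Y \<omega> i) + c - (s * Y \<omega> i + c')) \<partial>N) +
             (\<integral>\<omega>. V \<omega> * cos ((\<Sum>i\<in>I. t i * Y \<omega> i) + c + (s * Y \<omega> i + c')) \<partial>N)) / 2"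
          by (rule N.weighted_cos_mult_cos[OF _ _ _ V]) auto
        moreover have "(\<lambda>n. ((\<integral>\<omega>. U n \<omega> * cos ((\<Sum>i\<in>I. t i * X n \<omega> i) + c - (s * X n \<omega> i + c')) \<partial>P) +
             (\<integral>\<omega>. U n \<omega> * cos ((\<Sum>i\<in>I. t i * X n \<omega> i) + c + (s * X n \<omega> i + c')) \<partial>P)) / 2)
           \<longlonglongrightarrow> ((\<integral>\<omega>. V \<omega> * cos ((\<Sum>i\<in>I. t i * Y \<omega> i) + c - (s * Y \<omega> i + c')) \<partial>N) +
             (\<integral>\<omega>. V \<omega> * cos ((\<Sum>i\<in>I. t i * Y \<omega> i) + c + (s * Y \<omega> i + c')) \<partial>N)) / 2"
          using tendsto_add[OF conv[of "- s" "- c'"] conv[of s c']]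
          by (intro tendsto_divide tendsto_const) (simp_all add: algebra_simps)
        ultimately show ?thesis by (simp only:)
      qed
    next
      show "\<bar>U n \<omega> * cos ((\<Sum>i\<in>I. t i * X n \<omega> i) + c)\<bar> \<le> D" if "\<omega> \<in> space P" for n \<omega>
        using mult_mono[OF U[OF that, of n] abs_cos_le_one, of "(\<Sum>i\<in>I. t i * X n \<omega> i) + c"] U[OF that, of n]
        by (simp add: abs_mult)
      show "\<bar>V \<omega> * cos ((\<Sum>i\<in>I. t i * Y \<omega> i) + c)\<bar> \<le> D" if "\<omega> \<in> space N" for \<omega>
        using mult_mono[OF V[OF that] abs_cos_le_one, of "(\<Sum>i\<in>I. t i * Y \<omega> i) + c"] V[OF that]
        by (simp add: abs_mult)
    qed measurable
    then show ?thesis by (simp add: mult_ac)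
  qed
  have Uw: "\<bar>U n \<omega> * w k j (X n \<omega> i)\<bar> \<le> D" if "\<omega> \<in> space P" for n \<omega> k j
    using mult_mono[OF U[OF that, of n] w[of k j "X n \<omega> i"]] U[OF that, of n] by (simp add: abs_mult)
  have Vw: "\<bar>V \<omega> * w k j (Y \<omega> i)\<bar> \<le> D" if "\<omega> \<in> space N" for \<omega> k j
    using mult_mono[OF V[OF that] w[of k j "Y \<omega> i"]] V[OF that] by (simp add: abs_mult)
  have term_conv: "(\<lambda>n. \<integral>\<omega>. (U n \<omega> * w k j (X n \<omega> i)) * g ((X n \<omega>)(i := y k j)) \<partial>P)
      \<longlonglongrightarrow> (\<integral>\<omega>. (V \<omega> * w k j (Y \<omega> i)) * g ((Y \<omega>)(i := y k j)) \<partial>N)" for k j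
  proof (rule insert.IH[where g="\<lambda>x. g (x(i := y k j))"])
    show "(\<lambda>n. \<integral>\<omega>. cos ((\<Sum>i\<in>I. t i * X n \<omega> i) + c) \<partial>P) \<longlonglongrightarrow> (\<integral>\<omega>. cos ((\<Sum>i\<in>I. t i * Y \<omega> i) + c) \<partial>N)" for t c
      using insert.prems(7)[of "t(i := 0)" c] unfolding sum_upd[symmetric] by simp
    show "\<bar>g (x(i := y k j)) - g (x'(i := y k j))\<bar> \<le> L * (\<Sum>j\<in>I. \<bar>x j - x' j\<bar>)" for x x'
      by (rule Lipschitz_coord_upd(1)[OF insert.hyps(2,1) g_lip])
  qed (use insert.prems(3-6) Uw Vw Uw_cos g_bdd in auto)
  define h where "h k x = (\<Sum>j<2 * k\<^sup>2 + 1. w k j (x i) * g (x(i := y k j)))" for k x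
  have h_meas [measurable]: "(\<lambda>\<omega>. h k (X n \<omega>)) \<in> borel_measurable P" "(\<lambda>\<omega>. h k (Y \<omega>)) \<in> borel_measurable N" for k n
    unfolding h_def by measurable
  have D0: "D \<ge> 0"
    using U[OF P.not_empty[THEN some_in_eq[THEN iffD2]], of 0] by linarith
  have B0: "B \<ge> 0" using g_bdd[of undefined] by linarith
  \<comment> \<open>Stated for an arbitrary probability space so that it serves the approximating
    fields and the limit alike. The bound does not mention \<open>R\<close>, hence is the same for
    all \<open>n\<close>.\<close>
  have approx: "\<bar>(\<integral>\<omega>. W \<omega> * g (R \<omega>) \<partial>Q) - (\<integral>\<omega>. W \<omega> * h k (R \<omega>) \<partial>Q)\<bar> \<le> D * (L / real k + 2 * B * C / (real k)\<^sup>2)"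
    and h_int: "(\<integral>\<omega>. W \<omega> * h k (R \<omega>) \<partial>Q) = (\<Sum>j<2 * k\<^sup>2 + 1. \<integral>\<omega>. (W \<omega> * w k j (R \<omega> i)) * g ((R \<omega>)(i := y k j)) \<partial>Q)"
    if "k > 0" "prob_space Q" and [measurable]: "(\<lambda>\<omega>. R \<omega> i) \<in> borel_measurable Q" "(\<lambda>\<omega>. g (R \<omega>)) \<in> borel_measurable Q"
      "W \<in> borel_measurable Q" "\<And>s. (\<lambda>\<omega>. g ((R \<omega>)(i := s))) \<in> borel_measurable Q"
      and int: "integrable Q (\<lambda>\<omega>. (R \<omega> i)\<^sup>2)" "(\<integral>\<omega>. (R \<omega> i)\<^sup>2 \<partial>Q) \<le> C" and W: "\<forall>\<omega>\<in>space Q. \<bar>W \<omega>\<bar> \<le> D"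
    for k and Q :: "'c measure" and W and R :: "'c \<Rightarrow> 'i \<Rightarrow> real"
  proof -
    interpret Q: prob_space Q by fact
    have hb: "\<bar>h k x\<bar> \<le> real (2 * k\<^sup>2 + 1) * B" for x
    proof -
      have "\<bar>w k j (x i) * g (x(i := y k j))\<bar> \<le> B" for j
        using mult_mono[OF w[of k j "x i"] g_bdd[of "x(i := y k j)"]] by (simp only: abs_mult mult_1 abs_ge_zero zero_le_one)
      then have "\<bar>h k x\<bar> \<le> (\<Sum>j<2 * k\<^sup>2 + 1. B)"
        unfolding h_def by (intro order_trans[OF sum_abs] sum_mono)
      then show ?thesis by simp
    qed
    have [measurable]: "(\<lambda>\<omega>. h k (R \<omega>)) \<in> borel_measurable Q"
      unfolding h_def by measurable
    have "\<bar>(\<integral>\<omega>. W \<omega> * g (R \<omega>) \<partial>Q) - (\<integral>\<omega>. W \<omega> * h k (R \<omega>) \<partial>Q)\<bar>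
        \<le> (\<integral>\<omega>. D * (L / real k + 2 * B * (R \<omega> i)\<^sup>2 / (real k)\<^sup>2) \<partial>Q)"
    proof (rule Q.expectation_abs_diff_le)
      show "integrable Q (\<lambda>\<omega>. W \<omega> * g (R \<omega>))"
        by (rule Q.integrable_bounded_mult[where D=D and B=B]) (use W g_bdd in auto)
      show "integrable Q (\<lambda>\<omega>. W \<omega> * h k (R \<omega>))"
        by (rule Q.integrable_bounded_mult[where D=D]) (use W hb in auto)
      show "integrable Q (\<lambda>\<omega>. D * (L / real k + 2 * B * (R \<omega> i)\<^sup>2 / (real k)\<^sup>2))"
        using int by auto
      fix \<omega> assume \<omega>: "\<omega> \<in> space Q"
      have "\<bar>g (R \<omega>) - h k (R \<omega>)\<bar> \<le> L / real k + 2 * B * (R \<omega> i)\<^sup>2 / (real k)\<^sup>2"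
        unfolding h_def w_def y_def using Lipschitz_coord_grid_approx[OF insert.hyps(2,1) g_bdd g_lip \<open>k > 0\<close>, of "R \<omega>"] .
      then have "\<bar>W \<omega>\<bar> * \<bar>g (R \<omega>) - h k (R \<omega>)\<bar> \<le> D * (L / real k + 2 * B * (R \<omega> i)\<^sup>2 / (real k)\<^sup>2)"
        using W \<omega> D0 by (intro mult_mono) auto
      then show "\<bar>W \<omega> * g (R \<omega>) - W \<omega> * h k (R \<omega>)\<bar> \<le> D * (L / real k + 2 * B * (R \<omega> i)\<^sup>2 / (real k)\<^sup>2)"
        by (simp add: abs_mult[symmetric] right_diff_distrib)
    qed
    also have "\<dots> = D * (L / real k + 2 * B * (\<integral>\<omega>. (R \<omega> i)\<^sup>2 \<partial>Q) / (real k)\<^sup>2)"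
      using int(1) by (simp add: Q.prob_space)
    also have "\<dots> \<le> D * (L / real k + 2 * B * C / (real k)\<^sup>2)"
      using D0 B0 int(2) by (intro mult_left_mono add_left_mono divide_right_mono) auto
    finally show "\<bar>(\<integral>\<omega>. W \<omega> * g (R \<omega>) \<partial>Q) - (\<integral>\<omega>. W \<omega> * h k (R \<omega>) \<partial>Q)\<bar> \<le> D * (L / real k + 2 * B * C / (real k)\<^sup>2)" .
    have "integrable Q (\<lambda>\<omega>. (W \<omega> * w k j (R \<omega> i)) * g ((R \<omega>)(i := y k j)))" for j
    proof (rule Q.integrable_bounded_mult[where D=D and B=B])
      show "\<bar>W \<omega> * w k j (R \<omega> i)\<bar> \<le> D" if "\<omega> \<in> space Q" for \<omega>
        using mult_mono[OF bspec[OF W that] w[of k j "R \<omega> i"]] D0 by (simp add: abs_mult)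
    qed (use g_bdd in auto)
    then show "(\<integral>\<omega>. W \<omega> * h k (R \<omega>) \<partial>Q) = (\<Sum>j<2 * k\<^sup>2 + 1. \<integral>\<omega>. (W \<omega> * w k j (R \<omega> i)) * g ((R \<omega>)(i := y k j)) \<partial>Q)"
      unfolding h_def sum_distrib_left by (subst Bochner_Integration.integral_sum[symmetric]) (auto simp: mult_ac)
  qed
  have i: "i \<in> insert i I" by simp
  have U': "\<forall>\<omega>\<in>space P. \<bar>U n \<omega>\<bar> \<le> D" and V': "\<forall>\<omega>\<in>space N. \<bar>V \<omega>\<bar> \<le> D" for n
    using U V by auto
  have hP: "(\<integral>\<omega>. U n \<omega> * h k (X n \<omega>) \<partial>P)
      = (\<Sum>j<2 * k\<^sup>2 + 1. \<integral>\<omega>. (U n \<omega> * w k j (X n \<omega> i)) * g ((X n \<omega>)(i := y k j)) \<partial>P)" if "k > 0" for k n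
    by (rule h_int[OF that assms(2) _ _ _ _ _ _ U'])
       (use insert.prems(3)[OF i] insert.prems(5)[OF i] in auto)
  have hN: "(\<integral>\<omega>. V \<omega> * h k (Y \<omega>) \<partial>N)
      = (\<Sum>j<2 * k\<^sup>2 + 1. \<integral>\<omega>. (V \<omega> * w k j (Y \<omega> i)) * g ((Y \<omega>)(i := y k j)) \<partial>N)" if "k > 0" for k
    by (rule h_int[OF that assms(3) _ _ _ _ _ _ V'])
       (use insert.prems(4)[OF i] insert.prems(6)[OF i] in auto)
  \<comment> \<open>The level is written \<open>Suc k\<close> because the grid needs a positive mesh
    parameter.\<close>
  show ?case
  proof (rule LIMSEQ_uniform_approx)
    show "(\<lambda>n. \<integral>\<omega>. U n \<omega> * h (Suc k) (X n \<omega>) \<partial>P) \<longlonglongrightarrow> (\<integral>\<omega>. V \<omega> * h (Suc k) (Y \<omega>) \<partial>N)" for k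
      unfolding hP[OF zero_less_Suc] hN[OF zero_less_Suc] by (intro tendsto_sum term_conv)
    show "\<forall>\<^sub>F n in sequentially. \<bar>(\<integral>\<omega>. U n \<omega> * g (X n \<omega>) \<partial>P) - (\<integral>\<omega>. U n \<omega> * h (Suc k) (X n \<omega>) \<partial>P)\<bar>
        \<le> D * (L / real (Suc k) + 2 * B * C / (real (Suc k))\<^sup>2)" for k
      by (intro always_eventually allI approx[OF zero_less_Suc assms(2) _ _ _ _ _ _ U'])
         (use insert.prems(3)[OF i] insert.prems(5)[OF i] in auto)
    show "\<bar>(\<integral>\<omega>. V \<omega> * g (Y \<omega>) \<partial>N) - (\<integral>\<omega>. V \<omega> * h (Suc k) (Y \<omega>) \<partial>N)\<bar>
        \<le> D * (L / real (Suc k) + 2 * B * C / (real (Suc k))\<^sup>2)" for k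
      by (rule approx[OF zero_less_Suc assms(3) _ _ _ _ _ _ V'])
         (use insert.prems(4)[OF i] insert.prems(6)[OF i] in auto)
    have "(\<lambda>k. D * (L / real k + 2 * B * C / (real k)\<^sup>2)) \<longlonglongrightarrow> 0"
      by (rule tendsto_mult_right_zero[OF tendsto_over_n_add_over_n_square])
    then show "(\<lambda>k. D * (L / real (Suc k) + 2 * B * C / (real (Suc k))\<^sup>2)) \<longlonglongrightarrow> 0"
      by (rule LIMSEQ_Suc)
  qed (rule tendsto_const)
qed

lemma finite_dim_cos_conv:
  fixes X :: "nat \<Rightarrow> 'a \<Rightarrow> 'i \<Rightarrow> real" and Y :: "'b \<Rightarrow> 'i \<Rightarrow> real"
  assumes "finite I" "prob_space P" "prob_space N"
    and "\<And>n i. i \<in> I \<Longrightarrow> (\<lambda>\<omega>. X n \<omega> i) \<in> borel_measurable P" "\<And>i. i \<in> I \<Longrightarrow> (\<lambda>\<omega>. Y \<omega> i) \<in> borel_measurable N"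
    and "\<And>n i. i \<in> I \<Longrightarrow> integrable P (\<lambda>\<omega>. (X n \<omega> i)\<^sup>2)" "\<And>i. i \<in> I \<Longrightarrow> integrable N (\<lambda>\<omega>. (Y \<omega> i)\<^sup>2)"
    and "\<And>n i. i \<in> I \<Longrightarrow> (\<integral>\<omega>. (X n \<omega> i)\<^sup>2 \<partial>P) \<le> C" "\<And>i. i \<in> I \<Longrightarrow> (\<integral>\<omega>. (Y \<omega> i)\<^sup>2 \<partial>N) \<le> C"
    and "\<And>t c. (\<lambda>n. \<integral>\<omega>. cos ((\<Sum>i\<in>I. t i * X n \<omega> i) + c) \<partial>P) \<longlonglongrightarrow> (\<integral>\<omega>. cos ((\<Sum>i\<in>I. t i * Y \<omega> i) + c) \<partial>N)"
    and "\<And>x. \<bar>g x\<bar> \<le> B" "\<And>x y. \<bar>g x - g y\<bar> \<le> L * (\<Sum>i\<in>I. \<bar>x i - y i\<bar>)"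
  shows "(\<lambda>n. \<integral>\<omega>. g (X n \<omega>) \<partial>P) \<longlonglongrightarrow> (\<integral>\<omega>. g (Y \<omega>) \<partial>N)"
proof -
  have "(\<lambda>n. \<integral>\<omega>. 1 * g (X n \<omega>) \<partial>P) \<longlonglongrightarrow> (\<integral>\<omega>. 1 * g (Y \<omega>) \<partial>N)"
    by (rule weighted_finite_dim_cos_conv[OF assms(1-10) _ _ _ _ _ assms(11,12), where D = 1])
       (use assms(10) in auto)
  then show ?thesis by simp
qed

section \<open>A central limit theorem for bounded summands\<close>

context prob_space
begin

lemma indep_vars_pair_expectation:
  fixes X :: "'i \<Rightarrow> 'a \<Rightarrow> real"
  assumes indep: "indep_vars (\<lambda>_. borel) X I" and "i \<in> I" "j \<in> I" "i \<noteq> j"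
    and int: "\<And>i. i \<in> I \<Longrightarrow> integrable M (X i)"
  shows "integrable M (\<lambda>\<omega>. X i \<omega> * X j \<omega>)"
    "expectation (\<lambda>\<omega>. X i \<omega> * X j \<omega>) = expectation (X i) * expectation (X j)"
proof -
  have "indep_vars (\<lambda>_. borel) X {i, j}"
    by (rule indep_vars_subset[OF indep]) (use assms in auto)
  from indep_vars_integrable[OF _ this] indep_vars_lebesgue_integral[OF _ this]
  show "integrable M (\<lambda>\<omega>. X i \<omega> * X j \<omega>)"
    "expectation (\<lambda>\<omega>. X i \<omega> * X j \<omega>) = expectation (X i) * expectation (X j)"
    using assms by auto
qed

lemma indep_sum_second_moment:
  fixes X :: "'i \<Rightarrow> 'a \<Rightarrow> real"
  assumes indep: "indep_vars (\<lambda>_. borel) X I" and A: "finite A" "A \<subseteq> I"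
    and sq: "\<And>i. i \<in> I \<Longrightarrow> integrable M (\<lambda>\<omega>. (X i \<omega>)\<^sup>2)"
    and mean: "\<And>i. i \<in> I \<Longrightarrow> expectation (X i) = 0"
  shows "integrable M (\<lambda>\<omega>. (\<Sum>i\<in>A. X i \<omega>)\<^sup>2)"
    "expectation (\<lambda>\<omega>. (\<Sum>i\<in>A. X i \<omega>)\<^sup>2) = (\<Sum>i\<in>A. expectation (\<lambda>\<omega>. (X i \<omega>)\<^sup>2))"
proof -
  have rv: "X i \<in> borel_measurable M" if "i \<in> I" for i
    using indep that by (auto simp: indep_vars_def)
  have int: "integrable M (X i)" if "i \<in> I" for i
    using square_integrable_imp_integrable[OF rv[OF that] sq[OF that]] .
  have pair: "integrable M (\<lambda>\<omega>. X i \<omega> * X j \<omega>)"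
    "expectation (\<lambda>\<omega>. X i \<omega> * X j \<omega>) = (if i = j then expectation (\<lambda>\<omega>. (X i \<omega>)\<^sup>2) else 0)"
    if "i \<in> A" "j \<in> A" for i j
    using indep_vars_pair_expectation[OF indep _ _ _ int, of i j] sq[of i] mean[of i] that A
    by (auto simp: power2_eq_square)
  have eq: "(\<Sum>i\<in>A. X i \<omega>)\<^sup>2 = (\<Sum>i\<in>A. \<Sum>j\<in>A. X i \<omega> * X j \<omega>)" for \<omega>
    by (simp add: power2_eq_square sum_product)
  show "integrable M (\<lambda>\<omega>. (\<Sum>i\<in>A. X i \<omega>)\<^sup>2)"
    unfolding eq by (intro Bochner_Integration.integrable_sum pair)
  have "expectation (\<lambda>\<omega>. (\<Sum>i\<in>A. X i \<omega>)\<^sup>2) = (\<Sum>i\<in>A. \<Sum>j\<in>A. expectation (\<lambda>\<omega>. X i \<omega> * X j \<omega>))"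
    unfolding eq using pair(1)
    by (subst Bochner_Integration.integral_sum, auto intro!: Bochner_Integration.integrable_sum sum.cong Bochner_Integration.integral_sum)
  also have "\<dots> = (\<Sum>i\<in>A. expectation (\<lambda>\<omega>. (X i \<omega>)\<^sup>2))"
    using A by (intro sum.cong) (simp_all add: pair(2) sum.delta)
  finally show "expectation (\<lambda>\<omega>. (\<Sum>i\<in>A. X i \<omega>)\<^sup>2) = (\<Sum>i\<in>A. expectation (\<lambda>\<omega>. (X i \<omega>)\<^sup>2))" .
qed

lemma expectation_cos_char:
  assumes [measurable]: "X \<in> borel_measurable M"
  shows "expectation (\<lambda>\<omega>. cos (X \<omega> + c)) = Re (cis c * char (distr M borel X) 1)"
proof -
  have eq: "cis c * iexp (X \<omega>) = cis (X \<omega> + c)" for \<omega>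
    using cis_mult[of c "X \<omega>"] cis_conv_exp[of "X \<omega>"] by (simp add: add.commute)
  have "cis c * char (distr M borel X) 1 = (CLINT \<omega>|M. cis c * iexp (X \<omega>))"
    by (simp add: char_def integral_distr)
  also have "\<dots> = (CLINT \<omega>|M. cis (X \<omega> + c))"
    by (intro Bochner_Integration.integral_cong) (use eq in auto)
  finally have "Re (cis c * char (distr M borel X) 1) = Re (CLINT \<omega>|M. cis (X \<omega> + c))"
    by simp
  also have "\<dots> = (\<integral>\<omega>. Re (cis (X \<omega> + c)) \<partial>M)"
    by (rule integral_Re[symmetric], rule integrable_const_bound[where B=1]) 
       (auto simp: cis_conv_exp)
  finally show ?thesis by simp
qed

end

text \<open>The upper bound follows after multiplication by \<open>1 + a\<close>:
  \<open>(1 + a) * exp (- a) \<le> 1\<close>, while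
  \<open>(1 + a) * (1 - a + a\<^sup>2) = 1 + a ^ 3 \<ge> 1\<close>.\<close>

lemma exp_minus_approx:
  fixes a :: real
  assumes "a \<ge> 0"
  shows "\<bar>exp (- a) - (1 - a)\<bar> \<le> a\<^sup>2"
proof -
  have "1 - a \<le> exp (- a)"
    using exp_ge_add_one_self[of "- a"] by simp
  moreover have "exp (- a) \<le> 1 - a + a\<^sup>2"
  proof -
    have "(1 + a) * exp (- a) \<le> exp a * exp (- a)"
      using exp_ge_add_one_self[of a] by (intro mult_right_mono) auto
    then have "(1 + a) * exp (- a) \<le> 1"
      by (simp add: exp_minus)
    also have "1 \<le> (1 + a) * (1 - a + a\<^sup>2)"
      using assms by (simp add: algebra_simps power2_eq_square)
    finally show ?thesis
      using assms by (subst (asm) mult_le_cancel_left_pos) auto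
  qed
  ultimately show ?thesis by (simp add: abs_le_iff)
qed

text \<open>The summands need not be identically distributed and only their averaged variance
  converges. The product of their characteristic functions is therefore compared factor by factor
  with Gaussian factors of the same variances, whose product is explicit and depends on the averaged
  variance alone. A limit \<open>v = 0\<close> is covered as well.\<close>

lemma (in prob_space) clt_bounded_char:
  fixes X :: "nat \<Rightarrow> 'a \<Rightarrow> real"
  assumes indep: "indep_vars (\<lambda>_. borel) X UNIV"
    and bdd: "\<And>j \<omega>. \<omega> \<in> space M \<Longrightarrow> \<bar>X j \<omega>\<bar> \<le> C"
    and mean: "\<And>j. expectation (X j) = 0"
    and var: "(\<lambda>n. (\<Sum>j<n. expectation (\<lambda>\<omega>. (X j \<omega>)\<^sup>2)) / real n) \<longlonglongrightarrow> v"
  shows "(\<lambda>n. char (distr M borel (\<lambda>\<omega>. 1 / sqrt (real n) * (\<Sum>j<n. X j \<omega>))) 1)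
    \<longlonglongrightarrow> complex_of_real (exp (- v / 2))"
proof -
  have [measurable]: "X j \<in> borel_measurable M" for j
    using indep by (auto simp: indep_vars_def)
  have C0: "C \<ge> 0"
    using bdd[OF not_empty[THEN some_in_eq[THEN iffD2]], of 0] by linarith
  define s where "s j = expectation (\<lambda>\<omega>. (X j \<omega>)\<^sup>2)" for j
  have sq_bdd: "(X j \<omega>)\<^sup>2 \<le> C\<^sup>2" if "\<omega> \<in> space M" for j \<omega>
    using bdd[OF that, of j] C0 by (simp add: abs_le_square_iff[symmetric])
  have sq_int: "integrable M (\<lambda>\<omega>. (X j \<omega>)\<^sup>2)" for j
    using sq_bdd by (intro integrable_const_bound[where B="C\<^sup>2"]) auto
  have int: "integrable M (X j)" for j
    using bdd by (intro integrable_const_bound[where B=C]) auto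
  have s: "0 \<le> s j" "s j \<le> C\<^sup>2" for j
    using integral_mono[OF sq_int integrable_const, of j "C\<^sup>2"] sq_bdd by (auto simp: s_def prob_space)
  let ?z = "\<lambda>n j. char (distr M borel (X j)) (1 / sqrt (real n))"
  let ?w = "\<lambda>n j. complex_of_real (exp (- (s j / (2 * real n))))"
  have char_sum: "char (distr M borel (\<lambda>\<omega>. 1 / sqrt (real n) * (\<Sum>j<n. X j \<omega>))) 1 = (\<Prod>j<n. ?z n j)" for n
  proof -
    have "char (distr M borel (\<lambda>\<omega>. 1 / sqrt (real n) * (\<Sum>j<n. X j \<omega>))) 1
        = char (distr M borel (\<lambda>\<omega>. \<Sum>j<n. X j \<omega>)) (1 / sqrt (real n))"
      by (simp add: char_def integral_distr)
    then show ?thesis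
      using char_distr_sum[OF indep_vars_subset[OF indep], of "{..<n}"] by simp
  qed
  \<comment> \<open>Both factors are compared with the common second-order expansion
    \<open>1 - s j / (2 * n)\<close>: the characteristic function by its third-order remainder,
    where the bound \<open>C\<close> replaces a third moment, the Gaussian factor by
    \<open>exp_minus_approx\<close>.\<close>
  have bound: "cmod (?z n j - ?w n j) \<le> (C ^ 3 / 6) * (1 / sqrt (real n)) ^ 3 + (C\<^sup>2)\<^sup>2 / (4 * (real n)\<^sup>2)"
    if n: "n > 0" for n j
  proof -
    let ?t = "1 / sqrt (real n)"
    have "cmod (?z n j - (1 - ?t\<^sup>2 * s j / 2)) \<le>
        (?t\<^sup>2 / 6) * expectation (\<lambda>\<omega>. min (6 * (X j \<omega>)\<^sup>2) (\<bar>?t\<bar> * \<bar>X j \<omega>\<bar>^3))"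
      by (rule char_approx3') (auto simp: int sq_int mean s_def)
    also have "\<dots> \<le> (?t\<^sup>2 / 6) * (\<integral>\<omega>. \<bar>?t\<bar> * C ^ 3 \<partial>M)"
    proof (intro mult_left_mono integral_mono)
      show "integrable M (\<lambda>\<omega>. min (6 * (X j \<omega>)\<^sup>2) (\<bar>?t\<bar> * \<bar>X j \<omega>\<bar>^3))"
        using sq_bdd by (intro integrable_const_bound[where B="6 * C\<^sup>2"] AE_I2) (auto intro: min.coboundedI1)
      show "min (6 * (X j \<omega>)\<^sup>2) (\<bar>?t\<bar> * \<bar>X j \<omega>\<bar>^3) \<le> \<bar>?t\<bar> * C ^ 3" if "\<omega> \<in> space M" for \<omega>
        using bdd[OF that, of j] by (intro min.coboundedI2 mult_left_mono power_mono) auto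
    qed auto
    also have "\<dots> = (C ^ 3 / 6) * ?t ^ 3"
      by (simp add: prob_space power3_eq_cube power2_eq_square)
    finally have 1: "cmod (?z n j - (1 - ?t\<^sup>2 * s j / 2)) \<le> (C ^ 3 / 6) * ?t ^ 3" .
    have t2: "?t\<^sup>2 * s j / 2 = s j / (2 * real n)"
      by (simp add: power_divide)
    have "cmod (?w n j - (1 - ?t\<^sup>2 * s j / 2)) = \<bar>exp (- (s j / (2 * real n))) - (1 - s j / (2 * real n))\<bar>"
      unfolding t2 by (metis norm_of_real of_real_1 of_real_diff)
    also have "\<dots> \<le> (s j / (2 * real n))\<^sup>2"
      using s by (intro exp_minus_approx) auto
    also have "\<dots> \<le> (C\<^sup>2)\<^sup>2 / (4 * (real n)\<^sup>2)"
      using power_mono[OF s(2)[of j] s(1)[of j], of 2] by (simp add: power_divide power_mult_distrib divide_right_mono)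
    finally have 2: "cmod (?w n j - (1 - ?t\<^sup>2 * s j / 2)) \<le> (C\<^sup>2)\<^sup>2 / (4 * (real n)\<^sup>2)" .
    show ?thesis
      using 1 2 norm_triangle_ineq4[of "?z n j - (1 - ?t\<^sup>2 * s j / 2)" "?w n j - (1 - ?t\<^sup>2 * s j / 2)"] by simp
  qed
  \<comment> \<open>All factors lie in the closed unit disc, so the products differ by at most the
    sum of the differences. Summing \<open>n\<close> errors of orders \<open>n\<close> to the powers
    \<open>-3/2\<close> and \<open>-2\<close> still leaves something that vanishes.\<close>
  have prod: "cmod ((\<Prod>j<n. ?z n j) - (\<Prod>j<n. ?w n j)) \<le> C ^ 3 / 6 * sqrt (1 / real n) + (C\<^sup>2)\<^sup>2 / 4 * (1 / real n)"
    if n: "n > 0" for n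
  proof -
    have "cmod ((\<Prod>j<n. ?z n j) - (\<Prod>j<n. ?w n j)) \<le> (\<Sum>j<n. cmod (?z n j - ?w n j))"
    proof (rule norm_prod_diff)
      show "cmod (?z n j) \<le> 1" for j
        by (rule real_distribution.cmod_char_le_1[OF real_distribution_distr]) auto
      show "cmod (?w n j) \<le> 1" for j
        using s by auto
    qed
    also have "\<dots> \<le> (\<Sum>j<n. (C ^ 3 / 6) * (1 / sqrt (real n)) ^ 3 + (C\<^sup>2)\<^sup>2 / (4 * (real n)\<^sup>2))"
      by (intro sum_mono bound n)
    also have "\<dots> = C ^ 3 / 6 * (real n * (1 / sqrt (real n)) ^ 3) + (C\<^sup>2)\<^sup>2 / 4 * (real n / (real n)\<^sup>2)"
      by (simp add: algebra_simps)
    also have "real n * (1 / sqrt (real n)) ^ 3 = sqrt (1 / real n)"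
      using n by (simp add: power3_eq_cube real_sqrt_divide)
    also have "real n / (real n)\<^sup>2 = 1 / real n"
      using n by (simp add: power2_eq_square)
    finally show ?thesis .
  qed
  have diff: "(\<lambda>n. (\<Prod>j<n. ?z n j) - (\<Prod>j<n. ?w n j)) \<longlonglongrightarrow> 0"
  proof (rule Lim_null_comparison)
    show "\<forall>\<^sub>F n in sequentially. cmod ((\<Prod>j<n. ?z n j) - (\<Prod>j<n. ?w n j)) \<le>
        C ^ 3 / 6 * sqrt (1 / real n) + (C\<^sup>2)\<^sup>2 / 4 * (1 / real n)"
      using eventually_gt_at_top[of 0] by eventually_elim (rule prod)
    have "(\<lambda>n. C ^ 3 / 6 * sqrt (1 / real n) + (C\<^sup>2)\<^sup>2 / 4 * (1 / real n)) \<longlonglongrightarrow>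
        C ^ 3 / 6 * sqrt 0 + (C\<^sup>2)\<^sup>2 / 4 * 0"
      by (intro tendsto_intros lim_const_over_n)
    then show "(\<lambda>n. C ^ 3 / 6 * sqrt (1 / real n) + (C\<^sup>2)\<^sup>2 / 4 * (1 / real n)) \<longlonglongrightarrow> 0"
      by simp
  qed
  have w_prod: "(\<Prod>j<n. ?w n j) = complex_of_real (exp (- ((\<Sum>j<n. s j) / real n) / 2))" for n
    by (simp add: exp_sum[symmetric] sum_negf sum_divide_distrib[symmetric] flip: of_real_prod)
  have "(\<lambda>n. \<Prod>j<n. ?w n j) \<longlonglongrightarrow> complex_of_real (exp (- v / 2))"
    unfolding w_prod using var unfolding s_def by (intro tendsto_intros) auto
  from tendsto_add[OF diff this] show ?thesis
    unfolding char_sum by simp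
qed

lemma (in prob_space) clt_bounded_cos:
  fixes X :: "nat \<Rightarrow> 'a \<Rightarrow> real"
  assumes indep: "indep_vars (\<lambda>_. borel) X UNIV"
    and bdd: "\<And>j \<omega>. \<omega> \<in> space M \<Longrightarrow> \<bar>X j \<omega>\<bar> \<le> C"
    and mean: "\<And>j. expectation (X j) = 0"
    and var: "(\<lambda>n. (\<Sum>j<n. expectation (\<lambda>\<omega>. (X j \<omega>)\<^sup>2)) / real n) \<longlonglongrightarrow> v"
  shows "(\<lambda>n. expectation (\<lambda>\<omega>. cos (1 / sqrt (real n) * (\<Sum>j<n. X j \<omega>) + c))) \<longlonglongrightarrow> exp (- v / 2) * cos c"
proof -
  have [measurable]: "X j \<in> borel_measurable M" for j
    using indep by (auto simp: indep_vars_def)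
  have "(\<lambda>n. Re (cis c * char (distr M borel (\<lambda>\<omega>. 1 / sqrt (real n) * (\<Sum>j<n. X j \<omega>))) 1))
      \<longlonglongrightarrow> Re (cis c * complex_of_real (exp (- v / 2)))"
    by (intro tendsto_intros clt_bounded_char[OF assms])
  then show ?thesis
    by (subst expectation_cos_char) (auto simp: mult.commute)
qed

section \<open>Positive semidefinite kernels\<close>

text \<open>Points are indexed by a sequence, hence may be repeated. A further point can thus be
  appended to a quadratic form without asking whether it already occurs.\<close>

definition pos_kernel :: "('x \<Rightarrow> 'x \<Rightarrow> real) \<Rightarrow> bool" where
  "pos_kernel K \<longleftrightarrow> (\<forall>x y. K x y = K y x) \<and>
     (\<forall>(n::nat) c x. 0 \<le> (\<Sum>i<n. \<Sum>j<n. c i * c j * K (x i) (x j)))"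

lemma pos_kernel_sym: "pos_kernel K \<Longrightarrow> K x y = K y x"
  by (simp add: pos_kernel_def)

lemma pos_kernel_nonneg:
  fixes n :: nat
  shows "pos_kernel K \<Longrightarrow> 0 \<le> (\<Sum>i<n. \<Sum>j<n. c i * c j * K (x i) (x j))"
  by (simp add: pos_kernel_def)

lemma pos_kernel_pair:
  assumes "pos_kernel K"
  shows "0 \<le> s\<^sup>2 * K x x + 2 * s * t * K x y + t\<^sup>2 * K y y"
proof -
  have "0 \<le> (\<Sum>i<2::nat. \<Sum>j<2::nat. (if i = 0 then s else t) * (if j = 0 then s else t) *
      K (if i = 0 then x else y) (if j = 0 then x else y))"
    by (rule pos_kernel_nonneg[OF assms, where c="\<lambda>i. if i = 0 then s else t" and x="\<lambda>i. if i = 0 then x else y"])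
  then show ?thesis
    using pos_kernel_sym[OF assms, of x y]
    by (simp add: numeral_2_eq_2 power2_eq_square algebra_simps)
qed

lemma pos_kernel_diag: "pos_kernel K \<Longrightarrow> 0 \<le> K x x"
  using pos_kernel_pair[of K 1 x 0 x] by simp

lemma pos_kernel_abs_le: "pos_kernel K \<Longrightarrow> \<bar>K x y\<bar> \<le> (K x x + K y y) / 2"
  using pos_kernel_pair[of K 1 x 1 y] pos_kernel_pair[of K 1 x "- 1" y] by (simp add: abs_le_iff)

text \<open>With \<open>K a a = 0\<close> the quadratic form on \<open>a\<close> and
  \<open>x\<close> is affine in the coefficient of \<open>a\<close>. Being bounded below, it must
  have slope zero; otherwise the coefficient used in the proof gives it the value
  \<open>-1\<close>.\<close>

lemma pos_kernel_null:
  assumes K: "pos_kernel K" and "K a a = 0"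
  shows "K x a = 0"
proof (rule ccontr)
  assume "K x a \<noteq> 0"
  then have "2 * (- (K x x + 1) / (2 * K x a)) * K a x = - (K x x + 1)"
    using pos_kernel_sym[OF K, of x a] by simp
  moreover have "0 \<le> 2 * (- (K x x + 1) / (2 * K x a)) * K a x + K x x"
    using pos_kernel_pair[OF K, of "- (K x x + 1) / (2 * K x a)" a 1 x] assms(2) by simp
  ultimately show False by linarith
qed

text \<open>Schur complement: the form of the residual kernel is the minimum of the form of
  \<open>K\<close> over the coefficient of one appended point \<open>a\<close>. For a Gaussian field
  this kernel is the covariance that remains after conditioning on the value at
  \<open>a\<close>.\<close>

lemma pos_kernel_schur:
  assumes K: "pos_kernel K"
  shows "pos_kernel (\<lambda>x y. K x y - K x a * K y a / K a a)"
proof (cases "K a a = 0")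
  case True
  then show ?thesis using K by (simp add: pos_kernel_null)
next
  case False
  have "0 \<le> (\<Sum>i<n. \<Sum>j<n. c i * c j * (K (x i) (x j) - K (x i) a * K (x j) a / K a a))"
    for n :: nat and c x
  proof -
    define L where "L = (\<Sum>i<n. c i * K (x i) a)"
    define Q where "Q = (\<Sum>i<n. \<Sum>j<n. c i * c j * K (x i) (x j))"
    \<comment> \<open>The minimiser of \<open>Q + 2 * s * L + s\<^sup>2 * K a a\<close> in
      \<open>s\<close>.\<close>
    define s where "s = - L / K a a"
    define c' where "c' i = (if i < n then c i else s)" for i
    define x' where "x' i = (if i < n then x i else a)" for i
    have "0 \<le> (\<Sum>i<Suc n. \<Sum>j<Suc n. c' i * c' j * K (x' i) (x' j))"
      by (rule pos_kernel_nonneg[OF K])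
    also have "\<dots> = Q + s * L + (s * L + s * s * K a a)"
    proof -
      have "(\<Sum>i<n. \<Sum>j<n. c' i * c' j * K (x' i) (x' j)) = Q"
        unfolding Q_def by (intro sum.cong) (auto simp: c'_def x'_def)
      moreover have "(\<Sum>i<n. c' i * c' n * K (x' i) (x' n)) = s * L"
        unfolding L_def sum_distrib_left by (intro sum.cong) (auto simp: c'_def x'_def)
      moreover have "(\<Sum>j<n. c' n * c' j * K (x' n) (x' j)) = s * L"
        unfolding L_def sum_distrib_left
        by (intro sum.cong) (auto simp: c'_def x'_def pos_kernel_sym[OF K, of a])
      moreover have "c' n * c' n * K (x' n) (x' n) = s * s * K a a"
        by (simp add: c'_def x'_def)
      ultimately show ?thesis
        unfolding sum.lessThan_Suc sum.distrib by simp
    qed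
    also have "\<dots> = Q - L * L / K a a"
      using False by (simp add: s_def field_simps)
    also have "\<dots> = (\<Sum>i<n. \<Sum>j<n. c i * c j * (K (x i) (x j) - K (x i) a * K (x j) a / K a a))"
      unfolding Q_def L_def sum_product sum_divide_distrib
      unfolding sum_subtractf[symmetric]
      by (intro sum.cong refl) (simp add: right_diff_distrib mult_ac)
    finally show ?thesis .
  qed
  then show ?thesis
    using K unfolding pos_kernel_def by (simp add: mult.commute)
qed

text \<open>Cholesky decomposition of \<open>K\<close> along the points \<open>a 0, a 1, \<dots>\<close>: \<open>chol K a n\<close> is the
  residual kernel after \<open>n\<close> steps. Where its diagonal vanishes at \<open>a n\<close>, the division by zero makes the step trivial.\<close>

primrec chol :: "('x \<Rightarrow> 'x \<Rightarrow> real) \<Rightarrow> (nat \<Rightarrow> 'x) \<Rightarrow> nat \<Rightarrow> 'x \<Rightarrow> 'x \<Rightarrow> real" where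
  "chol K a 0 = K"
| "chol K a (Suc n) = (\<lambda>x y. chol K a n x y - chol K a n x (a n) * chol K a n y (a n) / chol K a n (a n) (a n))"

text \<open>A column of the Cholesky factor: the residual covariance with the pivot point, scaled by
  the residual standard deviation there. It is the zero function if the pivot vanishes.\<close>

definition chol_vec :: "('x \<Rightarrow> 'x \<Rightarrow> real) \<Rightarrow> (nat \<Rightarrow> 'x) \<Rightarrow> nat \<Rightarrow> 'x \<Rightarrow> real" where
  "chol_vec K a n x = chol K a n x (a n) / sqrt (chol K a n (a n) (a n))"

context
  fixes K :: "'x \<Rightarrow> 'x \<Rightarrow> real" and a :: "nat \<Rightarrow> 'x"
  assumes K: "pos_kernel K"
begin

lemma pos_kernel_chol: "pos_kernel (chol K a n)"
  by (induction n) (simp_all add: K pos_kernel_schur)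

lemma chol_Suc: "chol K a (Suc n) x y = chol K a n x y - chol_vec K a n x * chol_vec K a n y"
  using pos_kernel_diag[OF pos_kernel_chol[of n], of "a n"]
  by (simp add: chol_vec_def power2_eq_square[symmetric])

lemma chol_eq: "chol K a n x y = K x y - (\<Sum>k<n. chol_vec K a k x * chol_vec K a k y)"
  by (induction n) (simp_all only: chol_Suc chol.simps(1), simp_all)

text \<open>The step at \<open>a j\<close> removes all residual covariance with \<open>a j\<close>,
  and a later step at \<open>a n\<close> does not bring it back, since the correction at
  \<open>a j\<close> is proportional to the residual covariance of \<open>a j\<close> and
  \<open>a n\<close>, which is already zero.\<close>

lemma chol_null: "j < n \<Longrightarrow> chol K a n x (a j) = 0"
proof (induction n arbitrary: x)
  case (Suc n)
  show ?case
  proof (cases "j = n")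
    case True
    then show ?thesis
      using pos_kernel_null[OF pos_kernel_chol[of n], of "a n"] by simp
  next
    case False
    then have "chol K a n x (a j) = 0" "chol K a n (a j) (a n) = 0"
      using Suc by (auto simp: pos_kernel_sym[OF pos_kernel_chol[of n], of "a j"])
    then show ?thesis by simp
  qed
qed simp

text \<open>The residual covariances with a processed point \<open>a j\<close> vanish, so the
  residual variance at \<open>x\<close> equals the residual squared distance of \<open>x\<close> and
  \<open>a j\<close>. This is the original squared distance minus a sum of squares.\<close>

lemma chol_diag_le_dist:
  assumes "j < n"
  shows "chol K a n x x \<le> K x x - 2 * K x (a j) + K (a j) (a j)"
proof -
  have "chol K a n x x = chol K a n x x - 2 * chol K a n x (a j) + chol K a n (a j) (a j)"
    using chol_null[OF assms] by simp
  also have "\<dots> = K x x - 2 * K x (a j) + K (a j) (a j) -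
      (\<Sum>k<n. (chol_vec K a k x - chol_vec K a k (a j))\<^sup>2)"
  proof -
    have "(\<Sum>k<n. (chol_vec K a k x - chol_vec K a k (a j))\<^sup>2) =
        (\<Sum>k<n. chol_vec K a k x * chol_vec K a k x) - 2 * (\<Sum>k<n. chol_vec K a k x * chol_vec K a k (a j))
        + (\<Sum>k<n. chol_vec K a k (a j) * chol_vec K a k (a j))"
      unfolding sum_distrib_left sum_subtractf[symmetric] sum.distrib[symmetric]
      by (intro sum.cong refl) (simp add: power2_eq_square algebra_simps)
    then show ?thesis by (simp add: chol_eq)
  qed
  also have "\<dots> \<le> K x x - 2 * K x (a j) + K (a j) (a j)"
    by (simp add: sum_nonneg)
  finally show ?thesis .
qed

lemma chol_diag_nonneg: "0 \<le> chol K a n x x"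
  by (rule pos_kernel_diag[OF pos_kernel_chol])

lemma chol_diag_antimono: "m \<le> n \<Longrightarrow> chol K a n x x \<le> chol K a m x x"
  by (induction n rule: dec_induct)
     (simp_all only: chol_Suc, auto simp: power2_eq_square[symmetric] intro: order_trans[rotated])

lemma sum_chol_vec_sq: "(\<Sum>k\<in>{m..<n}. (chol_vec K a k x)\<^sup>2) = chol K a m x x - chol K a n x x" if "m \<le> n"
  using that by (induction n rule: dec_induct) (simp_all only: chol_Suc, auto simp: power2_eq_square)

lemma chol_vec_sq_le: "(chol_vec K a k x)\<^sup>2 \<le> K x x"
  using chol_diag_nonneg[of "Suc k" x] chol_diag_antimono[of 0 k x]
  by (simp only: chol_Suc power2_eq_square) simp

end

text \<open>The squared distance \<open>K x x - 2 * K x y + K y y\<close> is continuous in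
  \<open>y\<close> and vanishes at \<open>y = x\<close>, so some point of the dense sequence makes
  it smaller than \<open>e\<close>. It bounds the residual variance at \<open>x\<close> from the
  step after that point on.\<close>

lemma chol_diag_tendsto_0:
  fixes K :: "'x::topological_space \<Rightarrow> 'x \<Rightarrow> real"
  assumes K: "pos_kernel K" and cont: "continuous_on UNIV (\<lambda>(x, y). K x y)"
    and dense: "\<And>U. open U \<Longrightarrow> U \<noteq> {} \<Longrightarrow> \<exists>j. a j \<in> U"
  shows "(\<lambda>n. chol K a n x x) \<longlonglongrightarrow> 0"
proof (rule LIMSEQ_I)
  fix e :: real assume e: "e > 0"
  have cont': "continuous_on UNIV (\<lambda>y. K x x - 2 * K x y + K y y)"
    by (intro continuous_intros continuous_on_compose2[OF cont, where f="\<lambda>y. (x, y)", simplified]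
        continuous_on_compose2[OF cont, where f="\<lambda>y. (y, y)", simplified])
  then have "open {y. K x x - 2 * K x y + K y y < e}"
    by (intro open_Collect_less continuous_on_const)
  moreover have "x \<in> {y. K x x - 2 * K x y + K y y < e}"
    using e by simp
  ultimately obtain j where j: "K x x - 2 * K x (a j) + K (a j) (a j) < e"
    using dense by blast
  have "norm (chol K a n x x - 0) < e" if "n \<ge> Suc j" for n
    using chol_diag_le_dist[OF K, of j n a x] chol_diag_nonneg[OF K, of a n x] j that by auto
  then show "\<exists>no. \<forall>n\<ge>no. norm (chol K a n x x - 0) < e" by blast
qed

text \<open>The residual kernel is positive semidefinite, so its off-diagonal values are dominated
  by its diagonal, which tends to zero.\<close>

lemma chol_expansion:
  fixes K :: "'x \<Rightarrow> 'x \<Rightarrow> real"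
  assumes K: "pos_kernel K" and "\<And>x. (\<lambda>n. chol K a n x x) \<longlonglongrightarrow> 0"
  shows "(\<lambda>n. \<Sum>k<n. chol_vec K a k x * chol_vec K a k y) \<longlonglongrightarrow> K x y"
proof -
  have "(\<lambda>n. chol K a n x y) \<longlonglongrightarrow> 0"
  proof (rule Lim_null_comparison)
    show "\<forall>\<^sub>F n in sequentially. norm (chol K a n x y) \<le> (chol K a n x x + chol K a n y y) / 2"
      using pos_kernel_abs_le[OF pos_kernel_chol[OF K, of a]] by (auto simp: always_eventually)
    show "(\<lambda>n. (chol K a n x x + chol K a n y y) / 2) \<longlonglongrightarrow> 0"
      using tendsto_divide[OF tendsto_add[OF assms(2)[of x] assms(2)[of y]] tendsto_const[of 2]] by simp
  qed
  then have "(\<lambda>n. K x y - chol K a n x y) \<longlonglongrightarrow> K x y - 0"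
    by (intro tendsto_intros)
  then show ?thesis by (simp add: chol_eq[OF K])
qed

lemma continuous_on_chol:
  fixes K :: "'x::topological_space \<Rightarrow> 'x \<Rightarrow> real"
  assumes K: "pos_kernel K" and cont: "continuous_on UNIV (\<lambda>(x, y). K x y)"
  shows "continuous_on UNIV (\<lambda>x. chol K a n x y)" "continuous_on UNIV (chol_vec K a n)"
    "continuous_on UNIV (\<lambda>x. chol K a n x x)"
proof -
  have K_cont: "continuous_on UNIV (\<lambda>x. K x y)" for y
    by (rule continuous_on_compose2[OF cont, where f="\<lambda>x. (x, y)", simplified]) (intro continuous_intros)
  have chol_cont: "continuous_on UNIV (\<lambda>x. chol K a n x y)" for n y
    by (induction n arbitrary: y) (auto intro!: continuous_intros K_cont simp: divide_inverse)
  then show "continuous_on UNIV (\<lambda>x. chol K a n x y)" .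
  have vec_cont: "continuous_on UNIV (chol_vec K a n)" for n
    unfolding chol_vec_def divide_inverse by (intro continuous_intros chol_cont)
  then show "continuous_on UNIV (chol_vec K a n)" .
  have "continuous_on UNIV (\<lambda>x. K x x)"
    by (rule continuous_on_compose2[OF cont, where f="\<lambda>x. (x, x)", simplified]) (intro continuous_intros)
  then show "continuous_on UNIV (\<lambda>x. chol K a n x x)"
    unfolding chol_eq[OF K] by (intro continuous_intros vec_cont)
qed

section \<open>Gaussian fields with a given covariance kernel\<close>

lemma summable_half_powers: "summable (\<lambda>m. (1/2::real) ^ m)"
  by (rule summable_geometric) simp

lemma summable_tendsto_real:
  fixes f :: "nat \<Rightarrow> ennreal"
  assumes "(\<Sum>m. f m) < \<infinity>"
  shows "\<And>m. f m < \<infinity>" "summable (\<lambda>m. enn2real (f m))" "(\<lambda>m. enn2real (f m)) \<longlonglongrightarrow> 0"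
proof -
  show fin: "f m < \<infinity>" for m
    using assms ennreal_suminf_lessD[of f \<infinity> m] by simp
  have "(\<Sum>m. ennreal (enn2real (f m))) = (\<Sum>m. f m)"
    using fin by (intro suminf_cong) auto
  then show "summable (\<lambda>m. enn2real (f m))"
    using assms by (intro summable_suminf_not_top) auto
  then show "(\<lambda>m. enn2real (f m)) \<longlonglongrightarrow> 0"
    by (rule summable_LIMSEQ_zero)
qed

context prob_space
begin

lemma expectation_abs_le_sqrt:
  fixes X :: "'a \<Rightarrow> real"
  assumes [measurable]: "X \<in> borel_measurable M" and sq: "integrable M (\<lambda>\<omega>. (X \<omega>)\<^sup>2)"
  shows "integrable M X" "expectation (\<lambda>\<omega>. \<bar>X \<omega>\<bar>) \<le> sqrt (expectation (\<lambda>\<omega>. (X \<omega>)\<^sup>2))"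
proof -
  show int: "integrable M X"
    by (rule square_integrable_imp_integrable[OF _ sq]) simp
  have "0 \<le> variance (\<lambda>\<omega>. \<bar>X \<omega>\<bar>)"
    by simp
  then have "(expectation (\<lambda>\<omega>. \<bar>X \<omega>\<bar>))\<^sup>2 \<le> expectation (\<lambda>\<omega>. (X \<omega>)\<^sup>2)"
    using int sq by (subst (asm) variance_eq) auto
  then show "expectation (\<lambda>\<omega>. \<bar>X \<omega>\<bar>) \<le> sqrt (expectation (\<lambda>\<omega>. (X \<omega>)\<^sup>2))"
    by (rule real_le_rsqrt)
qed

text \<open>The increments have mean absolute value at most \<open>(1/2) ^ m\<close>, the root of
  the assumed bound. Their sum has finite expectation, so it is finite almost surely and the
  sequence telescopes to an absolutely convergent series.\<close>

lemma AE_convergent_of_rapidly_Cauchy: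
  fixes X :: "nat \<Rightarrow> 'a \<Rightarrow> real"
  assumes [measurable]: "\<And>m. X m \<in> borel_measurable M"
    and sq: "\<And>m. integrable M (\<lambda>\<omega>. (X (Suc m) \<omega> - X m \<omega>)\<^sup>2)"
    and le: "\<And>m. expectation (\<lambda>\<omega>. (X (Suc m) \<omega> - X m \<omega>)\<^sup>2) \<le> ((1/2) ^ m)\<^sup>2"
  shows "AE \<omega> in M. convergent (\<lambda>m. X m \<omega>)"
proof -
  have "(\<integral>\<^sup>+\<omega>. ennreal \<bar>X (Suc m) \<omega> - X m \<omega>\<bar> \<partial>M) \<le> ennreal ((1/2) ^ m)" for m
  proof -
    note D = expectation_abs_le_sqrt[OF _ sq[of m]]
    have "(\<integral>\<^sup>+\<omega>. ennreal \<bar>X (Suc m) \<omega> - X m \<omega>\<bar> \<partial>M) = ennreal (\<integral>\<omega>. \<bar>X (Suc m) \<omega> - X m \<omega>\<bar> \<partial>M)"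
      using D(1) by (intro nn_integral_eq_integral) auto
    also have "\<dots> \<le> ennreal ((1/2) ^ m)"
      using D(2) real_sqrt_le_mono[OF le[of m]] by (intro ennreal_leI) auto
    finally show ?thesis .
  qed
  then have "(\<Sum>m. \<integral>\<^sup>+\<omega>. ennreal \<bar>X (Suc m) \<omega> - X m \<omega>\<bar> \<partial>M) \<le> (\<Sum>m. ennreal ((1/2) ^ m))"
    by (intro suminf_le) auto
  also have "\<dots> < \<infinity>"
    by (subst suminf_ennreal2[OF _ summable_half_powers]) (simp_all only: infinity_ennreal_def ennreal_less_top, simp)
  finally have "(\<integral>\<^sup>+\<omega>. (\<Sum>m. ennreal \<bar>X (Suc m) \<omega> - X m \<omega>\<bar>) \<partial>M) \<noteq> \<infinity>"
    by (subst nn_integral_suminf) auto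
  then have "AE \<omega> in M. (\<Sum>m. ennreal \<bar>X (Suc m) \<omega> - X m \<omega>\<bar>) \<noteq> \<infinity>"
    by (intro nn_integral_noteq_infinite) auto
  then show ?thesis
  proof eventually_elim
    case (elim \<omega>)
    have "summable (\<lambda>m. \<bar>X (Suc m) \<omega> - X m \<omega>\<bar>)"
      using elim by (intro summable_suminf_not_top) auto
    then have "convergent (\<lambda>n. \<Sum>m<n. X (Suc m) \<omega> - X m \<omega>)"
      by (rule summable_iff_convergent[THEN iffD1, OF summable_rabs_cancel])
    then have "convergent (\<lambda>n. X 0 \<omega> + (\<Sum>m<n. X (Suc m) \<omega> - X m \<omega>))"
      by (intro convergent_add convergent_const)
    then show ?case
      unfolding sum_lessThan_telescope[of "\<lambda>m. X m \<omega>"] by simp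
  qed
qed

text \<open>Fatou's lemma for squares, with a bound that may vary with the index: the bounds to
  which it is applied exceed their limit by a vanishing term.\<close>

lemma second_moment_Fatou:
  fixes X :: "nat \<Rightarrow> 'a \<Rightarrow> real"
  assumes [measurable]: "\<And>m. X m \<in> borel_measurable M" "Y \<in> borel_measurable M"
    and lim: "AE \<omega> in M. (\<lambda>m. X m \<omega>) \<longlonglongrightarrow> Y \<omega>"
    and sq: "\<And>m. integrable M (\<lambda>\<omega>. (X m \<omega>)\<^sup>2)"
    and le: "\<And>m. expectation (\<lambda>\<omega>. (X m \<omega>)\<^sup>2) \<le> b m" and b: "b \<longlonglongrightarrow> c"
  shows "integrable M (\<lambda>\<omega>. (Y \<omega>)\<^sup>2)" "expectation (\<lambda>\<omega>. (Y \<omega>)\<^sup>2) \<le> c"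
proof -
  have b0: "b m \<ge> 0" for m
    using le[of m] by (rule order_trans[rotated]) simp
  have c0: "c \<ge> 0"
    using b b0 by (intro LIMSEQ_le_const) auto
  have "(\<integral>\<^sup>+\<omega>. ennreal ((Y \<omega>)\<^sup>2) \<partial>M) = (\<integral>\<^sup>+\<omega>. liminf (\<lambda>m. ennreal ((X m \<omega>)\<^sup>2)) \<partial>M)"
  proof (rule nn_integral_cong_AE)
    show "AE \<omega> in M. ennreal ((Y \<omega>)\<^sup>2) = liminf (\<lambda>m. ennreal ((X m \<omega>)\<^sup>2))"
      using lim
    proof eventually_elim
      case (elim \<omega>)
      then have "(\<lambda>m. ennreal ((X m \<omega>)\<^sup>2)) \<longlonglongrightarrow> ennreal ((Y \<omega>)\<^sup>2)"
        by (intro tendsto_ennrealI tendsto_intros)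
      then show ?case by (rule lim_imp_Liminf[OF sequentially_bot, symmetric])
    qed
  qed
  also have "\<dots> \<le> liminf (\<lambda>m. \<integral>\<^sup>+\<omega>. ennreal ((X m \<omega>)\<^sup>2) \<partial>M)"
    by (rule nn_integral_liminf) auto
  also have "\<dots> \<le> liminf (\<lambda>m. ennreal (b m))"
    by (intro Liminf_mono always_eventually allI)
       (simp add: nn_integral_eq_integral[OF sq] le ennreal_leI)
  also have "\<dots> = ennreal c"
    by (rule lim_imp_Liminf[OF sequentially_bot tendsto_ennrealI[OF b]])
  finally have fin: "(\<integral>\<^sup>+\<omega>. ennreal ((Y \<omega>)\<^sup>2) \<partial>M) \<le> ennreal c" .
  show int: "integrable M (\<lambda>\<omega>. (Y \<omega>)\<^sup>2)"
    by (rule integrableI_nonneg) (use fin in \<open>auto intro: le_less_trans\<close>)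
  show "expectation (\<lambda>\<omega>. (Y \<omega>)\<^sup>2) \<le> c"
    using fin c0 by (simp add: nn_integral_eq_integral[OF int])
qed

text \<open>The map \<open>iexp\<close> has Lipschitz constant \<open>1\<close>, so two
  characteristic functions at \<open>t\<close> differ by at most \<open>\<bar>t\<bar>\<close> times
  the mean-square distance of the variables.\<close>

lemma char_L2_limit:
  fixes A :: "'a \<Rightarrow> real" and S :: "nat \<Rightarrow> 'a \<Rightarrow> real"
  assumes [measurable]: "A \<in> borel_measurable M" "\<And>n. S n \<in> borel_measurable M"
    and sq: "\<And>n. integrable M (\<lambda>\<omega>. (A \<omega> - S n \<omega>)\<^sup>2)"
    and lim: "(\<lambda>n. expectation (\<lambda>\<omega>. (A \<omega> - S n \<omega>)\<^sup>2)) \<longlonglongrightarrow> 0"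
  shows "(\<lambda>n. char (distr M borel (S n)) t) \<longlonglongrightarrow> char (distr M borel A) t"
proof -
  have iexp_diff: "cmod (iexp x - iexp y) \<le> \<bar>x - y\<bar>" for x y
  proof -
    have "iexp x - iexp y = iexp y * (iexp (x - y) - 1)"
      by (simp add: algebra_simps flip: exp_add)
    then have "cmod (iexp x - iexp y) = cmod (iexp (x - y) - 1)"
      by (simp add: norm_mult)
    then show ?thesis
      using iexp_approx1[of "x - y" 0] by simp
  qed
  have bound: "cmod (char (distr M borel (S n)) t - char (distr M borel A) t) \<le>
      \<bar>t\<bar> * sqrt (expectation (\<lambda>\<omega>. (A \<omega> - S n \<omega>)\<^sup>2))" for n
  proof -
    note D = expectation_abs_le_sqrt[OF _ sq[of n]]
    have "char (distr M borel (S n)) t - char (distr M borel A) t =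
        (CLINT \<omega>|M. iexp (t * S n \<omega>) - iexp (t * A \<omega>))"
      by (simp add: char_def integral_distr)
         (subst Bochner_Integration.integral_diff, auto intro!: integrable_const_bound[where B=1] simp flip: of_real_mult)
    also have "cmod \<dots> \<le> (\<integral>\<omega>. cmod (iexp (t * S n \<omega>) - iexp (t * A \<omega>)) \<partial>M)"
      by (rule integral_norm_bound)
    also have "\<dots> \<le> (\<integral>\<omega>. \<bar>t\<bar> * \<bar>A \<omega> - S n \<omega>\<bar> \<partial>M)"
    proof (rule integral_mono_AE')
      show "integrable M (\<lambda>\<omega>. \<bar>t\<bar> * \<bar>A \<omega> - S n \<omega>\<bar>)"
        using D(1) by auto
      show "AE \<omega> in M. cmod (iexp (t * S n \<omega>) - iexp (t * A \<omega>)) \<le> \<bar>t\<bar> * \<bar>A \<omega> - S n \<omega>\<bar>"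
      proof (rule AE_I2)
        fix \<omega>
        show "cmod (iexp (t * S n \<omega>) - iexp (t * A \<omega>)) \<le> \<bar>t\<bar> * \<bar>A \<omega> - S n \<omega>\<bar>"
          using iexp_diff[of "t * S n \<omega>" "t * A \<omega>"]
          by (simp only: right_diff_distrib[symmetric] abs_mult abs_minus_commute)
      qed
    qed auto
    also have "\<dots> \<le> \<bar>t\<bar> * sqrt (expectation (\<lambda>\<omega>. (A \<omega> - S n \<omega>)\<^sup>2))"
      using D(2) by (simp add: mult_left_mono)
    finally show ?thesis .
  qed
  have lim0: "(\<lambda>n. \<bar>t\<bar> * sqrt (expectation (\<lambda>\<omega>. (A \<omega> - S n \<omega>)\<^sup>2))) \<longlonglongrightarrow> \<bar>t\<bar> * sqrt 0"
    by (intro tendsto_intros lim)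
  from lim0 have "(\<lambda>n. \<bar>t\<bar> * sqrt (expectation (\<lambda>\<omega>. (A \<omega> - S n \<omega>)\<^sup>2))) \<longlonglongrightarrow> 0"
    unfolding real_sqrt_zero mult_zero_right .
  then have "(\<lambda>n. char (distr M borel (S n)) t - char (distr M borel A) t) \<longlonglongrightarrow> 0"
    by (rule Lim_null_comparison[OF always_eventually[OF allI], rotated]) (rule bound)
  then show ?thesis by (rule LIM_zero_cancel)
qed

text \<open>Uniqueness of characteristic functions, against the point mass at \<open>0\<close> if
  the variance is zero and against a scaled standard normal variable otherwise.\<close>

lemma centred_normal_law_char:
  assumes [measurable]: "A \<in> borel_measurable M"
    and char: "\<And>t. char (distr M borel A) t = complex_of_real (exp (- t\<^sup>2 * q / 2))" and q: "q \<ge> 0"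
  shows "centred_normal_law (distr M borel A)"
proof (cases "q = 0")
  case True
  have R: "real_distribution (return borel (0::real))"
    by (simp add: real_distribution_def real_distribution_axioms_def prob_space_return)
  have "char (return borel 0) t = 1" for t
    by (simp add: char_def integral_return)
  then have "distr M borel A = return borel 0"
    using char True by (intro Levy_uniqueness R real_distribution_distr) auto
  then show ?thesis by (simp add: centred_normal_law_def)
next
  case False
  then have \<sigma>: "sqrt q > 0" using q by simp
  interpret S: prob_space std_normal_distribution
    using real_dist_normal_dist by (simp add: real_distribution_def)
  have "distributed std_normal_distribution lborel (\<lambda>x. x) std_normal_density"
    by (simp add: distributed_def distr_id2)
  from S.normal_density_affine[OF this, of "sqrt q" 0]
  have "distributed std_normal_distribution lborel (\<lambda>x. sqrt q * x) (normal_density 0 (sqrt q))"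
    using \<sigma> by simp
  then have eq: "distr std_normal_distribution borel (\<lambda>x. sqrt q * x) = density lborel (normal_density 0 (sqrt q))"
    by (simp add: distributed_def cong: distr_cong)
  have "char (density lborel (normal_density 0 (sqrt q))) t = complex_of_real (exp (- t\<^sup>2 * q / 2))" for t
  proof -
    have "char (density lborel (normal_density 0 (sqrt q))) t = char std_normal_distribution (t * sqrt q)"
      unfolding eq[symmetric] by (simp add: char_def integral_distr mult_ac)
    then show ?thesis
      using q by (simp add: char_std_normal_distribution power_mult_distrib)
  qed
  then have "distr M borel A = density lborel (normal_density 0 (sqrt q))"
    using char \<sigma> prob_space_normal_density
    by (intro Levy_uniqueness real_distribution_distr)
       (auto simp: real_distribution_def real_distribution_axioms_def)
  then show ?thesis
    unfolding centred_normal_law_def using \<sigma> by (intro disjI2 exI[of _ "sqrt q"]) simp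
qed

end

section \<open>Independent standard normal variables\<close>

abbreviation gauss_seq :: "(nat \<Rightarrow> real) measure" where
  "gauss_seq \<equiv> PiM UNIV (\<lambda>_. std_normal_distribution)"

lemma prob_space_gauss_seq: "prob_space gauss_seq"
  using real_dist_normal_dist by (intro prob_space_PiM) (simp add: real_distribution_def)

lemma sets_gauss_seq [measurable_cong]: "sets gauss_seq = sets (PiM UNIV (\<lambda>_. borel))"
  by (intro sets_PiM_cong) auto

lemma sets_gauss_seq_borel: "sets gauss_seq = sets borel"
  unfolding sets_gauss_seq by (rule sets_PiM_equal_borel)

lemma space_gauss_seq: "space gauss_seq = UNIV"
  by (simp add: space_PiM)

lemma distr_gauss_seq_component: "distr gauss_seq borel (\<lambda>\<omega>. \<omega> k) = std_normal_distribution"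
proof -
  have "distr gauss_seq borel (\<lambda>\<omega>. \<omega> k) = distr gauss_seq std_normal_distribution (\<lambda>\<omega>. \<omega> k)"
    by (intro distr_cong) auto
  also have "\<dots> = std_normal_distribution"
    by (rule distr_PiM_component) (use real_dist_normal_dist in \<open>auto simp: real_distribution_def\<close>)
  finally show ?thesis .
qed

lemma indep_vars_gauss_seq: "prob_space.indep_vars gauss_seq (\<lambda>_. borel) (\<lambda>k \<omega>. \<omega> k) UNIV"
proof -
  interpret prob_space gauss_seq by (rule prob_space_gauss_seq)
  have "distr gauss_seq (PiM UNIV (\<lambda>_. borel)) (\<lambda>x. \<lambda>i\<in>UNIV. x i) = gauss_seq"
    by (simp add: distr_id2 sets_gauss_seq restrict_UNIV)
  moreover have "PiM UNIV (\<lambda>i. distr gauss_seq borel (\<lambda>\<omega>. \<omega> i)) = gauss_seq"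
    by (simp only: distr_gauss_seq_component)
  ultimately show ?thesis
    by (subst indep_vars_iff_distr_eq_PiM) auto
qed

lemma gauss_seq_component_moments:
  "integrable gauss_seq (\<lambda>\<omega>. (\<omega> k)\<^sup>2)" "(\<integral>\<omega>. \<omega> k \<partial>gauss_seq) = 0" "(\<integral>\<omega>. (\<omega> k)\<^sup>2 \<partial>gauss_seq) = 1"
proof -
  have "integrable (distr gauss_seq borel (\<lambda>\<omega>. \<omega> k)) (\<lambda>x. x\<^sup>2)"
    using std_normal_distribution_even_moments(2)[of 1] by (simp add: distr_gauss_seq_component)
  then show "integrable gauss_seq (\<lambda>\<omega>. (\<omega> k)\<^sup>2)"
    by (rule integrable_distr[rotated]) simp
  have "(\<integral>\<omega>. \<omega> k \<partial>gauss_seq) = (\<integral>x. x \<partial>distr gauss_seq borel (\<lambda>\<omega>. \<omega> k))"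
    by (simp add: integral_distr)
  then show "(\<integral>\<omega>. \<omega> k \<partial>gauss_seq) = 0"
    using integral_std_normal_distribution_moment_odd[of 1] by (simp add: distr_gauss_seq_component)
  have "(\<integral>\<omega>. (\<omega> k)\<^sup>2 \<partial>gauss_seq) = (\<integral>x. x\<^sup>2 \<partial>distr gauss_seq borel (\<lambda>\<omega>. \<omega> k))"
    by (simp add: integral_distr)
  then show "(\<integral>\<omega>. (\<omega> k)\<^sup>2 \<partial>gauss_seq) = 1"
    using std_normal_distribution_even_moments(1)[of 1] by (simp add: distr_gauss_seq_component)
qed

lemma gauss_seq_linear_second_moment:
  fixes c :: "nat \<Rightarrow> real"
  assumes "finite A"
  shows "integrable gauss_seq (\<lambda>\<omega>. (\<Sum>k\<in>A. \<omega> k * c k)\<^sup>2)"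
    "(\<integral>\<omega>. (\<Sum>k\<in>A. \<omega> k * c k)\<^sup>2 \<partial>gauss_seq) = (\<Sum>k\<in>A. (c k)\<^sup>2)"
proof -
  interpret prob_space gauss_seq by (rule prob_space_gauss_seq)
  have indep: "indep_vars (\<lambda>_. borel) (\<lambda>k \<omega>. \<omega> k * c k) UNIV"
    by (rule indep_vars_compose2[OF indep_vars_gauss_seq]) auto
  note S = indep_sum_second_moment[OF indep assms subset_UNIV]
  show "integrable gauss_seq (\<lambda>\<omega>. (\<Sum>k\<in>A. \<omega> k * c k)\<^sup>2)"
    by (rule S) (auto simp: power_mult_distrib gauss_seq_component_moments)
  show "(\<integral>\<omega>. (\<Sum>k\<in>A. \<omega> k * c k)\<^sup>2 \<partial>gauss_seq) = (\<Sum>k\<in>A. (c k)\<^sup>2)"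
    by (subst S(2)) (auto simp: power_mult_distrib gauss_seq_component_moments)
qed

lemma gauss_seq_linear_char:
  fixes c :: "nat \<Rightarrow> real"
  assumes "finite A"
  shows "char (distr gauss_seq borel (\<lambda>\<omega>. \<Sum>k\<in>A. \<omega> k * c k)) t = complex_of_real (exp (- t\<^sup>2 * (\<Sum>k\<in>A. (c k)\<^sup>2) / 2))"
proof -
  interpret prob_space gauss_seq by (rule prob_space_gauss_seq)
  have indep: "indep_vars (\<lambda>_. borel) (\<lambda>k \<omega>. \<omega> k * c k) A"
    by (rule indep_vars_compose2[OF indep_vars_subset[OF indep_vars_gauss_seq]]) auto
  have "char (distr gauss_seq borel (\<lambda>\<omega>. \<omega> k * c k)) t = complex_of_real (exp (- t\<^sup>2 * (c k)\<^sup>2 / 2))" for k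
  proof -
    have "char (distr gauss_seq borel (\<lambda>\<omega>. \<omega> k * c k)) t = char (distr gauss_seq borel (\<lambda>\<omega>. \<omega> k)) (t * c k)"
      by (simp add: char_def integral_distr mult_ac)
    then show ?thesis
      by (simp add: distr_gauss_seq_component char_std_normal_distribution power_mult_distrib)
  qed
  then show ?thesis
    unfolding char_distr_sum[OF indep]
    by (simp add: sum_distrib_left sum_divide_distrib sum_negf exp_sum assms flip: of_real_prod sum_negf)
qed

text \<open>Centred Gaussian laws are closed under mean-square limits. This yields both the joint
  laws of finitely many field values and the law of an inner product with an element of L2.\<close>

lemma gauss_seq_L2_limit_char:
  fixes c :: "nat \<Rightarrow> real" and A :: "(nat \<Rightarrow> real) \<Rightarrow> real"
  assumes [measurable]: "A \<in> borel_measurable gauss_seq"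
    and sq: "\<And>n. integrable gauss_seq (\<lambda>\<omega>. (A \<omega> - (\<Sum>k<n. \<omega> k * c k))\<^sup>2)"
    and lim: "(\<lambda>n. \<integral>\<omega>. (A \<omega> - (\<Sum>k<n. \<omega> k * c k))\<^sup>2 \<partial>gauss_seq) \<longlonglongrightarrow> 0"
    and q: "(\<lambda>n. \<Sum>k<n. (c k)\<^sup>2) \<longlonglongrightarrow> q"
  shows "char (distr gauss_seq borel A) t = complex_of_real (exp (- t\<^sup>2 * q / 2))"
proof -
  interpret prob_space gauss_seq by (rule prob_space_gauss_seq)
  have "(\<lambda>n. char (distr gauss_seq borel (\<lambda>\<omega>. \<Sum>k<n. \<omega> k * c k)) t) \<longlonglongrightarrow> char (distr gauss_seq borel A) t"
    by (rule char_L2_limit[OF _ _ sq lim]) auto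
  moreover have "(\<lambda>n. char (distr gauss_seq borel (\<lambda>\<omega>. \<Sum>k<n. \<omega> k * c k)) t) \<longlonglongrightarrow> complex_of_real (exp (- t\<^sup>2 * q / 2))"
    unfolding gauss_seq_linear_char[OF finite_lessThan] by (intro tendsto_intros q) auto
  ultimately show ?thesis by (rule LIMSEQ_unique)
qed

section \<open>Inequalities and limits in L2\<close>

lemma L2_fun_abs_Cauchy_Schwarz:
  assumes f: "f \<in> L2_fun \<mu>" and g: "g \<in> L2_fun \<mu>"
  shows "\<bar>\<integral>x. f x * g x \<partial>\<mu>\<bar> \<le> sqrt (\<integral>x. (f x)\<^sup>2 \<partial>\<mu>) * sqrt (\<integral>x. (g x)\<^sup>2 \<partial>\<mu>)"
proof -
  have "(\<lambda>x. - f x) \<in> L2_fun \<mu>" using f by (auto simp: L2_fun_def)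
  from L2_fun_Cauchy_Schwarz[OF this g] L2_fun_Cauchy_Schwarz[OF f g] show ?thesis
    by (simp add: abs_le_iff)
qed

lemma (in finite_measure) L2_fun_bounded:
  assumes [measurable]: "f \<in> borel_measurable M" and "\<And>x. x \<in> space M \<Longrightarrow> \<bar>f x\<bar> \<le> C"
  shows "f \<in> L2_fun M"
proof -
  have "(f x)\<^sup>2 \<le> C\<^sup>2" if "x \<in> space M" for x
    using power_mono[OF assms(2)[OF that], of 2] by simp
  then have "integrable M (\<lambda>x. (f x)\<^sup>2)"
    by (intro integrable_const_bound[where B="C\<^sup>2"] AE_I2) auto
  then show ?thesis by (simp add: L2_fun_def)
qed

lemma L2_fun_add:
  assumes "f \<in> L2_fun \<mu>" "g \<in> L2_fun \<mu>"
  shows "(\<lambda>x. f x + g x) \<in> L2_fun \<mu>"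
proof -
  have "(\<lambda>x. - g x) \<in> L2_fun \<mu>" using assms by (auto simp: L2_fun_def)
  from L2_fun_diff[OF assms(1) this] show ?thesis by simp
qed

lemma L2_inner_class_left:
  assumes "f \<in> L2_fun \<mu>" "h \<in> L2_space \<mu>"
  shows "L2_inner \<mu> (L2_class \<mu> f) h = (\<integral>x. f x * L2_rep h x \<partial>\<mu>)"
  unfolding L2_inner_def using L2_rep_class[OF assms(1)] L2_rep_in_class(2)[OF assms(2)] assms(1)
  by (intro integral_cong_AE) (auto simp: L2_fun_def)

lemma mult_L2_limit:
  fixes A A' :: "'a \<Rightarrow> real"
  assumes A: "A \<in> L2_fun \<mu>" "A' \<in> L2_fun \<mu>" and S: "\<And>n. S n \<in> L2_fun \<mu>" "\<And>n. S' n \<in> L2_fun \<mu>"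
    and lim: "(\<lambda>n. \<integral>x. (A x - S n x)\<^sup>2 \<partial>\<mu>) \<longlonglongrightarrow> 0" "(\<lambda>n. \<integral>x. (A' x - S' n x)\<^sup>2 \<partial>\<mu>) \<longlonglongrightarrow> 0"
    and bdd: "\<And>n. (\<integral>x. (S' n x)\<^sup>2 \<partial>\<mu>) \<le> C"
  shows "(\<lambda>n. \<integral>x. S n x * S' n x \<partial>\<mu>) \<longlonglongrightarrow> (\<integral>x. A x * A' x \<partial>\<mu>)"
proof -
  let ?b = "\<lambda>n. sqrt (\<integral>x. (A x - S n x)\<^sup>2 \<partial>\<mu>) * sqrt C + sqrt (\<integral>x. (A x)\<^sup>2 \<partial>\<mu>) * sqrt (\<integral>x. (A' x - S' n x)\<^sup>2 \<partial>\<mu>)"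
  have bound: "norm ((\<integral>x. S n x * S' n x \<partial>\<mu>) - (\<integral>x. A x * A' x \<partial>\<mu>)) \<le> ?b n" for n
  proof -
    note D = L2_fun_diff[OF A(1) S(1)[of n]] and D' = L2_fun_diff[OF A(2) S(2)[of n]]
    have "(\<integral>x. A x * A' x \<partial>\<mu>) - (\<integral>x. S n x * S' n x \<partial>\<mu>) = (\<integral>x. A x * A' x - S n x * S' n x \<partial>\<mu>)"
      using L2_fun_integrable_mult[OF A] L2_fun_integrable_mult[OF S(1) S(2)] by simp
    also have "\<dots> = (\<integral>x. (A x - S n x) * S' n x + A x * (A' x - S' n x) \<partial>\<mu>)"
      by (intro Bochner_Integration.integral_cong) (auto simp: algebra_simps)
    also have "\<dots> = (\<integral>x. (A x - S n x) * S' n x \<partial>\<mu>) + (\<integral>x. A x * (A' x - S' n x) \<partial>\<mu>)"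
      by (rule Bochner_Integration.integral_add[OF L2_fun_integrable_mult[OF D S(2)] L2_fun_integrable_mult[OF A(1) D']])
    finally have eq: "(\<integral>x. A x * A' x \<partial>\<mu>) - (\<integral>x. S n x * S' n x \<partial>\<mu>) =
        (\<integral>x. (A x - S n x) * S' n x \<partial>\<mu>) + (\<integral>x. A x * (A' x - S' n x) \<partial>\<mu>)" .
    have "\<bar>\<integral>x. (A x - S n x) * S' n x \<partial>\<mu>\<bar> \<le> sqrt (\<integral>x. (A x - S n x)\<^sup>2 \<partial>\<mu>) * sqrt (\<integral>x. (S' n x)\<^sup>2 \<partial>\<mu>)"
      by (rule L2_fun_abs_Cauchy_Schwarz[OF D S(2)])
    also have "\<dots> \<le> sqrt (\<integral>x. (A x - S n x)\<^sup>2 \<partial>\<mu>) * sqrt C"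
      using bdd by (intro mult_left_mono) auto
    finally show ?thesis
      using L2_fun_abs_Cauchy_Schwarz[OF A(1) D'] eq by (simp add: abs_le_iff)
  qed
  have "?b \<longlonglongrightarrow> sqrt 0 * sqrt C + sqrt (\<integral>x. (A x)\<^sup>2 \<partial>\<mu>) * sqrt 0"
    by (intro tendsto_intros lim)
  then have "?b \<longlonglongrightarrow> 0"
    unfolding real_sqrt_zero mult_zero_left mult_zero_right add_0_right .
  then have "(\<lambda>n. (\<integral>x. S n x * S' n x \<partial>\<mu>) - (\<integral>x. A x * A' x \<partial>\<mu>)) \<longlonglongrightarrow> 0"
    by (rule Lim_null_comparison[OF always_eventually[OF allI], rotated]) (rule bound)
  then show ?thesis by (rule LIM_zero_cancel)
qed

text \<open>The kernel lives on the whole type, where continuity and density are stated, while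
  \<open>\<mu>\<close> may have a smaller space, as happens when the second component is restricted
  to \<open>Theta\<close>. The assumption \<open>ident\<close> is what connects the Borel sets of
  the type with those of \<open>\<mu>\<close>.\<close>

locale covariance_kernel = finite_measure \<mu>
  for \<mu> :: "'x::{metric_space, second_countable_topology} measure" +
  fixes K :: "'x \<Rightarrow> 'x \<Rightarrow> real" and B :: real
  assumes pos: "pos_kernel K" and cont: "continuous_on UNIV (\<lambda>(x, y). K x y)"
    and K_le: "\<And>x. K x x \<le> B" and ident [measurable]: "(\<lambda>x. x) \<in> \<mu> \<rightarrow>\<^sub>M borel"
begin

section \<open>The random series and its pointwise limit\<close>

definition dense_seq :: "nat \<Rightarrow> 'x" where
  "dense_seq = (SOME a. \<forall>U. open U \<longrightarrow> U \<noteq> {} \<longrightarrow> (\<exists>j. a j \<in> U))"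

lemma dense_seq: "open U \<Longrightarrow> U \<noteq> {} \<Longrightarrow> \<exists>j. dense_seq j \<in> U"
proof -
  obtain D :: "'x set" where D: "countable D" "\<And>U. open U \<Longrightarrow> U \<noteq> {} \<Longrightarrow> \<exists>d\<in>D. d \<in> U"
    by (rule countable_dense_setE) blast
  have "D \<noteq> {}" using D(2)[of UNIV] by auto
  then have "range (from_nat_into D) = D"
    using D(1) by (rule range_from_nat_into)
  then have "\<exists>a::nat \<Rightarrow> 'x. \<forall>U. open U \<longrightarrow> U \<noteq> {} \<longrightarrow> (\<exists>j. a j \<in> U)"
    using D(2) by (intro exI[of _ "from_nat_into D"]) (metis rangeE)
  from someI_ex[OF this, folded dense_seq_def] show "open U \<Longrightarrow> U \<noteq> {} \<Longrightarrow> \<exists>j. dense_seq j \<in> U"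
    by blast
qed

definition e :: "nat \<Rightarrow> 'x \<Rightarrow> real" where "e = chol_vec K dense_seq"
text \<open>The variance of the field at \<open>x\<close> that the first \<open>n\<close> terms of
  the series do not explain. It is the mean-square truncation error and depends on
  \<open>x\<close>.\<close>

definition r :: "nat \<Rightarrow> 'x \<Rightarrow> real" where "r n x = chol K dense_seq n x x"
definition S :: "nat \<Rightarrow> (nat \<Rightarrow> real) \<Rightarrow> 'x \<Rightarrow> real" where "S n \<omega> x = (\<Sum>k<n. \<omega> k * e k x)"

lemma B_nonneg: "0 \<le> B"
  using pos_kernel_diag[OF pos] K_le order_trans by blast

lemma r_nonneg: "0 \<le> r n x" and r_antimono: "m \<le> n \<Longrightarrow> r n x \<le> r m x"
  and r_le: "r n x \<le> B" and r_lim: "(\<lambda>n. r n x) \<longlonglongrightarrow> 0"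
proof -
  show "0 \<le> r n x" "m \<le> n \<Longrightarrow> r n x \<le> r m x" "(\<lambda>n. r n x) \<longlonglongrightarrow> 0"
    unfolding r_def
    by (rule chol_diag_nonneg[OF pos] chol_diag_antimono[OF pos]
        chol_diag_tendsto_0[OF pos cont dense_seq]; assumption)+
  show "r n x \<le> B"
    using chol_diag_antimono[OF pos, of 0 n dense_seq x] K_le[of x] by (simp add: r_def)
qed

lemma sum_e_sq: "m \<le> n \<Longrightarrow> (\<Sum>k\<in>{m..<n}. (e k x)\<^sup>2) = r m x - r n x"
  unfolding e_def r_def by (rule sum_chol_vec_sq[OF pos])

lemma e_sq_le: "(e k x)\<^sup>2 \<le> B"
  using chol_vec_sq_le[OF pos, of dense_seq k x] K_le[of x] by (simp add: e_def)

lemma e_abs_le: "\<bar>e k x\<bar> \<le> sqrt B"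
  using e_sq_le[of k x] by (intro real_le_rsqrt) simp

lemma e_expansion: "(\<lambda>n. \<Sum>k<n. e k x * e k y) \<longlonglongrightarrow> K x y"
  unfolding e_def
  by (rule chol_expansion[OF pos chol_diag_tendsto_0[OF pos cont dense_seq]])

lemma e_borel [measurable]: "e k \<in> borel_measurable borel" and r_borel [measurable]: "r n \<in> borel_measurable borel"
  unfolding e_def r_def[abs_def]
  by (intro borel_measurable_continuous_onI continuous_on_chol[OF pos cont])+

lemma e_meas [measurable]: "e k \<in> borel_measurable \<mu>" and r_meas [measurable]: "r n \<in> borel_measurable \<mu>"
  by (rule measurable_compose[OF ident], measurable)+

lemma S_meas [measurable]: "(\<lambda>(\<omega>, x). S n \<omega> x) \<in> borel_measurable (gauss_seq \<Otimes>\<^sub>M \<mu>)"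
  "(\<lambda>\<omega>. S n \<omega> x) \<in> borel_measurable gauss_seq" "S n \<omega> \<in> borel_measurable \<mu>"
  unfolding S_def[abs_def] by measurable

lemma S_diff_second_moment:
  "integrable gauss_seq (\<lambda>\<omega>. (S m \<omega> x - S n \<omega> x)\<^sup>2)"
  "(\<integral>\<omega>. (S m \<omega> x - S n \<omega> x)\<^sup>2 \<partial>gauss_seq) = \<bar>r n x - r m x\<bar>"
proof -
  have *: "integrable gauss_seq (\<lambda>\<omega>. (S m \<omega> x - S n \<omega> x)\<^sup>2) \<and>
      (\<integral>\<omega>. (S m \<omega> x - S n \<omega> x)\<^sup>2 \<partial>gauss_seq) = r n x - r m x" if "n \<le> m" for m n
  proof -
    have "S m \<omega> x - S n \<omega> x = (\<Sum>k\<in>{n..<m}. \<omega> k * e k x)" for \<omega>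
      using sum_diff_nat_ivl[of 0 n m "\<lambda>k. \<omega> k * e k x"] that by (simp add: S_def atLeast0LessThan)
    then show ?thesis
      using gauss_seq_linear_second_moment[of "{n..<m}" "\<lambda>k. e k x"] sum_e_sq[OF that, of x] by simp
  qed
  show "integrable gauss_seq (\<lambda>\<omega>. (S m \<omega> x - S n \<omega> x)\<^sup>2)"
    "(\<integral>\<omega>. (S m \<omega> x - S n \<omega> x)\<^sup>2 \<partial>gauss_seq) = \<bar>r n x - r m x\<bar>"
    using *[of n m] *[of m n] r_antimono[of n m x] r_antimono[of m n x] linear[of m n]
    by (auto simp: power2_commute)
qed

text \<open>The series for the field at \<open>x\<close> converges in mean square at a speed depending on \<open>x\<close>;
  choosing the truncation index as a measurable function of \<open>x\<close> gives almost sure convergence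
  at every point, and hence a jointly measurable version.\<close>

definition idx :: "nat \<Rightarrow> 'x \<Rightarrow> nat" where
  "idx m x = (LEAST n. r n x \<le> ((1/2) ^ m)\<^sup>2)"

definition v0 :: "(nat \<Rightarrow> real) \<Rightarrow> 'x \<Rightarrow> real" where
  "v0 \<omega> x = lim (\<lambda>m. S (idx m x) \<omega> x)"

lemma r_idx: "r (idx m x) x \<le> ((1/2) ^ m)\<^sup>2"
proof -
  have "\<forall>\<^sub>F n in sequentially. r n x < ((1/2) ^ m)\<^sup>2"
    by (rule order_tendstoD[OF r_lim]) simp
  then obtain n where "r n x \<le> ((1/2) ^ m)\<^sup>2"
    using eventually_happens'[OF sequentially_bot] less_imp_le by blast
  then show ?thesis unfolding idx_def by (rule LeastI)
qed

lemma idx_mono: "idx m x \<le> idx (Suc m) x"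
proof -
  have "((1/2) ^ Suc m)\<^sup>2 \<le> ((1/2::real) ^ m)\<^sup>2"
    by (intro power_mono) auto
  then have "r (idx (Suc m) x) x \<le> ((1/2) ^ m)\<^sup>2"
    using r_idx[of "Suc m" x] by linarith
  then show ?thesis
    unfolding idx_def[of m] by (rule Least_le)
qed

lemma idx_meas [measurable]: "idx m \<in> \<mu> \<rightarrow>\<^sub>M count_space UNIV"
  unfolding idx_def[abs_def] by measurable

text \<open>The truncation index takes countably many values, and on each set where it is constant
  the expression is a fixed partial sum.\<close>

lemma S_idx_meas [measurable]: "(\<lambda>(\<omega>, x). S (idx m x) \<omega> x) \<in> borel_measurable (gauss_seq \<Otimes>\<^sub>M \<mu>)"
proof -
  have "(\<lambda>p. (\<lambda>n p. S n (fst p) (snd p)) (idx m (snd p)) p) \<in> borel_measurable (gauss_seq \<Otimes>\<^sub>M \<mu>)"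
    by (rule measurable_compose_countable) (use S_meas(1) in \<open>auto simp: case_prod_beta\<close>)
  then show ?thesis by (simp add: case_prod_beta)
qed

lemma v0_meas [measurable]: "(\<lambda>(\<omega>, x). v0 \<omega> x) \<in> borel_measurable (gauss_seq \<Otimes>\<^sub>M \<mu>)"
  unfolding v0_def[abs_def] case_prod_beta
  by (rule borel_measurable_lim_metric) (use S_idx_meas in \<open>simp add: case_prod_beta\<close>)

lemma v0_meas' [measurable]: "(\<lambda>\<omega>. v0 \<omega> x) \<in> borel_measurable gauss_seq"
  unfolding v0_def[abs_def] by (rule borel_measurable_lim_metric) measurable

lemma v0_section [measurable]: "v0 \<omega> \<in> borel_measurable \<mu>"
  using measurable_compose[OF measurable_Pair1' v0_meas, of \<omega>] by (simp add: space_gauss_seq)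

text \<open>The increment from \<open>idx m x\<close> to \<open>idx (Suc m) x\<close> has variance
  at most \<open>((1/2) ^ m)\<^sup>2\<close> by the choice of the index. The exceptional null set
  depends on \<open>x\<close>, so this is a statement about each point separately.\<close>

lemma v0_AE_lim: "AE \<omega> in gauss_seq. (\<lambda>m. S (idx m x) \<omega> x) \<longlonglongrightarrow> v0 \<omega> x"
proof -
  interpret prob_space gauss_seq by (rule prob_space_gauss_seq)
  have "AE \<omega> in gauss_seq. convergent (\<lambda>m. S (idx m x) \<omega> x)"
  proof (rule AE_convergent_of_rapidly_Cauchy)
    show "(\<integral>\<omega>. (S (idx (Suc m) x) \<omega> x - S (idx m x) \<omega> x)\<^sup>2 \<partial>gauss_seq) \<le> ((1/2) ^ m)\<^sup>2" for m
      using r_idx[of m x] r_antimono[OF idx_mono[of m x], of x] r_nonneg[of "idx (Suc m) x" x]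
      by (simp add: S_diff_second_moment)
  qed (use S_diff_second_moment in auto)
  then show ?thesis
    unfolding v0_def by eventually_elim (simp add: convergent_LIMSEQ_iff)
qed

text \<open>Although \<open>v0\<close> is defined along the sparse indices \<open>idx m x\<close>,
  it is approximated by the whole sequence of partial sums: Fatou's lemma is applied as
  \<open>m\<close> grows, with \<open>n\<close> fixed, to mean-square distances of at most
  \<open>r n x + r (idx m x) x\<close>.\<close>

lemma v0_S_second_moment:
  "integrable gauss_seq (\<lambda>\<omega>. (v0 \<omega> x - S n \<omega> x)\<^sup>2)"
  "(\<integral>\<omega>. (v0 \<omega> x - S n \<omega> x)\<^sup>2 \<partial>gauss_seq) \<le> r n x"
proof -
  interpret prob_space gauss_seq by (rule prob_space_gauss_seq)
  have lim: "AE \<omega> in gauss_seq. (\<lambda>m. S (idx m x) \<omega> x - S n \<omega> x) \<longlonglongrightarrow> v0 \<omega> x - S n \<omega> x"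
    using v0_AE_lim[of x] by eventually_elim (intro tendsto_intros)
  have le: "(\<integral>\<omega>. (S (idx m x) \<omega> x - S n \<omega> x)\<^sup>2 \<partial>gauss_seq) \<le> r n x + (1/2) ^ m * (1/2) ^ m" for m
    using r_idx[of m x, unfolded power2_eq_square] r_nonneg[of n x] r_nonneg[of "idx m x" x]
    unfolding S_diff_second_moment(2) by linarith
  have b: "(\<lambda>m. r n x + (1/2) ^ m * (1/2) ^ m) \<longlonglongrightarrow> r n x"
    using tendsto_add[OF tendsto_const[of "r n x"] tendsto_mult[OF LIMSEQ_power_zero LIMSEQ_power_zero, of "1/2::real" "1/2::real"]]
    by simp
  show "integrable gauss_seq (\<lambda>\<omega>. (v0 \<omega> x - S n \<omega> x)\<^sup>2)"
    "(\<integral>\<omega>. (v0 \<omega> x - S n \<omega> x)\<^sup>2 \<partial>gauss_seq) \<le> r n x"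
    by (rule second_moment_Fatou[OF _ _ lim S_diff_second_moment(1) le b]; measurable)+
qed

lemma v0_L2_lim: "(\<lambda>n. \<integral>\<omega>. (v0 \<omega> x - S n \<omega> x)\<^sup>2 \<partial>gauss_seq) \<longlonglongrightarrow> 0"
  by (rule tendsto_sandwich[OF _ _ tendsto_const r_lim[of x]]) (auto simp: v0_S_second_moment)

lemma S_L2_gauss: "(\<lambda>\<omega>. S n \<omega> x) \<in> L2_fun gauss_seq"
  using gauss_seq_linear_second_moment(1)[of "{..<n}" "\<lambda>k. e k x"] by (simp add: L2_fun_def S_def)

lemma v0_L2_gauss: "(\<lambda>\<omega>. v0 \<omega> x) \<in> L2_fun gauss_seq"
  using v0_S_second_moment(1)[of x 0] by (simp add: L2_fun_def S_def)

lemma v0_covariance: "(\<integral>\<omega>. v0 \<omega> x * v0 \<omega> y \<partial>gauss_seq) = K x y"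
proof -
  interpret prob_space gauss_seq by (rule prob_space_gauss_seq)
  have sq: "(\<integral>\<omega>. (S n \<omega> x)\<^sup>2 \<partial>gauss_seq) = (\<Sum>k<n. (e k x)\<^sup>2)" for n x
    by (simp add: S_def gauss_seq_linear_second_moment)
  have S_cov: "(\<integral>\<omega>. S n \<omega> x * S n \<omega> y \<partial>gauss_seq) = (\<Sum>k<n. e k x * e k y)" for n
  proof -
    \<comment> \<open>Polarisation: the sum of two field values is again a linear form in the
      Gaussian variables, so its second moment is known, and the mixed moment is read off from the
      expanded square.\<close>
    have "(\<integral>\<omega>. (S n \<omega> x + S n \<omega> y)\<^sup>2 \<partial>gauss_seq) = (\<Sum>k<n. (e k x + e k y)\<^sup>2)"
      using gauss_seq_linear_second_moment(2)[of "{..<n}" "\<lambda>k. e k x + e k y"]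
      by (simp add: S_def sum.distrib distrib_left)
    moreover have "(\<integral>\<omega>. (S n \<omega> x + S n \<omega> y)\<^sup>2 \<partial>gauss_seq) =
        (\<integral>\<omega>. (S n \<omega> x)\<^sup>2 \<partial>gauss_seq) + (\<integral>\<omega>. (S n \<omega> y)\<^sup>2 \<partial>gauss_seq) + 2 * (\<integral>\<omega>. S n \<omega> x * S n \<omega> y \<partial>gauss_seq)"
    proof -
      have "(\<integral>\<omega>. (S n \<omega> x + S n \<omega> y)\<^sup>2 \<partial>gauss_seq) =
          (\<integral>\<omega>. (S n \<omega> x)\<^sup>2 + (S n \<omega> y)\<^sup>2 + 2 * (S n \<omega> x * S n \<omega> y) \<partial>gauss_seq)"
        by (intro Bochner_Integration.integral_cong) (auto simp: power2_sum)
      then show ?thesis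
        using S_L2_gauss L2_fun_integrable_mult[OF S_L2_gauss S_L2_gauss, of n x n y] by (simp add: L2_fun_def)
    qed
    ultimately show ?thesis
      unfolding sq by (simp add: power2_sum sum.distrib sum_distrib_left mult.assoc flip: sum_distrib_left)
  qed
  have "(\<lambda>n. \<integral>\<omega>. S n \<omega> x * S n \<omega> y \<partial>gauss_seq) \<longlonglongrightarrow> (\<integral>\<omega>. v0 \<omega> x * v0 \<omega> y \<partial>gauss_seq)"
  proof (rule mult_L2_limit[OF v0_L2_gauss v0_L2_gauss S_L2_gauss S_L2_gauss v0_L2_lim v0_L2_lim])
    show "(\<integral>\<omega>. (S n \<omega> y)\<^sup>2 \<partial>gauss_seq) \<le> B" for n
      using sum_e_sq[of 0 n y] r_nonneg[of n y] r_le[of 0 y] by (simp add: sq atLeast0LessThan)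
  qed
  then show ?thesis
    unfolding S_cov using e_expansion LIMSEQ_unique by blast
qed

text \<open>A linear combination of field values is the mean-square limit of Gaussian sums with
  coefficients \<open>c k\<close>, and the sums of the squares of these coefficients converge to the
  quadratic form of \<open>K\<close>.\<close>

lemma v0_char:
  assumes "finite I"
  shows "char (distr gauss_seq borel (\<lambda>\<omega>. \<Sum>x\<in>I. t x * v0 \<omega> x)) s =
    complex_of_real (exp (- s\<^sup>2 * (\<Sum>x\<in>I. \<Sum>y\<in>I. t x * t y * K x y) / 2))"
proof (rule gauss_seq_L2_limit_char)
  interpret prob_space gauss_seq by (rule prob_space_gauss_seq)
  define c where "c k = (\<Sum>x\<in>I. t x * e k x)" for k
  have eq: "(\<Sum>x\<in>I. t x * v0 \<omega> x) - (\<Sum>k<n. \<omega> k * c k) = (\<Sum>x\<in>I. t x * (v0 \<omega> x - S n \<omega> x))" for n \<omega>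
  proof -
    have "(\<Sum>k<n. \<omega> k * c k) = (\<Sum>x\<in>I. t x * S n \<omega> x)"
      unfolding c_def S_def sum_distrib_left by (subst sum.swap) (simp add: mult_ac)
    then show ?thesis by (simp add: right_diff_distrib sum_subtractf)
  qed
  \<comment> \<open>The Cauchy-Schwarz inequality over the finite set \<open>I\<close> reduces the
    error of the linear combination to the errors at single points.\<close>
  have le: "((\<Sum>x\<in>I. t x * v0 \<omega> x) - (\<Sum>k<n. \<omega> k * c k))\<^sup>2 \<le> (\<Sum>x\<in>I. (t x)\<^sup>2) * (\<Sum>x\<in>I. (v0 \<omega> x - S n \<omega> x)\<^sup>2)" for n \<omega>
    unfolding eq by (rule Cauchy_Schwarz_ineq_sum)
  have int: "integrable gauss_seq (\<lambda>\<omega>. (\<Sum>x\<in>I. (t x)\<^sup>2) * (\<Sum>x\<in>I. (v0 \<omega> x - S n \<omega> x)\<^sup>2))" for n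
    by (intro integrable_mult_right Bochner_Integration.integrable_sum v0_S_second_moment)
  show meas [measurable]: "(\<lambda>\<omega>. \<Sum>x\<in>I. t x * v0 \<omega> x) \<in> borel_measurable gauss_seq"
    by measurable
  show sq: "integrable gauss_seq (\<lambda>\<omega>. ((\<Sum>x\<in>I. t x * v0 \<omega> x) - (\<Sum>k<n. \<omega> k * c k))\<^sup>2)" for n
    by (rule Bochner_Integration.integrable_bound[OF int[of n]])
       (auto intro!: AE_I2 order_trans[OF le abs_ge_self])
  show "(\<lambda>n. \<integral>\<omega>. ((\<Sum>x\<in>I. t x * v0 \<omega> x) - (\<Sum>k<n. \<omega> k * c k))\<^sup>2 \<partial>gauss_seq) \<longlonglongrightarrow> 0"
  proof (rule tendsto_sandwich[OF _ _ tendsto_const])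
    show "\<forall>\<^sub>F n in sequentially. (\<integral>\<omega>. ((\<Sum>x\<in>I. t x * v0 \<omega> x) - (\<Sum>k<n. \<omega> k * c k))\<^sup>2 \<partial>gauss_seq)
        \<le> (\<Sum>x\<in>I. (t x)\<^sup>2) * (\<Sum>x\<in>I. \<integral>\<omega>. (v0 \<omega> x - S n \<omega> x)\<^sup>2 \<partial>gauss_seq)"
    proof (intro always_eventually allI)
      fix n
      have "(\<integral>\<omega>. ((\<Sum>x\<in>I. t x * v0 \<omega> x) - (\<Sum>k<n. \<omega> k * c k))\<^sup>2 \<partial>gauss_seq)
          \<le> (\<integral>\<omega>. (\<Sum>x\<in>I. (t x)\<^sup>2) * (\<Sum>x\<in>I. (v0 \<omega> x - S n \<omega> x)\<^sup>2) \<partial>gauss_seq)"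
        by (rule integral_mono[OF sq int le])
      also have "\<dots> = (\<Sum>x\<in>I. (t x)\<^sup>2) * (\<Sum>x\<in>I. \<integral>\<omega>. (v0 \<omega> x - S n \<omega> x)\<^sup>2 \<partial>gauss_seq)"
        by (simp add: v0_S_second_moment Bochner_Integration.integral_sum)
      finally show "(\<integral>\<omega>. ((\<Sum>x\<in>I. t x * v0 \<omega> x) - (\<Sum>k<n. \<omega> k * c k))\<^sup>2 \<partial>gauss_seq)
          \<le> (\<Sum>x\<in>I. (t x)\<^sup>2) * (\<Sum>x\<in>I. \<integral>\<omega>. (v0 \<omega> x - S n \<omega> x)\<^sup>2 \<partial>gauss_seq)" .
    qed
    show "(\<lambda>n. (\<Sum>x\<in>I. (t x)\<^sup>2) * (\<Sum>x\<in>I. \<integral>\<omega>. (v0 \<omega> x - S n \<omega> x)\<^sup>2 \<partial>gauss_seq)) \<longlonglongrightarrow> 0"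
      by (rule tendsto_mult_right_zero, rule tendsto_null_sum) (rule v0_L2_lim)
  qed auto
  have "(\<Sum>k<n. (c k)\<^sup>2) = (\<Sum>x\<in>I. \<Sum>y\<in>I. t x * t y * (\<Sum>k<n. e k x * e k y))" for n
    by (induction n) (simp_all add: c_def power2_eq_square sum_product distrib_left sum.distrib mult_ac)
  then show "(\<lambda>n. \<Sum>k<n. (c k)\<^sup>2) \<longlonglongrightarrow> (\<Sum>x\<in>I. \<Sum>y\<in>I. t x * t y * K x y)"
    by (simp only:) (intro tendsto_intros e_expansion)
qed

end

section \<open>The field as a random element of L2\<close>

context covariance_kernel
begin

text \<open>The squared L2 distance of \<open>v0 \<omega>\<close> from a partial sum, kept
  extended-valued because square integrability of \<open>v0 \<omega>\<close> is not known at this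
  stage and may fail for exceptional \<open>\<omega>\<close>.\<close>

definition D :: "nat \<Rightarrow> (nat \<Rightarrow> real) \<Rightarrow> ennreal" where
  "D n \<omega> = (\<integral>\<^sup>+x. ennreal ((v0 \<omega> x - S n \<omega> x)\<^sup>2) \<partial>\<mu>)"

lemma D_meas [measurable]: "D n \<in> borel_measurable gauss_seq"
  unfolding D_def[abs_def] by (rule borel_measurable_nn_integral) measurable

lemma r_integrable: "integrable \<mu> (r n)"
  by (rule integrable_const_bound[where B=B]) (auto simp: r_nonneg r_le)

lemma integral_r_lim: "(\<lambda>n. \<integral>x. r n x \<partial>\<mu>) \<longlonglongrightarrow> 0"
proof -
  have "(\<lambda>n. \<integral>x. r n x \<partial>\<mu>) \<longlonglongrightarrow> (\<integral>x. 0 \<partial>\<mu>)"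
    by (rule integral_dominated_convergence[where w="\<lambda>_. B"]) (auto simp: r_lim r_nonneg r_le)
  then show ?thesis by simp
qed

lemma nn_integral_D: "(\<integral>\<^sup>+\<omega>. D n \<omega> \<partial>gauss_seq) \<le> ennreal (\<integral>x. r n x \<partial>\<mu>)"
proof -
  interpret G: prob_space gauss_seq by (rule prob_space_gauss_seq)
  interpret P: pair_sigma_finite \<mu> gauss_seq ..
  have "(\<integral>\<^sup>+\<omega>. D n \<omega> \<partial>gauss_seq) = (\<integral>\<^sup>+x. \<integral>\<^sup>+\<omega>. ennreal ((v0 \<omega> x - S n \<omega> x)\<^sup>2) \<partial>gauss_seq \<partial>\<mu>)"
    unfolding D_def by (rule P.Fubini') measurable
  also have "\<dots> \<le> (\<integral>\<^sup>+x. ennreal (r n x) \<partial>\<mu>)"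
    by (intro nn_integral_mono) (simp add: nn_integral_eq_integral[OF v0_S_second_moment(1)] ennreal_leI v0_S_second_moment(2))
  also have "\<dots> = ennreal (\<integral>x. r n x \<partial>\<mu>)"
    by (rule nn_integral_eq_integral[OF r_integrable]) (simp add: r_nonneg)
  finally show ?thesis .
qed

text \<open>A subsequence with summable mean errors. Along it the errors
  \<open>D (\<phi> m) \<omega>\<close> are almost surely summable, hence tend to zero for almost
  every \<open>\<omega>\<close>, which convergence of the means alone would not give.\<close>

definition \<phi> :: "nat \<Rightarrow> nat" where
  "\<phi> m = (SOME n. (\<integral>x. r n x \<partial>\<mu>) \<le> (1/2) ^ m)"

lemma integral_r_\<phi>: "(\<integral>x. r (\<phi> m) x \<partial>\<mu>) \<le> (1/2) ^ m"
proof -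
  have "\<forall>\<^sub>F n in sequentially. (\<integral>x. r n x \<partial>\<mu>) < (1/2) ^ m"
    by (rule order_tendstoD[OF integral_r_lim]) simp
  then have "\<exists>n. (\<integral>x. r n x \<partial>\<mu>) \<le> (1/2) ^ m"
    using eventually_happens'[OF sequentially_bot] less_imp_le by blast
  then show ?thesis unfolding \<phi>_def by (rule someI_ex)
qed

definition G :: "(nat \<Rightarrow> real) set" where
  "G = {\<omega>. (\<Sum>m. D (\<phi> m) \<omega>) < \<infinity>}"

lemma G_meas [measurable]: "G \<in> sets gauss_seq"
proof -
  have "{\<omega> \<in> space gauss_seq. (\<Sum>m. D (\<phi> m) \<omega>) < \<infinity>} \<in> sets gauss_seq"
    by measurable
  then show ?thesis by (simp add: G_def space_gauss_seq)
qed

lemma AE_G: "AE \<omega> in gauss_seq. \<omega> \<in> G"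
proof -
  have "(\<Sum>m. \<integral>\<^sup>+\<omega>. D (\<phi> m) \<omega> \<partial>gauss_seq) \<le> (\<Sum>m. ennreal ((1/2) ^ m))"
    by (intro suminf_le order_trans[OF nn_integral_D] ennreal_leI integral_r_\<phi>) auto
  also have "\<dots> < \<infinity>"
    by (subst suminf_ennreal2[OF _ summable_half_powers]) (simp_all only: infinity_ennreal_def ennreal_less_top, simp)
  finally have "(\<integral>\<^sup>+\<omega>. (\<Sum>m. D (\<phi> m) \<omega>) \<partial>gauss_seq) \<noteq> \<infinity>"
    by (subst nn_integral_suminf) auto
  then have "AE \<omega> in gauss_seq. (\<Sum>m. D (\<phi> m) \<omega>) \<noteq> \<infinity>"
    by (intro nn_integral_noteq_infinite) auto
  then show ?thesis
    by eventually_elim (simp add: G_def top.not_eq_extremum)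
qed

lemma S_abs_le: "\<bar>S n \<omega> x\<bar> \<le> (\<Sum>k<n. \<bar>\<omega> k\<bar>) * sqrt B"
  unfolding S_def sum_distrib_right
  by (rule order_trans[OF sum_abs], rule sum_mono) (simp add: abs_mult e_abs_le mult_left_mono)

lemma S_L2: "S n \<omega> \<in> L2_fun \<mu>"
  by (rule L2_fun_bounded[OF S_meas(3) S_abs_le])

lemma v0_L2:
  assumes "\<omega> \<in> G"
  shows "v0 \<omega> \<in> L2_fun \<mu>" "(\<lambda>m. \<integral>x. (v0 \<omega> x - S (\<phi> m) \<omega> x)\<^sup>2 \<partial>\<mu>) \<longlonglongrightarrow> 0"
    "D n \<omega> = ennreal (\<integral>x. (v0 \<omega> x - S n \<omega> x)\<^sup>2 \<partial>\<mu>)"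
proof -
  have fin: "(\<Sum>m. D (\<phi> m) \<omega>) < \<infinity>" using assms by (simp add: G_def)
  have "(\<lambda>x. v0 \<omega> x - S (\<phi> 0) \<omega> x) \<in> L2_fun \<mu>"
    using summable_tendsto_real(1)[OF fin, of 0]
    by (auto simp: L2_fun_def D_def intro!: integrableI_nonneg)
  from L2_fun_add[OF this S_L2[of "\<phi> 0" \<omega>]] show L2: "v0 \<omega> \<in> L2_fun \<mu>"
    by simp
  show D: "D n \<omega> = ennreal (\<integral>x. (v0 \<omega> x - S n \<omega> x)\<^sup>2 \<partial>\<mu>)" for n
    unfolding D_def using L2_fun_diff[OF L2 S_L2[of n \<omega>]]
    by (intro nn_integral_eq_integral) (auto simp: L2_fun_def)
  have "enn2real (D n \<omega>) = (\<integral>x. (v0 \<omega> x - S n \<omega> x)\<^sup>2 \<partial>\<mu>)" for n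
    unfolding D by simp
  then show "(\<lambda>m. \<integral>x. (v0 \<omega> x - S (\<phi> m) \<omega> x)\<^sup>2 \<partial>\<mu>) \<longlonglongrightarrow> 0"
    using summable_tendsto_real(3)[OF fin] by simp
qed

text \<open>A covariance kernel in the sense of \<open>has_covariance_kernel\<close> needs a
  representative in the class for every \<open>\<omega>\<close>. Off the event \<open>G\<close>,
  where square integrability may fail, the field is therefore replaced by zero.\<close>

definition v :: "(nat \<Rightarrow> real) \<Rightarrow> 'x \<Rightarrow> real" where
  "v \<omega> x = (if \<omega> \<in> G then v0 \<omega> x else 0)"

lemma v_meas [measurable]: "(\<lambda>(\<omega>, x). v \<omega> x) \<in> borel_measurable (gauss_seq \<Otimes>\<^sub>M \<mu>)"
  unfolding v_def[abs_def] by measurable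

lemma v_meas' [measurable]: "(\<lambda>\<omega>. v \<omega> x) \<in> borel_measurable gauss_seq"
  unfolding v_def[abs_def] by measurable

lemma AE_v: "AE \<omega> in gauss_seq. \<forall>x. v \<omega> x = v0 \<omega> x"
  using AE_G by eventually_elim (simp add: v_def)

lemma v_L2: "v \<omega> \<in> L2_fun \<mu>"
proof (cases "\<omega> \<in> G")
  case True
  then have "v \<omega> = v0 \<omega>" by (auto simp: v_def)
  then show ?thesis using v0_L2(1)[OF True] by simp
next
  case False
  then have "v \<omega> = (\<lambda>_. 0)" by (auto simp: v_def)
  then show ?thesis by (simp add: L2_fun_def)
qed

text \<open>The class of a partial sum depends continuously on the coefficients, hence is
  measurable. On \<open>G\<close> these classes converge in L2 along \<open>\<phi>\<close>, and
  metric limits of measurable maps are measurable.\<close>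

lemma v_class_meas: "(\<lambda>\<omega>. L2_class \<mu> (v \<omega>)) \<in> gauss_seq \<rightarrow>\<^sub>M borel_of_topology (L2_topology \<mu>)"
proof -
  interpret L2: Metric_space "L2_space \<mu>" "L2_dist \<mu>" by (rule Metric_space_L2)
  \<comment> \<open>Off \<open>G\<close> the approximants are set to the class of zero as well, so
    that they converge for every \<open>\<omega>\<close>.\<close>
  define X where "X m \<omega> = (if \<omega> \<in> G then L2_class \<mu> (S (\<phi> m) \<omega>) else L2_class \<mu> (\<lambda>_. 0))" for m \<omega>
  have zero: "(\<lambda>_. 0) \<in> L2_fun \<mu>" by (simp add: L2_fun_def)
  have S_class: "(\<lambda>\<omega>. L2_class \<mu> (S n \<omega>)) \<in> gauss_seq \<rightarrow>\<^sub>M borel_of_topology (L2_topology \<mu>)" for n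
  proof -
    have "(\<lambda>\<omega>. L2_class \<mu> (S n \<omega>)) \<in> borel \<rightarrow>\<^sub>M borel_of_topology (L2_topology \<mu>)"
      by (rule L2_class_continuous_measurable[where b="\<lambda>\<omega>. (\<Sum>k<n. \<bar>\<omega> k\<bar>) * sqrt B"])
         (auto simp: finite_measure_axioms S_def[abs_def] intro!: continuous_intros S_abs_le[unfolded S_def])
    then show ?thesis
      by (simp cong: measurable_cong_sets add: sets_gauss_seq_borel)
  qed
  show ?thesis
    unfolding L2_topology_def
  proof (rule L2.measurable_borel_of_mtopology_LIMSEQ[where X=X])
    show "X m \<in> gauss_seq \<rightarrow>\<^sub>M borel_of_topology L2.mtopology" for m
      unfolding X_def[abs_def] using S_class[of "\<phi> m"] L2_class_in_space[OF zero] G_meas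
      by (intro measurable_If_set) (auto simp: L2_topology_def space_borel_of_topology space_gauss_seq)
    show "L2_class \<mu> (v \<omega>) \<in> L2_space \<mu>" for \<omega>
      by (rule L2_class_in_space[OF v_L2])
    show "(\<lambda>m. L2_dist \<mu> (X m \<omega>) (L2_class \<mu> (v \<omega>))) \<longlonglongrightarrow> 0" for \<omega>
    proof (cases "\<omega> \<in> G")
      case True
      then have v: "v \<omega> = v0 \<omega>" by (auto simp: v_def)
      have "L2_dist \<mu> (X m \<omega>) (L2_class \<mu> (v \<omega>)) = sqrt (\<integral>x. (v0 \<omega> x - S (\<phi> m) \<omega> x)\<^sup>2 \<partial>\<mu>)" for m
        using True by (simp add: X_def v L2_dist_class[OF S_L2 v0_L2(1)] power2_commute)
      moreover have "(\<lambda>m. sqrt (\<integral>x. (v0 \<omega> x - S (\<phi> m) \<omega> x)\<^sup>2 \<partial>\<mu>)) \<longlonglongrightarrow> sqrt 0"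
        by (intro tendsto_intros v0_L2(2)[OF True])
      ultimately show ?thesis by simp
    next
      case False
      then have "v \<omega> = (\<lambda>_. 0)" by (auto simp: v_def)
      with False show ?thesis by (simp add: X_def L2_dist_class[OF zero zero])
    qed
  qed
qed

lemma v_integrable_mult: "integrable gauss_seq (\<lambda>\<omega>. v \<omega> x * v \<omega> y)"
  and v_covariance: "(\<integral>\<omega>. v \<omega> x * v \<omega> y \<partial>gauss_seq) = K x y"
proof -
  have AE: "AE \<omega> in gauss_seq. v \<omega> x * v \<omega> y = v0 \<omega> x * v0 \<omega> y"
    using AE_v by eventually_elim simp
  show "integrable gauss_seq (\<lambda>\<omega>. v \<omega> x * v \<omega> y)"
    using L2_fun_integrable_mult[OF v0_L2_gauss v0_L2_gauss] AE
    by (subst integrable_cong_AE[where g="\<lambda>\<omega>. v0 \<omega> x * v0 \<omega> y"]) auto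
  show "(\<integral>\<omega>. v \<omega> x * v \<omega> y \<partial>gauss_seq) = K x y"
    using v0_covariance AE by (subst integral_cong_AE[where g="\<lambda>\<omega>. v0 \<omega> x * v0 \<omega> y"]) auto
qed

lemma v_cos:
  assumes "finite I"
  shows "(\<integral>\<omega>. cos ((\<Sum>x\<in>I. t x * v \<omega> x) + c) \<partial>gauss_seq) =
    exp (- (\<Sum>x\<in>I. \<Sum>y\<in>I. t x * t y * K x y) / 2) * cos c"
proof -
  interpret prob_space gauss_seq by (rule prob_space_gauss_seq)
  have "(\<integral>\<omega>. cos ((\<Sum>x\<in>I. t x * v \<omega> x) + c) \<partial>gauss_seq) = (\<integral>\<omega>. cos ((\<Sum>x\<in>I. t x * v0 \<omega> x) + c) \<partial>gauss_seq)"
  proof (rule integral_cong_AE)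
    show "AE \<omega> in gauss_seq. cos ((\<Sum>x\<in>I. t x * v \<omega> x) + c) = cos ((\<Sum>x\<in>I. t x * v0 \<omega> x) + c)"
      using AE_v by eventually_elim simp
  qed measurable
  then show ?thesis
    by (simp add: expectation_cos_char v0_char[OF assms])
qed

text \<open>The inner product with \<open>h\<close> is the mean-square limit of Gaussian sums whose
  coefficients \<open>c k\<close> are the inner products of the \<open>e k\<close> with
  \<open>h\<close>. By the Cauchy-Schwarz inequality its squared error is at most
  \<open>H * D n\<close>, whose mean is controlled by the integral of \<open>r n\<close>.\<close>

lemma v_inner_normal:
  assumes h: "h \<in> L2_space \<mu>"
  shows "centred_normal_law (distr gauss_seq borel (\<lambda>\<omega>. L2_inner \<mu> (L2_class \<mu> (v \<omega>)) h))"
proof -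
  interpret P: prob_space gauss_seq by (rule prob_space_gauss_seq)
  define g where "g = L2_rep h"
  have g: "g \<in> L2_fun \<mu>" unfolding g_def by (rule L2_rep_in_class(2)[OF h])
  then have g_meas [measurable]: "g \<in> borel_measurable \<mu>" by (simp add: L2_fun_def)
  define A where "A \<omega> = (\<integral>x. v \<omega> x * g x \<partial>\<mu>)" for \<omega>
  have A_eq: "L2_inner \<mu> (L2_class \<mu> (v \<omega>)) h = A \<omega>" for \<omega>
    unfolding A_def g_def by (rule L2_inner_class_left[OF v_L2 h])
  have A_meas [measurable]: "A \<in> borel_measurable gauss_seq"
    unfolding A_def[abs_def] by (rule borel_measurable_lebesgue_integral) measurable
  define H where "H = (\<integral>x. (g x)\<^sup>2 \<partial>\<mu>)"
  have H0: "H \<ge> 0" by (simp add: H_def)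
  define c where "c k = (\<integral>x. e k x * g x \<partial>\<mu>)" for k
  have e_L2: "e k \<in> L2_fun \<mu>" for k
    by (rule L2_fun_bounded[OF e_meas e_abs_le])
  have sum_c: "(\<Sum>k<n. \<omega> k * c k) = (\<integral>x. S n \<omega> x * g x \<partial>\<mu>)" for n \<omega>
    unfolding c_def S_def sum_distrib_right
    by (subst Bochner_Integration.integral_sum) (auto simp: mult.assoc L2_fun_integrable_mult[OF e_L2 g])
  have diff_le: "(A \<omega> - (\<Sum>k<n. \<omega> k * c k))\<^sup>2 \<le> H * enn2real (D n \<omega>)" if "\<omega> \<in> G" for n \<omega>
  proof -
    have v: "v \<omega> = v0 \<omega>" using that by (auto simp: v_def)
    note L2 = L2_fun_diff[OF v0_L2(1)[OF that] S_L2[of n \<omega>]]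
    have "A \<omega> - (\<Sum>k<n. \<omega> k * c k) = (\<integral>x. (v0 \<omega> x - S n \<omega> x) * g x \<partial>\<mu>)"
      unfolding A_def sum_c v
      using L2_fun_integrable_mult[OF v0_L2(1)[OF that] g] L2_fun_integrable_mult[OF S_L2[of n \<omega>] g]
      by (simp add: left_diff_distrib)
    then have "\<bar>A \<omega> - (\<Sum>k<n. \<omega> k * c k)\<bar> \<le> sqrt (enn2real (D n \<omega>)) * sqrt H"
      using L2_fun_abs_Cauchy_Schwarz[OF L2 g] v0_L2(3)[OF that, of n] by (simp add: H_def)
    then have "\<bar>A \<omega> - (\<Sum>k<n. \<omega> k * c k)\<bar>\<^sup>2 \<le> (sqrt (enn2real (D n \<omega>)) * sqrt H)\<^sup>2"
      by (intro power_mono) auto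
    then show ?thesis
      using H0 by (simp add: power_mult_distrib mult.commute)
  qed
  have D_int: "integrable gauss_seq (\<lambda>\<omega>. enn2real (D n \<omega>))"
    and D_le: "(\<integral>\<omega>. enn2real (D n \<omega>) \<partial>gauss_seq) \<le> (\<integral>x. r n x \<partial>\<mu>)" for n
  proof -
    have eq: "(\<integral>\<^sup>+\<omega>. ennreal (enn2real (D n \<omega>)) \<partial>gauss_seq) = (\<integral>\<^sup>+\<omega>. D n \<omega> \<partial>gauss_seq)"
      by (rule nn_integral_cong_AE, use AE_G in eventually_elim) (simp add: v0_L2(3))
    then have fin: "(\<integral>\<^sup>+\<omega>. ennreal (enn2real (D n \<omega>)) \<partial>gauss_seq) \<le> ennreal (\<integral>x. r n x \<partial>\<mu>)"
      using nn_integral_D by simp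
    then show int: "integrable gauss_seq (\<lambda>\<omega>. enn2real (D n \<omega>))"
      by (intro integrableI_nonneg) (auto intro: le_less_trans)
    show "(\<integral>\<omega>. enn2real (D n \<omega>) \<partial>gauss_seq) \<le> (\<integral>x. r n x \<partial>\<mu>)"
      using fin by (subst (asm) nn_integral_eq_integral[OF int]) (auto simp: r_nonneg)
  qed
  have sq: "integrable gauss_seq (\<lambda>\<omega>. (A \<omega> - (\<Sum>k<n. \<omega> k * c k))\<^sup>2)" for n
  proof (rule Bochner_Integration.integrable_bound)
    show "integrable gauss_seq (\<lambda>\<omega>. H * enn2real (D n \<omega>))"
      using D_int by simp
    show "AE \<omega> in gauss_seq. norm ((A \<omega> - (\<Sum>k<n. \<omega> k * c k))\<^sup>2) \<le> norm (H * enn2real (D n \<omega>))"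
      using AE_G by eventually_elim (use diff_le H0 in \<open>auto simp: abs_mult\<close>)
  qed measurable
  have lim: "(\<lambda>n. \<integral>\<omega>. (A \<omega> - (\<Sum>k<n. \<omega> k * c k))\<^sup>2 \<partial>gauss_seq) \<longlonglongrightarrow> 0"
  proof (rule tendsto_sandwich[OF _ _ tendsto_const])
    show "\<forall>\<^sub>F n in sequentially. (\<integral>\<omega>. (A \<omega> - (\<Sum>k<n. \<omega> k * c k))\<^sup>2 \<partial>gauss_seq) \<le> H * (\<integral>x. r n x \<partial>\<mu>)"
    proof (intro always_eventually allI)
      fix n
      have "(\<integral>\<omega>. (A \<omega> - (\<Sum>k<n. \<omega> k * c k))\<^sup>2 \<partial>gauss_seq) \<le> (\<integral>\<omega>. H * enn2real (D n \<omega>) \<partial>gauss_seq)"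
        using AE_G diff_le D_int sq by (intro integral_mono_AE) (auto elim: eventually_mono)
      also have "\<dots> \<le> H * (\<integral>x. r n x \<partial>\<mu>)"
        using D_le[of n] H0 by (simp add: mult_left_mono)
      finally show "(\<integral>\<omega>. (A \<omega> - (\<Sum>k<n. \<omega> k * c k))\<^sup>2 \<partial>gauss_seq) \<le> H * (\<integral>x. r n x \<partial>\<mu>)" .
    qed
    show "(\<lambda>n. H * (\<integral>x. r n x \<partial>\<mu>)) \<longlonglongrightarrow> 0"
      by (rule tendsto_mult_right_zero[OF integral_r_lim])
  qed auto
  \<comment> \<open>The variance of the limit is finite: \<open>(c k)\<^sup>2\<close> is at most
    \<open>H\<close> times the integral of \<open>(e k)\<^sup>2\<close>, and the squares of the
    \<open>e k\<close> sum to at most \<open>B\<close> at every point.\<close>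
  have "summable (\<lambda>k. (c k)\<^sup>2)"
  proof (rule bounded_imp_summable)
    fix n
    have "(c k)\<^sup>2 \<le> H * (\<integral>x. (e k x)\<^sup>2 \<partial>\<mu>)" for k
    proof -
      have "\<bar>c k\<bar>\<^sup>2 \<le> (sqrt (\<integral>x. (e k x)\<^sup>2 \<partial>\<mu>) * sqrt H)\<^sup>2"
        using L2_fun_abs_Cauchy_Schwarz[OF e_L2 g, of k] by (intro power_mono) (auto simp: c_def H_def)
      then show ?thesis using H0 by (simp add: power_mult_distrib mult.commute)
    qed
    then have "(\<Sum>k\<le>n. (c k)\<^sup>2) \<le> H * (\<Sum>k\<le>n. \<integral>x. (e k x)\<^sup>2 \<partial>\<mu>)"
      unfolding sum_distrib_left by (rule sum_mono)
    also have "(\<Sum>k\<le>n. \<integral>x. (e k x)\<^sup>2 \<partial>\<mu>) = (\<integral>x. (\<Sum>k\<le>n. (e k x)\<^sup>2) \<partial>\<mu>)"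
      using e_L2 by (intro Bochner_Integration.integral_sum[symmetric]) (auto simp: L2_fun_def)
    also have "(\<integral>x. (\<Sum>k\<le>n. (e k x)\<^sup>2) \<partial>\<mu>) \<le> (\<integral>x. B \<partial>\<mu>)"
    proof (rule integral_mono)
      show "(\<Sum>k\<le>n. (e k x)\<^sup>2) \<le> B" for x
        using sum_e_sq[of 0 "Suc n" x] r_nonneg[of "Suc n" x] r_le[of 0 x]
        by (simp add: atLeast0LessThan lessThan_Suc_atMost)
    qed (use e_L2 in \<open>auto simp: L2_fun_def\<close>)
    finally show "(\<Sum>k\<le>n. (c k)\<^sup>2) \<le> H * (\<integral>x. B \<partial>\<mu>)"
      using H0 by (simp add: mult_left_mono)
  qed simp
  then have q: "(\<lambda>n. \<Sum>k<n. (c k)\<^sup>2) \<longlonglongrightarrow> (\<Sum>k. (c k)\<^sup>2)" and q0: "(\<Sum>k. (c k)\<^sup>2) \<ge> 0"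
    by (rule summable_LIMSEQ) (rule suminf_nonneg, fact, simp)
  show ?thesis
    unfolding A_eq
    by (rule P.centred_normal_law_char[OF A_meas gauss_seq_L2_limit_char[OF A_meas sq lim q] q0])
qed

end

section \<open>A central limit theorem for bounded random fields\<close>

text \<open>The mean-square increment between \<open>x\<close> and \<open>y\<close> of a centred
  field with covariance \<open>K\<close>.\<close>

definition kdist :: "('x \<Rightarrow> 'x \<Rightarrow> real) \<Rightarrow> 'x \<Rightarrow> 'x \<Rightarrow> real" where
  "kdist K x y = K x x - 2 * K x y + K y y"

text \<open>On each of the finitely many level sets of \<open>F\<close> the expression depends on
  \<open>\<omega>\<close> only, so it is a finite sum of products with indicators. Measurability of
  \<open>y\<close> is thus a matter of finitely many points.\<close>

lemma simple_function_compose_pair_measurable: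
  fixes y :: "'a \<Rightarrow> 'i \<Rightarrow> real"
  assumes F: "simple_function \<mu> F" and y: "\<And>i. i \<in> F ` space \<mu> \<Longrightarrow> (\<lambda>\<omega>. y \<omega> i) \<in> borel_measurable Q"
  shows "(\<lambda>(\<omega>, x). y \<omega> (F x)) \<in> borel_measurable (Q \<Otimes>\<^sub>M \<mu>)"
proof -
  let ?A = "\<lambda>i. F -` {i} \<inter> space \<mu>"
  have fin: "finite (F ` space \<mu>)" using F by (simp add: simple_function_def)
  have [measurable]: "?A i \<in> sets \<mu>" if "i \<in> F ` space \<mu>" for i
    using F that by (auto simp: simple_function_def)
  have "(\<lambda>p. \<Sum>i\<in>F ` space \<mu>. y (fst p) i * indicator (?A i) (snd p)) \<in> borel_measurable (Q \<Otimes>\<^sub>M \<mu>)"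
  proof (intro borel_measurable_sum borel_measurable_times)
    fix i assume i: "i \<in> F ` space \<mu>"
    note [measurable] = y[OF i] \<open>i \<in> F ` space \<mu> \<Longrightarrow> ?A i \<in> sets \<mu>\<close>[OF i]
    show "(\<lambda>p. y (fst p) i) \<in> borel_measurable (Q \<Otimes>\<^sub>M \<mu>)"
      "(\<lambda>p. indicator (?A i) (snd p)) \<in> borel_measurable (Q \<Otimes>\<^sub>M \<mu>)"
      by measurable
  qed
  moreover have "(\<Sum>i\<in>F ` space \<mu>. y (fst p) i * indicator (?A i) (snd p)) = (case p of (\<omega>, x) \<Rightarrow> y \<omega> (F x))"
    if "p \<in> space (Q \<Otimes>\<^sub>M \<mu>)" for p
  proof -
    have x: "snd p \<in> space \<mu>" using that by (auto simp: space_pair_measure)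
    have "(\<Sum>i\<in>F ` space \<mu>. y (fst p) i * indicator (?A i) (snd p)) =
        (\<Sum>i\<in>F ` space \<mu>. if i = F (snd p) then y (fst p) i else 0)"
      using x by (intro sum.cong) (auto simp: indicator_def)
    then show ?thesis
      using fin x by (simp add: sum.delta' case_prod_beta)
  qed
  ultimately show ?thesis
    by (simp cong: measurable_cong)
qed

lemma simple_function_compose_L2:
  fixes y :: "'i \<Rightarrow> real"
  assumes "finite_measure \<mu>" and F: "simple_function \<mu> F"
  shows "(\<lambda>x. y (F x)) \<in> L2_fun \<mu>"
proof -
  interpret finite_measure \<mu> by fact
  have "(\<lambda>x. y (F x)) \<in> borel_measurable \<mu>"
    using simple_function_compose1[OF F] by (rule borel_measurable_simple_function)
  moreover have "\<bar>y (F x)\<bar> \<le> (\<Sum>i\<in>F ` space \<mu>. \<bar>y i\<bar>)" if "x \<in> space \<mu>" for x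
    using F that by (intro member_le_sum) (auto simp: simple_function_def)
  ultimately show ?thesis by (rule L2_fun_bounded)
qed

lemma expectation_L2_sq:
  assumes "finite_measure \<mu>" "prob_space Q"
    and W: "(\<lambda>(\<omega>, x). W \<omega> x) \<in> borel_measurable (Q \<Otimes>\<^sub>M \<mu>)"
    and L2: "\<And>\<omega>. \<omega> \<in> space Q \<Longrightarrow> W \<omega> \<in> L2_fun \<mu>"
    and sq: "\<And>x. x \<in> space \<mu> \<Longrightarrow> integrable Q (\<lambda>\<omega>. (W \<omega> x)\<^sup>2)"
    and bdd: "\<And>x. x \<in> space \<mu> \<Longrightarrow> (\<integral>\<omega>. (W \<omega> x)\<^sup>2 \<partial>Q) \<le> C"
  shows "integrable Q (\<lambda>\<omega>. \<integral>x. (W \<omega> x)\<^sup>2 \<partial>\<mu>)" "integrable \<mu> (\<lambda>x. \<integral>\<omega>. (W \<omega> x)\<^sup>2 \<partial>Q)"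
    "(\<integral>\<omega>. \<integral>x. (W \<omega> x)\<^sup>2 \<partial>\<mu> \<partial>Q) = (\<integral>x. \<integral>\<omega>. (W \<omega> x)\<^sup>2 \<partial>Q \<partial>\<mu>)"
proof -
  interpret \<mu>: finite_measure \<mu> by fact
  interpret Q: prob_space Q by fact
  interpret P: pair_sigma_finite \<mu> Q ..
  interpret P': pair_sigma_finite Q \<mu> ..
  have W_sq [measurable]: "(\<lambda>(\<omega>, x). (W \<omega> x)\<^sup>2) \<in> borel_measurable (Q \<Otimes>\<^sub>M \<mu>)"
    using W by (simp add: case_prod_beta)
  have meas1 [measurable]: "(\<lambda>\<omega>. \<integral>x. (W \<omega> x)\<^sup>2 \<partial>\<mu>) \<in> borel_measurable Q"
    by (rule \<mu>.borel_measurable_lebesgue_integral[OF W_sq])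
  have W_sq' [measurable]: "(\<lambda>(x, \<omega>). (W \<omega> x)\<^sup>2) \<in> borel_measurable (\<mu> \<Otimes>\<^sub>M Q)"
    using measurable_pair_swap[OF W_sq] by (simp add: case_prod_beta)
  have meas2 [measurable]: "(\<lambda>x. \<integral>\<omega>. (W \<omega> x)\<^sup>2 \<partial>Q) \<in> borel_measurable \<mu>"
    by (rule Q.borel_measurable_lebesgue_integral[OF W_sq'])
  show int2: "integrable \<mu> (\<lambda>x. \<integral>\<omega>. (W \<omega> x)\<^sup>2 \<partial>Q)"
    by (rule \<mu>.integrable_const_bound[where B=C]) (auto intro!: AE_I2 bdd)
  have "(\<integral>\<^sup>+\<omega>. ennreal (\<integral>x. (W \<omega> x)\<^sup>2 \<partial>\<mu>) \<partial>Q) = (\<integral>\<^sup>+\<omega>. \<integral>\<^sup>+x. ennreal ((W \<omega> x)\<^sup>2) \<partial>\<mu> \<partial>Q)"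
    using L2 by (intro nn_integral_cong nn_integral_eq_integral[symmetric]) (auto simp: L2_fun_def)
  also have "\<dots> = (\<integral>\<^sup>+x. \<integral>\<^sup>+\<omega>. ennreal ((W \<omega> x)\<^sup>2) \<partial>Q \<partial>\<mu>)"
    by (rule P.Fubini') measurable
  also have "\<dots> = (\<integral>\<^sup>+x. ennreal (\<integral>\<omega>. (W \<omega> x)\<^sup>2 \<partial>Q) \<partial>\<mu>)"
    using sq by (intro nn_integral_cong nn_integral_eq_integral) auto
  also have "\<dots> = ennreal (\<integral>x. \<integral>\<omega>. (W \<omega> x)\<^sup>2 \<partial>Q \<partial>\<mu>)"
    by (rule nn_integral_eq_integral[OF int2]) auto
  finally have eq: "(\<integral>\<^sup>+\<omega>. ennreal (\<integral>x. (W \<omega> x)\<^sup>2 \<partial>\<mu>) \<partial>Q) = ennreal (\<integral>x. \<integral>\<omega>. (W \<omega> x)\<^sup>2 \<partial>Q \<partial>\<mu>)" .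
  show int1: "integrable Q (\<lambda>\<omega>. \<integral>x. (W \<omega> x)\<^sup>2 \<partial>\<mu>)"
    by (rule integrableI_nonneg) (auto simp: eq)
  show "(\<integral>\<omega>. \<integral>x. (W \<omega> x)\<^sup>2 \<partial>\<mu> \<partial>Q) = (\<integral>x. \<integral>\<omega>. (W \<omega> x)\<^sup>2 \<partial>Q \<partial>\<mu>)"
    using eq unfolding nn_integral_eq_integral[OF int1 AE_I2[OF integral_nonneg_AE[OF AE_I2[OF zero_le_power2]]]]
    by (simp add: integral_nonneg_AE)
qed

text \<open>The Lipschitz property bounds the difference by the mean L2 distance, Jensen's
  inequality by the root of its second moment, and exchanging the integrals leaves pointwise
  mean-square distances, which covariances compute.\<close>

lemma L2_Lipschitz_expectation_diff:
  assumes "finite_measure \<mu>" "prob_space Q"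
    and f_bdd: "\<And>F. F \<in> L2_space \<mu> \<Longrightarrow> \<bar>f F\<bar> \<le> B"
    and f_lip: "\<And>F G. F \<in> L2_space \<mu> \<Longrightarrow> G \<in> L2_space \<mu> \<Longrightarrow> \<bar>f F - f G\<bar> \<le> L * L2_dist \<mu> F G"
    and Z: "(\<lambda>(\<omega>, x). Z \<omega> x) \<in> borel_measurable (Q \<Otimes>\<^sub>M \<mu>)" and Z': "(\<lambda>(\<omega>, x). Z' \<omega> x) \<in> borel_measurable (Q \<Otimes>\<^sub>M \<mu>)"
    and L2: "\<And>\<omega>. \<omega> \<in> space Q \<Longrightarrow> Z \<omega> \<in> L2_fun \<mu>" "\<And>\<omega>. \<omega> \<in> space Q \<Longrightarrow> Z' \<omega> \<in> L2_fun \<mu>"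
    and fZ [measurable]: "(\<lambda>\<omega>. f (L2_class \<mu> (Z \<omega>))) \<in> borel_measurable Q" "(\<lambda>\<omega>. f (L2_class \<mu> (Z' \<omega>))) \<in> borel_measurable Q"
    and sq: "\<And>x. x \<in> space \<mu> \<Longrightarrow> integrable Q (\<lambda>\<omega>. (Z \<omega> x - Z' \<omega> x)\<^sup>2)"
    and bdd: "\<And>x. x \<in> space \<mu> \<Longrightarrow> (\<integral>\<omega>. (Z \<omega> x - Z' \<omega> x)\<^sup>2 \<partial>Q) \<le> C"
  shows "\<bar>(\<integral>\<omega>. f (L2_class \<mu> (Z \<omega>)) \<partial>Q) - (\<integral>\<omega>. f (L2_class \<mu> (Z' \<omega>)) \<partial>Q)\<bar>
    \<le> \<bar>L\<bar> * sqrt (\<integral>x. \<integral>\<omega>. (Z \<omega> x - Z' \<omega> x)\<^sup>2 \<partial>Q \<partial>\<mu>)"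
proof -
  interpret Q: prob_space Q by fact
  have W: "(\<lambda>(\<omega>, x). Z \<omega> x - Z' \<omega> x) \<in> borel_measurable (Q \<Otimes>\<^sub>M \<mu>)"
    using Z Z' by (simp add: case_prod_beta)
  note E = expectation_L2_sq[where W="\<lambda>\<omega> x. Z \<omega> x - Z' \<omega> x", OF assms(1,2) W L2_fun_diff[OF L2] sq bdd]
  let ?T = "\<lambda>\<omega>. sqrt (\<integral>x. (Z \<omega> x - Z' \<omega> x)\<^sup>2 \<partial>\<mu>)"
  have T_meas: "?T \<in> borel_measurable Q"
    using borel_measurable_integrable[OF E(1)] by simp
  have T_sq: "integrable Q (\<lambda>\<omega>. (?T \<omega>)\<^sup>2)"
    using E(1) by (simp add: integral_nonneg_AE)
  note T = Q.expectation_abs_le_sqrt[OF T_meas T_sq]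
  have "\<bar>(\<integral>\<omega>. f (L2_class \<mu> (Z \<omega>)) \<partial>Q) - (\<integral>\<omega>. f (L2_class \<mu> (Z' \<omega>)) \<partial>Q)\<bar> \<le> (\<integral>\<omega>. \<bar>L\<bar> * ?T \<omega> \<partial>Q)"
  proof (rule Q.expectation_abs_diff_le)
    show "integrable Q (\<lambda>\<omega>. f (L2_class \<mu> (Z \<omega>)))" "integrable Q (\<lambda>\<omega>. f (L2_class \<mu> (Z' \<omega>)))"
      using f_bdd[OF L2_class_in_space[OF L2(1)]] f_bdd[OF L2_class_in_space[OF L2(2)]]
      by (auto intro!: Q.integrable_const_bound[where B=B] AE_I2)
    show "integrable Q (\<lambda>\<omega>. \<bar>L\<bar> * ?T \<omega>)"
      using T(1) by simp
    fix \<omega> assume \<omega>: "\<omega> \<in> space Q"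
    have "\<bar>f (L2_class \<mu> (Z \<omega>)) - f (L2_class \<mu> (Z' \<omega>))\<bar> \<le> L * L2_dist \<mu> (L2_class \<mu> (Z \<omega>)) (L2_class \<mu> (Z' \<omega>))"
      using L2[OF \<omega>] by (intro f_lip L2_class_in_space)
    also have "\<dots> \<le> \<bar>L\<bar> * ?T \<omega>"
      unfolding L2_dist_class[OF L2[OF \<omega>]] by (intro mult_right_mono) auto
    finally show "\<bar>f (L2_class \<mu> (Z \<omega>)) - f (L2_class \<mu> (Z' \<omega>))\<bar> \<le> \<bar>L\<bar> * ?T \<omega>" .
  qed
  also have "\<dots> = \<bar>L\<bar> * (\<integral>\<omega>. \<bar>?T \<omega>\<bar> \<partial>Q)"
    by simp
  also have "\<dots> \<le> \<bar>L\<bar> * sqrt (\<integral>\<omega>. (?T \<omega>)\<^sup>2 \<partial>Q)"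
    using T(2) by (intro mult_left_mono) auto
  also have "(\<integral>\<omega>. (?T \<omega>)\<^sup>2 \<partial>Q) = (\<integral>x. \<integral>\<omega>. (Z \<omega> x - Z' \<omega> x)\<^sup>2 \<partial>Q \<partial>\<mu>)"
    using E(3) by (simp add: integral_nonneg_AE)
  finally show ?thesis .
qed

text \<open>Turns a Lipschitz functional on L2 into a Lipschitz function of finitely many field
  values. The crude bound of each difference by the sum of all of them gives the root of the total
  mass as constant.\<close>

lemma L2_dist_class_simple_compose:
  fixes y y' :: "'i \<Rightarrow> real"
  assumes "finite_measure \<mu>" and F: "simple_function \<mu> F"
  shows "L2_dist \<mu> (L2_class \<mu> (\<lambda>x. y (F x))) (L2_class \<mu> (\<lambda>x. y' (F x)))
    \<le> sqrt (measure \<mu> (space \<mu>)) * (\<Sum>i\<in>F ` space \<mu>. \<bar>y i - y' i\<bar>)" (is "_ \<le> _ * ?s")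
proof -
  interpret finite_measure \<mu> by fact
  note L2 = simple_function_compose_L2[OF assms]
  have s0: "?s \<ge> 0" by (simp add: sum_nonneg)
  have "(\<integral>x. (y (F x) - y' (F x))\<^sup>2 \<partial>\<mu>) \<le> (\<integral>x. ?s\<^sup>2 \<partial>\<mu>)"
  proof (rule integral_mono)
    show "integrable \<mu> (\<lambda>x. (y (F x) - y' (F x))\<^sup>2)"
      using L2_fun_diff[OF L2 L2, of y y'] by (simp add: L2_fun_def)
    fix x assume "x \<in> space \<mu>"
    then have "\<bar>y (F x) - y' (F x)\<bar> \<le> ?s"
      using F by (intro member_le_sum[where f="\<lambda>i. \<bar>y i - y' i\<bar>"]) (auto simp: simple_function_def)
    then show "(y (F x) - y' (F x))\<^sup>2 \<le> ?s\<^sup>2"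
      using power_mono[of "\<bar>y (F x) - y' (F x)\<bar>" ?s 2] by simp
  qed simp
  also have "\<dots> = measure \<mu> (space \<mu>) * ?s\<^sup>2"
    by simp
  finally have "sqrt (\<integral>x. (y (F x) - y' (F x))\<^sup>2 \<partial>\<mu>) \<le> sqrt (measure \<mu> (space \<mu>) * ?s\<^sup>2)"
    by (rule real_sqrt_le_mono)
  then show ?thesis
    unfolding L2_dist_class[OF L2 L2] using s0 by (simp add: real_sqrt_mult)
qed

context covariance_kernel
begin

lemma kdist_le: "kdist K x y \<le> 4 * B"
  using pos_kernel_abs_le[OF pos, of x y] K_le[of x] K_le[of y] by (simp add: kdist_def)

lemma kdist_nonneg: "0 \<le> kdist K x y"
  using pos_kernel_abs_le[OF pos, of x y] by (simp add: kdist_def)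

lemma v_diff_sq:
  "integrable gauss_seq (\<lambda>\<omega>. (v \<omega> x - v \<omega> y)\<^sup>2)" "(\<integral>\<omega>. (v \<omega> x - v \<omega> y)\<^sup>2 \<partial>gauss_seq) = kdist K x y"
proof -
  have eq: "(v \<omega> x - v \<omega> y)\<^sup>2 = v \<omega> x * v \<omega> x - 2 * (v \<omega> x * v \<omega> y) + v \<omega> y * v \<omega> y" for \<omega>
    by (simp add: power2_eq_square algebra_simps)
  show "integrable gauss_seq (\<lambda>\<omega>. (v \<omega> x - v \<omega> y)\<^sup>2)" "(\<integral>\<omega>. (v \<omega> x - v \<omega> y)\<^sup>2 \<partial>gauss_seq) = kdist K x y"
    unfolding eq kdist_def by (simp_all add: v_integrable_mult v_covariance)
qed

lemma kdist_integral_tendsto_0: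
  assumes F: "\<And>m. simple_function \<mu> (F m)" "\<And>x. x \<in> space \<mu> \<Longrightarrow> (\<lambda>m. F m x) \<longlonglongrightarrow> x"
  shows "(\<lambda>m. \<integral>x. kdist K x (F m x) \<partial>\<mu>) \<longlonglongrightarrow> 0"
proof -
  have K_cont: "continuous_on UNIV (\<lambda>p. K (fst p) (snd p))"
    using cont by (simp add: case_prod_beta)
  have [measurable]: "(\<lambda>p. K (fst p) (snd p)) \<in> borel_measurable (borel \<Otimes>\<^sub>M borel)"
    using borel_measurable_continuous_onI[OF K_cont] by (simp add: borel_prod)
  have [measurable]: "F m \<in> \<mu> \<rightarrow>\<^sub>M borel" for m
    by (rule borel_measurable_simple_function[OF F(1)])
  have meas: "(\<lambda>x. K (g x) (h x)) \<in> borel_measurable \<mu>"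
    if [measurable]: "g \<in> \<mu> \<rightarrow>\<^sub>M borel" "h \<in> \<mu> \<rightarrow>\<^sub>M borel" for g h
    using measurable_compose[of "\<lambda>x. (g x, h x)" \<mu> "borel \<Otimes>\<^sub>M borel" "\<lambda>p. K (fst p) (snd p)" borel] by simp
  have [measurable]: "(\<lambda>x. kdist K x (F m x)) \<in> borel_measurable \<mu>" for m
    unfolding kdist_def by (intro borel_measurable_add borel_measurable_diff borel_measurable_times meas) auto
  have "(\<lambda>m. \<integral>x. kdist K x (F m x) \<partial>\<mu>) \<longlonglongrightarrow> (\<integral>x. 0 \<partial>\<mu>)"
  proof (rule integral_dominated_convergence[where w="\<lambda>_. 4 * B"])
    show "AE x in \<mu>. (\<lambda>m. kdist K x (F m x)) \<longlonglongrightarrow> 0"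
    proof (rule AE_I2)
      fix x assume x: "x \<in> space \<mu>"
      have lim: "(\<lambda>m. K (g m) (h m)) \<longlonglongrightarrow> K a b" if "g \<longlonglongrightarrow> a" "h \<longlonglongrightarrow> b" for g h a b
        using continuous_on_tendsto_compose[OF K_cont tendsto_Pair[OF that]] by simp
      have "(\<lambda>m. kdist K x (F m x)) \<longlonglongrightarrow> K x x - 2 * K x x + K x x"
        unfolding kdist_def by (intro tendsto_intros lim F(2)[OF x])
      then show "(\<lambda>m. kdist K x (F m x)) \<longlonglongrightarrow> 0" by simp
    qed
  qed (auto simp: kdist_nonneg kdist_le)
  then show ?thesis by simp
qed

end

text \<open>Cramer-Wold reduction: a linear combination of field values is again a normalised sum of
  independent, bounded, centred variables, and its averaged variance converges to the quadratic form
  of \<open>K\<close>.\<close>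

lemma (in prob_space) clt_field_cos:
  fixes \<xi> :: "nat \<Rightarrow> 'a \<Rightarrow> 'i \<Rightarrow> real"
  assumes I: "finite I"
    and indep: "\<And>t. indep_vars (\<lambda>_. borel) (\<lambda>j \<omega>. \<Sum>x\<in>I. t x * \<xi> j \<omega> x) UNIV"
    and meas [measurable]: "\<And>j x. (\<lambda>\<omega>. \<xi> j \<omega> x) \<in> borel_measurable M"
    and bdd: "\<And>j \<omega> x. \<omega> \<in> space M \<Longrightarrow> \<bar>\<xi> j \<omega> x\<bar> \<le> C"
    and mean: "\<And>j x. expectation (\<lambda>\<omega>. \<xi> j \<omega> x) = 0"
    and cov: "\<And>x y. x \<in> I \<Longrightarrow> y \<in> I \<Longrightarrow> (\<lambda>n. (\<Sum>j<n. expectation (\<lambda>\<omega>. \<xi> j \<omega> x * \<xi> j \<omega> y)) / real n) \<longlonglongrightarrow> K x y"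
  shows "(\<lambda>n. expectation (\<lambda>\<omega>. cos ((\<Sum>x\<in>I. t x * (1 / sqrt (real n) * (\<Sum>j<n. \<xi> j \<omega> x))) + c)))
    \<longlonglongrightarrow> exp (- (\<Sum>x\<in>I. \<Sum>y\<in>I. t x * t y * K x y) / 2) * cos c"
proof -
  let ?X = "\<lambda>j \<omega>. \<Sum>x\<in>I. t x * \<xi> j \<omega> x"
  have int: "integrable M (\<lambda>\<omega>. \<xi> j \<omega> x)" for j x
    using bdd by (intro integrable_const_bound[where B=C]) auto
  have int2: "integrable M (\<lambda>\<omega>. \<xi> j \<omega> x * \<xi> j \<omega> y)" for j x y
    by (rule integrable_bounded_mult[OF meas meas bdd bdd])
  have swap: "(\<Sum>x\<in>I. t x * (1 / sqrt (real n) * (\<Sum>j<n. \<xi> j \<omega> x))) = 1 / sqrt (real n) * (\<Sum>j<n. ?X j \<omega>)" for n \<omega>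
    unfolding sum_distrib_left by (subst sum.swap) (simp add: mult_ac)
  show ?thesis
    unfolding swap
  proof (rule clt_bounded_cos[OF indep])
    show "\<bar>?X j \<omega>\<bar> \<le> (\<Sum>x\<in>I. \<bar>t x\<bar> * C)" if "\<omega> \<in> space M" for j \<omega>
      by (rule order_trans[OF sum_abs], rule sum_mono) (auto simp: abs_mult intro: mult_left_mono bdd[OF that])
    show "expectation (?X j) = 0" for j
      by (subst Bochner_Integration.integral_sum) (auto simp: int mean)
    have "expectation (\<lambda>\<omega>. (?X j \<omega>)\<^sup>2) = (\<Sum>x\<in>I. \<Sum>y\<in>I. t x * t y * expectation (\<lambda>\<omega>. \<xi> j \<omega> x * \<xi> j \<omega> y))" for j
    proof -
      have "(?X j \<omega>)\<^sup>2 = (\<Sum>x\<in>I. \<Sum>y\<in>I. t x * t y * (\<xi> j \<omega> x * \<xi> j \<omega> y))" for \<omega>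
        by (simp add: power2_eq_square sum_product mult_ac)
      then show ?thesis
        by (simp add: Bochner_Integration.integral_sum Bochner_Integration.integrable_sum int2)
    qed
    moreover have "(\<Sum>j<n. \<Sum>x\<in>I. \<Sum>y\<in>I. t x * t y * expectation (\<lambda>\<omega>. \<xi> j \<omega> x * \<xi> j \<omega> y)) / real n
        = (\<Sum>x\<in>I. \<Sum>y\<in>I. t x * t y * ((\<Sum>j<n. expectation (\<lambda>\<omega>. \<xi> j \<omega> x * \<xi> j \<omega> y)) / real n))" for n
    proof -
      have "(\<Sum>j<n. \<Sum>x\<in>I. \<Sum>y\<in>I. t x * t y * expectation (\<lambda>\<omega>. \<xi> j \<omega> x * \<xi> j \<omega> y))
          = (\<Sum>x\<in>I. \<Sum>y\<in>I. \<Sum>j<n. t x * t y * expectation (\<lambda>\<omega>. \<xi> j \<omega> x * \<xi> j \<omega> y))"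
        by (subst sum.swap, rule sum.cong[OF refl], rule sum.swap)
      then show ?thesis
        by (simp add: sum_distrib_left sum_divide_distrib)
    qed
    ultimately show "(\<lambda>n. (\<Sum>j<n. expectation (\<lambda>\<omega>. (?X j \<omega>)\<^sup>2)) / real n) \<longlonglongrightarrow> (\<Sum>x\<in>I. \<Sum>y\<in>I. t x * t y * K x y)"
      by (simp only:) (intro tendsto_intros cov)
  qed
qed

context covariance_kernel
begin

text \<open>Replacing the argument \<open>x\<close> by the simple function \<open>F m x\<close> reduces the theorem to finitely
  many points; \<open>disc\<close> controls the error uniformly in \<open>n\<close>.\<close>

theorem field_clt:
  fixes P :: "'p measure" and \<Phi> :: "nat \<Rightarrow> 'p \<Rightarrow> real" and Z :: "nat \<Rightarrow> real \<Rightarrow> 'x \<Rightarrow> real"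
  assumes "prob_space P"
    and indep: "prob_space.indep_vars P (\<lambda>_. borel) \<Phi> UNIV"
    and Z_meas: "\<And>j. (\<lambda>(\<phi>, x). Z j \<phi> x) \<in> borel_measurable (borel \<Otimes>\<^sub>M \<mu>)"
    and Z_cont: "\<And>j x. continuous_on UNIV (\<lambda>\<phi>. Z j \<phi> x)"
    and Z_bdd: "\<And>j \<phi> x. \<bar>Z j \<phi> x\<bar> \<le> C"
    and mean: "\<And>j x. (\<integral>\<omega>. Z j (\<Phi> j \<omega>) x \<partial>P) = 0"
    and \<kappa>: "\<And>j x y. (\<integral>\<omega>. Z j (\<Phi> j \<omega>) x * Z j (\<Phi> j \<omega>) y \<partial>P) = \<kappa> j x y"
    and F: "\<And>m. simple_function \<mu> (F m)" "\<And>x. x \<in> space \<mu> \<Longrightarrow> (\<lambda>m. F m x) \<longlonglongrightarrow> x"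
    and cov: "\<And>m x y. x \<in> F m ` space \<mu> \<Longrightarrow> y \<in> F m ` space \<mu> \<Longrightarrow> (\<lambda>n. (\<Sum>j<n. \<kappa> j x y) / real n) \<longlonglongrightarrow> K x y"
    and disc: "\<And>m. (\<lambda>n. (\<Sum>j<n. \<integral>x. kdist (\<kappa> j) x (F m x) \<partial>\<mu>) / real n) \<longlonglongrightarrow> (\<integral>x. kdist K x (F m x) \<partial>\<mu>)"
  shows "conv_in_distr (L2_topology \<mu>)
    P (\<lambda>n \<omega>. L2_class \<mu> (\<lambda>x. 1 / sqrt (real n) * (\<Sum>j<n. Z j (\<Phi> j \<omega>) x)))
    gauss_seq (\<lambda>\<omega>. L2_class \<mu> (v \<omega>))"
proof -
  interpret P: prob_space P by fact
  interpret G: prob_space gauss_seq by (rule prob_space_gauss_seq)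
  interpret L2: Metric_space "L2_space \<mu>" "L2_dist \<mu>" by (rule Metric_space_L2)
  have \<Phi>_meas [measurable]: "\<Phi> j \<in> borel_measurable P" for j
    using indep by (auto simp: P.indep_vars_def)
  have C0: "C \<ge> 0" using Z_bdd[of 0 0 undefined] by linarith
  have Z_meas1 [measurable]: "(\<lambda>\<phi>. Z j \<phi> x) \<in> borel_measurable borel" for j x
    by (rule borel_measurable_continuous_onI[OF Z_cont])
  have Z_meas2 [measurable]: "Z j \<phi> \<in> borel_measurable \<mu>" for j \<phi>
    using measurable_compose[OF measurable_Pair1' Z_meas[of j], of \<phi>] by simp
  have \<xi>_meas: "(\<lambda>p. Z j (\<Phi> j (fst p)) (snd p)) \<in> borel_measurable (P \<Otimes>\<^sub>M \<mu>)" for j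
    using measurable_compose[of "\<lambda>p. (\<Phi> j (fst p), snd p)" "P \<Otimes>\<^sub>M \<mu>" "borel \<Otimes>\<^sub>M \<mu>", OF _ Z_meas[of j]] by simp
  define X where "X n \<omega> x = 1 / sqrt (real n) * (\<Sum>j<n. Z j (\<Phi> j \<omega>) x)" for n \<omega> x
  have sum_bdd: "\<bar>1 / sqrt (real n) * (\<Sum>j<n. Z j (\<phi> j) x)\<bar> \<le> 1 / sqrt (real n) * (real n * C)" for n x and \<phi> :: "nat \<Rightarrow> real"
  proof -
    have "\<bar>\<Sum>j<n. Z j (\<phi> j) x\<bar> \<le> (\<Sum>j<n. C)"
      by (rule order_trans[OF sum_abs], rule sum_mono) (rule Z_bdd)
    then show ?thesis by (simp add: abs_mult divide_right_mono)
  qed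
  have X_meas: "(\<lambda>(\<omega>, x). X n \<omega> x) \<in> borel_measurable (P \<Otimes>\<^sub>M \<mu>)" for n
    unfolding X_def case_prod_beta using \<xi>_meas by simp
  have X_meas1 [measurable]: "(\<lambda>\<omega>. X n \<omega> x) \<in> borel_measurable P" for n x
    unfolding X_def by measurable
  have X_L2: "X n \<omega> \<in> L2_fun \<mu>" for n \<omega>
  proof (rule L2_fun_bounded)
    show "X n \<omega> \<in> borel_measurable \<mu>"
      unfolding X_def[abs_def] by measurable
    show "\<bar>X n \<omega> x\<bar> \<le> 1 / sqrt (real n) * (real n * C)" for x
      unfolding X_def by (rule sum_bdd)
  qed
  \<comment> \<open>The class depends continuously on the sequence of angles, since the summands are
    bounded and continuous in them; measurability is inherited from the sequence of angles.\<close>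
  have X_class: "(\<lambda>\<omega>. L2_class \<mu> (X n \<omega>)) \<in> P \<rightarrow>\<^sub>M borel_of_topology (L2_topology \<mu>)" for n
  proof -
    have "(\<lambda>\<phi>::nat \<Rightarrow> real. L2_class \<mu> (\<lambda>x. 1 / sqrt (real n) * (\<Sum>j<n. Z j (\<phi> j) x))) \<in> borel \<rightarrow>\<^sub>M borel_of_topology (L2_topology \<mu>)"
    proof (rule L2_class_continuous_measurable[where b="\<lambda>_. 1 / sqrt (real n) * (real n * C)"])
      show "continuous_on UNIV (\<lambda>\<phi>::nat \<Rightarrow> real. 1 / sqrt (real n) * (\<Sum>j<n. Z j (\<phi> j) x))" for x
        by (intro continuous_intros continuous_on_compose2[OF Z_cont]) auto
    qed (use sum_bdd finite_measure_axioms in auto)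
    moreover have "(\<lambda>\<omega> j. \<Phi> j \<omega>) \<in> P \<rightarrow>\<^sub>M borel"
    proof -
      have "(\<lambda>\<omega> j. \<Phi> j \<omega>) \<in> P \<rightarrow>\<^sub>M PiM UNIV (\<lambda>_. borel)"
        by (rule measurable_PiM_single') auto
      then show ?thesis
        by (simp cong: measurable_cong_sets add: sets_PiM_equal_borel)
    qed
    ultimately show ?thesis
      unfolding X_def[abs_def] by (rule measurable_compose[rotated])
  qed
  have F_fin: "finite (F m ` space \<mu>)" for m
    using F(1)[of m] by (simp add: simple_function_def)
  have \<xi>_int: "integrable P (\<lambda>\<omega>. (Z j (\<Phi> j \<omega>) x)\<^sup>2)" "integrable P (\<lambda>\<omega>. Z j (\<Phi> j \<omega>) x * Z j (\<Phi> j \<omega>) y)" for j x y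
    unfolding power2_eq_square
    by (rule P.integrable_bounded_mult[where D=C and B=C]; use Z_bdd in auto)+
  have \<xi>_diff_sq: "integrable P (\<lambda>\<omega>. (Z j (\<Phi> j \<omega>) x - Z j (\<Phi> j \<omega>) y)\<^sup>2)"
    "(\<integral>\<omega>. (Z j (\<Phi> j \<omega>) x - Z j (\<Phi> j \<omega>) y)\<^sup>2 \<partial>P) = kdist (\<kappa> j) x y" for j x y
  proof -
    have sq: "(a - b)\<^sup>2 = a * a - 2 * (a * b) + b * b" for a b :: real
      by (simp add: power2_eq_square algebra_simps)
    show "integrable P (\<lambda>\<omega>. (Z j (\<Phi> j \<omega>) x - Z j (\<Phi> j \<omega>) y)\<^sup>2)"
      "(\<integral>\<omega>. (Z j (\<Phi> j \<omega>) x - Z j (\<Phi> j \<omega>) y)\<^sup>2 \<partial>P) = kdist (\<kappa> j) x y"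
      unfolding sq kdist_def using \<xi>_int(2) by (simp_all add: \<kappa>)
  qed
  have X_sq: "integrable P (\<lambda>\<omega>. (X n \<omega> x)\<^sup>2)" "(\<integral>\<omega>. (X n \<omega> x)\<^sup>2 \<partial>P) \<le> C\<^sup>2"
    and X_diff_sq: "integrable P (\<lambda>\<omega>. (X n \<omega> x - X n \<omega> y)\<^sup>2)"
      "(\<integral>\<omega>. (X n \<omega> x - X n \<omega> y)\<^sup>2 \<partial>P) = (\<Sum>j<n. kdist (\<kappa> j) x y) / real n" for n x y
  proof -
    \<comment> \<open>To be used with \<open>g j\<close> the summand at one point and with
      \<open>g j\<close> its increment between two points. The square of the factor
      \<open>1 / sqrt n\<close> turns the sum of second moments into an average.\<close>
    have second: "integrable P (\<lambda>\<omega>. (1 / sqrt (real n) * (\<Sum>j<n. g j (\<Phi> j \<omega>)))\<^sup>2)"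
      "(\<integral>\<omega>. (1 / sqrt (real n) * (\<Sum>j<n. g j (\<Phi> j \<omega>)))\<^sup>2 \<partial>P) = (\<Sum>j<n. \<integral>\<omega>. (g j (\<Phi> j \<omega>))\<^sup>2 \<partial>P) / real n"
      if g [measurable]: "\<And>j. g j \<in> borel_measurable borel" and "\<And>j. integrable P (\<lambda>\<omega>. (g j (\<Phi> j \<omega>))\<^sup>2)"
        and "\<And>j. (\<integral>\<omega>. g j (\<Phi> j \<omega>) \<partial>P) = 0" for g :: "nat \<Rightarrow> real \<Rightarrow> real"
    proof -
      have ind: "P.indep_vars (\<lambda>_. borel) (\<lambda>j \<omega>. g j (\<Phi> j \<omega>)) UNIV"
        by (rule P.indep_vars_compose2[OF indep]) auto
      note S = P.indep_sum_second_moment[OF ind finite_lessThan subset_UNIV, of n]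
      show "integrable P (\<lambda>\<omega>. (1 / sqrt (real n) * (\<Sum>j<n. g j (\<Phi> j \<omega>)))\<^sup>2)"
        unfolding power_mult_distrib by (intro integrable_mult_right S that)
      show "(\<integral>\<omega>. (1 / sqrt (real n) * (\<Sum>j<n. g j (\<Phi> j \<omega>)))\<^sup>2 \<partial>P) = (\<Sum>j<n. \<integral>\<omega>. (g j (\<Phi> j \<omega>))\<^sup>2 \<partial>P) / real n"
        unfolding power_mult_distrib using S(2)[OF that(2,3)] by (simp add: power_divide)
    qed
    note A = second[of "\<lambda>j \<phi>. Z j \<phi> x", OF _ \<xi>_int(1) mean]
    show "integrable P (\<lambda>\<omega>. (X n \<omega> x)\<^sup>2)"
      using A(1) by (simp add: X_def)
    have "(\<integral>\<omega>. (Z j (\<Phi> j \<omega>) x)\<^sup>2 \<partial>P) \<le> (\<integral>\<omega>. C\<^sup>2 \<partial>P)" for j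
      using \<xi>_int(1) power_mono[OF Z_bdd abs_ge_zero, where n=2] by (intro integral_mono) auto
    then have "(\<Sum>j<n. \<integral>\<omega>. (Z j (\<Phi> j \<omega>) x)\<^sup>2 \<partial>P) \<le> (\<Sum>j<n. C\<^sup>2)"
      by (intro sum_mono) (simp add: P.prob_space)
    then have "(\<Sum>j<n. \<integral>\<omega>. (Z j (\<Phi> j \<omega>) x)\<^sup>2 \<partial>P) / real n \<le> (\<Sum>j<n. C\<^sup>2) / real n"
      by (rule divide_right_mono) simp
    also have "\<dots> \<le> C\<^sup>2" by simp
    finally show "(\<integral>\<omega>. (X n \<omega> x)\<^sup>2 \<partial>P) \<le> C\<^sup>2"
      using A(2) by (simp add: X_def)
    have eq: "X n \<omega> x - X n \<omega> y = 1 / sqrt (real n) * (\<Sum>j<n. Z j (\<Phi> j \<omega>) x - Z j (\<Phi> j \<omega>) y)" for \<omega>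
      by (simp add: X_def sum_subtractf diff_divide_distrib)
    have int: "integrable P (\<lambda>\<omega>. Z j (\<Phi> j \<omega>) x)" for j x
      using Z_bdd by (intro P.integrable_const_bound[where B=C]) auto
    have D_mean: "(\<integral>\<omega>. Z j (\<Phi> j \<omega>) x - Z j (\<Phi> j \<omega>) y \<partial>P) = 0" for j
      using int mean by simp
    note B = second[of "\<lambda>j \<phi>. Z j \<phi> x - Z j \<phi> y", OF _ \<xi>_diff_sq(1) D_mean]
    show "integrable P (\<lambda>\<omega>. (X n \<omega> x - X n \<omega> y)\<^sup>2)"
      "(\<integral>\<omega>. (X n \<omega> x - X n \<omega> y)\<^sup>2 \<partial>P) = (\<Sum>j<n. kdist (\<kappa> j) x y) / real n"
      unfolding eq using B \<xi>_diff_sq(2) by simp_all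
  qed
  have \<kappa>_bdd: "\<bar>\<kappa> j x y\<bar> \<le> C * C" for j x y
    unfolding \<kappa>[symmetric]
  proof (rule order_trans[OF integral_abs_bound])
    have "\<bar>Z j \<phi> x * Z j \<phi> y\<bar> \<le> C * C" for \<phi>
      unfolding abs_mult by (intro mult_mono Z_bdd) (use C0 in auto)
    then have "(\<integral>\<omega>. \<bar>Z j (\<Phi> j \<omega>) x * Z j (\<Phi> j \<omega>) y\<bar> \<partial>P) \<le> (\<integral>\<omega>. C * C \<partial>P)"
      using \<xi>_int(2) by (intro integral_mono) auto
    then show "(\<integral>\<omega>. \<bar>Z j (\<Phi> j \<omega>) x * Z j (\<Phi> j \<omega>) y\<bar> \<partial>P) \<le> C * C"
      by (simp add: P.prob_space)
  qed
  have \<kappa>_dist_le: "kdist (\<kappa> j) x y \<le> 4 * (C * C)" for j x y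
    using \<kappa>_bdd[of j x x] \<kappa>_bdd[of j x y] \<kappa>_bdd[of j y y] by (simp add: kdist_def abs_le_iff)
  have X_diff_le: "(\<integral>\<omega>. (X n \<omega> x - X n \<omega> y)\<^sup>2 \<partial>P) \<le> 4 * (C * C)" for n x y
  proof -
    have "(\<Sum>j<n. kdist (\<kappa> j) x y) / real n \<le> (\<Sum>j<n. 4 * (C * C)) / real n"
      by (intro divide_right_mono sum_mono \<kappa>_dist_le) auto
    also have "\<dots> \<le> 4 * (C * C)" using C0 by simp
    finally show ?thesis by (simp add: X_diff_sq)
  qed
  have Xm_meas: "(\<lambda>(\<omega>, x). X n \<omega> (F m x)) \<in> borel_measurable (P \<Otimes>\<^sub>M \<mu>)" for n m
    by (rule simple_function_compose_pair_measurable[OF F(1)]) measurable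
  have vm_meas: "(\<lambda>(\<omega>, x). v \<omega> (F m x)) \<in> borel_measurable (gauss_seq \<Otimes>\<^sub>M \<mu>)" for m
    by (rule simple_function_compose_pair_measurable[OF F(1)]) measurable
  have v_diff_le: "(\<integral>\<omega>. (v \<omega> x - v \<omega> y)\<^sup>2 \<partial>gauss_seq) \<le> 4 * B" for x y
    unfolding v_diff_sq(2) by (rule kdist_le)
  note F_L2 = simple_function_compose_L2[OF finite_measure_axioms F(1)]
  \<comment> \<open>Measurability of \<open>\<kappa> j\<close> is not among the assumptions; it is
    recovered here from the joint measurability of \<open>Z j\<close> through the exchange of
    integrals.\<close>
  have \<kappa>_dist_int: "integrable \<mu> (\<lambda>x. kdist (\<kappa> j) x (F m x))" for j m
  proof -
    have W: "(\<lambda>(\<omega>, x). Z j (\<Phi> j \<omega>) x - Z j (\<Phi> j \<omega>) (F m x)) \<in> borel_measurable (P \<Otimes>\<^sub>M \<mu>)"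
      using \<xi>_meas[of j] simple_function_compose_pair_measurable[OF F(1)[of m], of "\<lambda>\<omega>. Z j (\<Phi> j \<omega>)" P]
      by (simp add: case_prod_beta)
    have L2: "(\<lambda>x. Z j (\<Phi> j \<omega>) x - Z j (\<Phi> j \<omega>) (F m x)) \<in> L2_fun \<mu>" for \<omega>
      by (intro L2_fun_diff F_L2 L2_fun_bounded[OF Z_meas2]) (rule Z_bdd)
    show ?thesis
      using expectation_L2_sq(2)[OF finite_measure_axioms assms(1) W L2, of "4 * (C * C)"]
      by (simp add: \<xi>_diff_sq \<kappa>_dist_le)
  qed
  have "conv_in_distr L2.mtopology P (\<lambda>n \<omega>. L2_class \<mu> (X n \<omega>)) gauss_seq (\<lambda>\<omega>. L2_class \<mu> (v \<omega>))"
  proof (rule L2.conv_in_distr_mtopologyI[OF assms(1) prob_space_gauss_seq])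
    show "(\<lambda>\<omega>. L2_class \<mu> (X n \<omega>)) \<in> P \<rightarrow>\<^sub>M borel_of_topology L2.mtopology" for n
      using X_class by (simp add: L2_topology_def)
    show "(\<lambda>\<omega>. L2_class \<mu> (v \<omega>)) \<in> gauss_seq \<rightarrow>\<^sub>M borel_of_topology L2.mtopology"
      using v_class_meas by (simp add: L2_topology_def)
    fix f :: "('x \<Rightarrow> real) set \<Rightarrow> real" and B' L
    assume f_bdd: "\<And>F. F \<in> L2_space \<mu> \<Longrightarrow> \<bar>f F\<bar> \<le> B'"
      and f_lip: "\<And>F G. F \<in> L2_space \<mu> \<Longrightarrow> G \<in> L2_space \<mu> \<Longrightarrow> \<bar>f F - f G\<bar> \<le> L * L2_dist \<mu> F G"
    have f_cont: "continuous_map (L2_topology \<mu>) euclideanreal f"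
      unfolding L2_topology_def by (rule L2.continuous_map_mtopology_lipschitz[OF f_lip])
    note f_meas = measurable_compose[OF _ continuous_map_borel_of_topology[OF f_cont]]
    \<comment> \<open>The functional \<open>f\<close> after discretisation, seen as a function of
      the field values at the points of the range of \<open>F m\<close>.\<close>
    define g where "g m y = f (L2_class \<mu> (\<lambda>x. y (F m x)))" for m and y :: "'x \<Rightarrow> real"
    have g_bdd: "\<bar>g m y\<bar> \<le> B'" for m y
      unfolding g_def by (intro f_bdd L2_class_in_space F_L2)
    have g_lip: "\<bar>g m y - g m y'\<bar> \<le> (\<bar>L\<bar> * sqrt (measure \<mu> (space \<mu>))) * (\<Sum>i\<in>F m ` space \<mu>. \<bar>y i - y' i\<bar>)" for m y y'
    proof -
      have "\<bar>g m y - g m y'\<bar> \<le> L * L2_dist \<mu> (L2_class \<mu> (\<lambda>x. y (F m x))) (L2_class \<mu> (\<lambda>x. y' (F m x)))"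
        unfolding g_def by (intro f_lip L2_class_in_space F_L2)
      also have "\<dots> \<le> \<bar>L\<bar> * L2_dist \<mu> (L2_class \<mu> (\<lambda>x. y (F m x))) (L2_class \<mu> (\<lambda>x. y' (F m x)))"
        by (intro mult_right_mono) auto
      also have "\<dots> \<le> \<bar>L\<bar> * (sqrt (measure \<mu> (space \<mu>)) * (\<Sum>i\<in>F m ` space \<mu>. \<bar>y i - y' i\<bar>))"
        by (intro mult_left_mono L2_dist_class_simple_compose[OF finite_measure_axioms F(1)]) auto
      finally show ?thesis by (simp add: mult.assoc)
    qed
    have gX_meas: "(\<lambda>\<omega>. f (L2_class \<mu> (\<lambda>x. X n \<omega> (F m x)))) \<in> borel_measurable P" for n m
      unfolding g_def[symmetric] by (rule Lipschitz_coord_measurable[OF F_fin _ g_bdd g_lip]) measurable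
    have gv_meas: "(\<lambda>\<omega>. f (L2_class \<mu> (\<lambda>x. v \<omega> (F m x)))) \<in> borel_measurable gauss_seq" for m
      unfolding g_def[symmetric] by (rule Lipschitz_coord_measurable[OF F_fin _ g_bdd g_lip]) measurable
    \<comment> \<open>For fixed \<open>m\<close> the discretised functional converges by the
      finite-dimensional theorem, and \<open>disc\<close> gives the limit in \<open>n\<close> of the
      discretisation error. This limit is the error bound of the Gaussian field itself and vanishes
      as \<open>m\<close> grows.\<close>
    show "(\<lambda>n. \<integral>\<omega>. f (L2_class \<mu> (X n \<omega>)) \<partial>P) \<longlonglongrightarrow> (\<integral>\<omega>. f (L2_class \<mu> (v \<omega>)) \<partial>gauss_seq)"
    proof (rule LIMSEQ_uniform_approx)
      show "(\<lambda>n. \<integral>\<omega>. g m (X n \<omega>) \<partial>P) \<longlonglongrightarrow> (\<integral>\<omega>. g m (v \<omega>) \<partial>gauss_seq)" for m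
      proof (rule finite_dim_cos_conv[OF F_fin assms(1) prob_space_gauss_seq _ _ _ _ _ _ _ g_bdd g_lip])
        \<comment> \<open>One constant has to bound the second moments of the sums and of the limit:
          \<open>C\<^sup>2\<close> serves the former and \<open>B\<close> the latter.\<close>
        show "(\<integral>\<omega>. (X n \<omega> i)\<^sup>2 \<partial>P) \<le> C\<^sup>2 + B" for n i
          using X_sq(2)[of n i] B_nonneg by simp
        show "(\<integral>\<omega>. (v \<omega> i)\<^sup>2 \<partial>gauss_seq) \<le> C\<^sup>2 + B" for i
          using K_le[of i] v_covariance[of i i] by (simp add: power2_eq_square add_increasing)
        show "integrable gauss_seq (\<lambda>\<omega>. (v \<omega> i)\<^sup>2)" for i
          using v_integrable_mult[of i i] by (simp add: power2_eq_square)
        show "(\<lambda>n. \<integral>\<omega>. cos ((\<Sum>i\<in>F m ` space \<mu>. t i * X n \<omega> i) + c) \<partial>P)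
          \<longlonglongrightarrow> (\<integral>\<omega>. cos ((\<Sum>i\<in>F m ` space \<mu>. t i * v \<omega> i) + c) \<partial>gauss_seq)" for t c
          unfolding v_cos[OF F_fin] X_def
        proof (rule P.clt_field_cos[OF F_fin])
          show "P.indep_vars (\<lambda>_. borel) (\<lambda>j \<omega>. \<Sum>x\<in>F m ` space \<mu>. t x * Z j (\<Phi> j \<omega>) x) UNIV" for t
            by (rule P.indep_vars_compose2[OF indep]) auto
        qed (use Z_bdd mean cov in \<open>auto simp: \<kappa>\<close>)
      qed (use X_sq in auto)
      show "\<forall>\<^sub>F n in sequentially. \<bar>(\<integral>\<omega>. f (L2_class \<mu> (X n \<omega>)) \<partial>P) - (\<integral>\<omega>. g m (X n \<omega>) \<partial>P)\<bar>
          \<le> \<bar>L\<bar> * sqrt ((\<Sum>j<n. \<integral>x. kdist (\<kappa> j) x (F m x) \<partial>\<mu>) / real n)" for m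
      proof (intro always_eventually allI)
        fix n
        have "\<bar>(\<integral>\<omega>. f (L2_class \<mu> (X n \<omega>)) \<partial>P) - (\<integral>\<omega>. g m (X n \<omega>) \<partial>P)\<bar>
          \<le> \<bar>L\<bar> * sqrt (\<integral>x. \<integral>\<omega>. (X n \<omega> x - X n \<omega> (F m x))\<^sup>2 \<partial>P \<partial>\<mu>)"
          unfolding g_def
          by (rule L2_Lipschitz_expectation_diff[OF finite_measure_axioms assms(1) f_bdd f_lip
                X_meas Xm_meas X_L2 F_L2 f_meas[OF X_class] gX_meas X_diff_sq(1) X_diff_le])
        also have "(\<integral>x. \<integral>\<omega>. (X n \<omega> x - X n \<omega> (F m x))\<^sup>2 \<partial>P \<partial>\<mu>) = (\<Sum>j<n. \<integral>x. kdist (\<kappa> j) x (F m x) \<partial>\<mu>) / real n"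
          using \<kappa>_dist_int by (simp add: X_diff_sq Bochner_Integration.integral_sum)
        finally show "\<bar>(\<integral>\<omega>. f (L2_class \<mu> (X n \<omega>)) \<partial>P) - (\<integral>\<omega>. g m (X n \<omega>) \<partial>P)\<bar>
          \<le> \<bar>L\<bar> * sqrt ((\<Sum>j<n. \<integral>x. kdist (\<kappa> j) x (F m x) \<partial>\<mu>) / real n)" .
      qed
      show "(\<lambda>n. \<bar>L\<bar> * sqrt ((\<Sum>j<n. \<integral>x. kdist (\<kappa> j) x (F m x) \<partial>\<mu>) / real n))
          \<longlonglongrightarrow> \<bar>L\<bar> * sqrt (\<integral>x. kdist K x (F m x) \<partial>\<mu>)" for m
        by (intro tendsto_intros disc)
      show "\<bar>(\<integral>\<omega>. f (L2_class \<mu> (v \<omega>)) \<partial>gauss_seq) - (\<integral>\<omega>. g m (v \<omega>) \<partial>gauss_seq)\<bar>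
          \<le> \<bar>L\<bar> * sqrt (\<integral>x. kdist K x (F m x) \<partial>\<mu>)" for m
        unfolding g_def v_diff_sq(2)[symmetric]
        by (rule L2_Lipschitz_expectation_diff[OF finite_measure_axioms prob_space_gauss_seq f_bdd f_lip
              v_meas vm_meas v_L2 F_L2 f_meas[OF v_class_meas] gv_meas v_diff_sq(1) v_diff_le])
      have "(\<lambda>m. \<bar>L\<bar> * sqrt (\<integral>x. kdist K x (F m x) \<partial>\<mu>)) \<longlonglongrightarrow> \<bar>L\<bar> * sqrt 0"
        by (intro tendsto_intros kdist_integral_tendsto_0 F)
      then show "(\<lambda>m. \<bar>L\<bar> * sqrt (\<integral>x. kdist K x (F m x) \<partial>\<mu>)) \<longlonglongrightarrow> 0"
        by simp
    qed
  qed
  then show ?thesis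
    by (simp add: L2_topology_def X_def[abs_def])
qed

end

section \<open>Randomly rotated observations\<close>

context prob_space
begin

lemma indep_vars_comp_inj:
  assumes indep: "indep_vars (\<lambda>_. N) X UNIV" and f: "inj f"
  shows "indep_vars (\<lambda>_. N) (\<lambda>j. X (f j)) UNIV"
  unfolding indep_vars_def2 indep_sets_def
proof (intro conjI ballI allI impI)
  let ?F = "\<lambda>i. {X i -` A \<inter> space M |A. A \<in> sets N}"
  have rv: "random_variable N (X i)" for i
    using indep by (simp add: indep_vars_def2)
  then show "random_variable N (X (f j))" for j .
  show "?F (f j) \<subseteq> events" for j
    using measurable_sets[OF rv] by auto
  fix J A assume J: "J \<noteq> {}" "finite J" and A: "A \<in> (\<Pi> j\<in>J. ?F (f j))"
  let ?B = "\<lambda>i. A (inv f i)"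
  have "prob (\<Inter>i\<in>f ` J. ?B i) = (\<Prod>i\<in>f ` J. prob (?B i))"
  proof -
    have B: "?B \<in> Pi (f ` J) ?F"
      using A f by (auto simp: Pi_iff)
    show ?thesis
      by (rule indep[unfolded indep_vars_def2 indep_sets_def, THEN conjunct2, THEN conjunct2, rule_format, OF subset_UNIV _ _ B])
         (use J in auto)
  qed
  then show "prob (\<Inter>j\<in>J. A j) = (\<Prod>j\<in>J. prob (A j))"
    using f by (simp add: prod.reindex inj_on_subset)
qed

text \<open>For bounded variables Hoeffding's inequality makes the probability of a deviation by
  \<open>d\<close> decay geometrically, so the Borel-Cantelli lemma excludes infinitely many such
  deviations; countably many \<open>d\<close> suffice.\<close>

lemma strong_law_bounded:
  fixes X :: "nat \<Rightarrow> 'a \<Rightarrow> real"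
  assumes indep: "indep_vars (\<lambda>_. borel) X UNIV"
    and Y [measurable]: "Y \<in> borel_measurable M" and distr: "\<And>j. distr M borel (X j) = distr M borel Y"
    and bdd: "\<And>\<omega>. \<omega> \<in> space M \<Longrightarrow> \<bar>Y \<omega>\<bar> \<le> C"
  shows "AE \<omega> in M. (\<lambda>n. (\<Sum>j<n. X j \<omega>) / real n) \<longlonglongrightarrow> expectation Y"
proof -
  have [measurable]: "X j \<in> borel_measurable M" for j
    using indep by (auto simp: indep_vars_def)
  \<comment> \<open>The summand \<open>1\<close> keeps the interval from \<open>- b\<close> to
    \<open>b\<close> nondegenerate even if \<open>C\<close> is zero.\<close>
  define b where "b = \<bar>C\<bar> + 1"
  have b: "- b < b" by (simp add: b_def)
  have close: "AE \<omega> in M. \<forall>\<^sub>F n in sequentially. \<bar>(\<Sum>j<n. X j \<omega>) / real n - expectation Y\<bar> < d" if d: "d > 0" for d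
  proof -
    define A where "A n = {\<omega> \<in> space M. \<bar>(\<Sum>j<Suc n. X j \<omega>) - real (Suc n) * expectation Y\<bar> \<ge> real (Suc n) * d}" for n
    define q where "q = exp (- 2 * d\<^sup>2 / (b - - b)\<^sup>2)"
    have q: "0 \<le> q" "q < 1"
      using d b by (auto simp: q_def)
    have prob_A: "prob (A n) \<le> 2 * q ^ Suc n" for n
    proof -
      interpret H: Hoeffding_ineq_iid M "{..<Suc n}" X Y "- b" b "expectation Y"
      proof unfold_locales
        show "indep_vars (\<lambda>_. borel) X {..<Suc n}"
          by (rule indep_vars_subset[OF indep]) auto
        show "AE \<omega> in M. Y \<omega> \<in> {- b..b}"
        proof (rule AE_I2)
          fix \<omega> assume "\<omega> \<in> space M"
          then show "Y \<omega> \<in> {- b..b}"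
            using bdd[of \<omega>] by (auto simp: b_def abs_le_iff)
        qed
      qed (auto simp: distr)
      have "prob {\<omega> \<in> space M. real (Suc n) * d \<le> \<bar>(\<Sum>j<Suc n. X j \<omega>) - real (card {..<Suc n}) * expectation Y\<bar>}
          \<le> 2 * exp (- 2 * (real (Suc n) * d)\<^sup>2 / (real (card {..<Suc n}) * (b - - b)\<^sup>2))"
        by (rule H.Hoeffding_ineq_abs_ge) (use d b in auto)
      then have "prob (A n) \<le> 2 * exp (- 2 * (real (Suc n) * d)\<^sup>2 / (real (card {..<Suc n}) * (b - - b)\<^sup>2))"
        unfolding A_def card_lessThan .
      also have "- 2 * (real (Suc n) * d)\<^sup>2 / (real (card {..<Suc n}) * (b - - b)\<^sup>2) = real (Suc n) * (- 2 * d\<^sup>2 / (b - - b)\<^sup>2)"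
        unfolding card_lessThan power2_eq_square by (simp del: of_nat_Suc)
      finally show ?thesis
        unfolding q_def exp_of_nat_mult[symmetric] .
    qed
    have "AE \<omega> in M. \<forall>\<^sub>F n in sequentially. \<omega> \<in> space M - A n"
    proof (rule borel_cantelli_AE1)
      show "A n \<in> sets M" for n unfolding A_def by measurable
      have "summable (\<lambda>n. 2 * q ^ Suc n)"
        using q by (intro summable_mult summable_Suc_iff[THEN iffD2] summable_geometric) simp
      then show "summable (\<lambda>n. prob (A n))"
        by (rule summable_comparison_test') (use prob_A in auto)
    qed (simp add: less_top[symmetric])
    then show ?thesis
    proof eventually_elim
      case (elim \<omega>)
      have "\<forall>\<^sub>F n in sequentially. \<bar>(\<Sum>j<Suc n. X j \<omega>) / real (Suc n) - expectation Y\<bar> < d"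
        using elim
      proof eventually_elim
        case (elim n)
        then have "\<bar>(\<Sum>j<Suc n. X j \<omega>) - real (Suc n) * expectation Y\<bar> < real (Suc n) * d"
          by (auto simp: A_def not_le)
        moreover have "(\<Sum>j<Suc n. X j \<omega>) - real (Suc n) * expectation Y = real (Suc n) * ((\<Sum>j<Suc n. X j \<omega>) / real (Suc n) - expectation Y)"
          by (simp add: field_simps)
        ultimately show ?case
          by (simp only: abs_mult) simp
      qed
      then show ?case
        by (subst (asm) eventually_sequentially_Suc)
    qed
  qed
  have "AE \<omega> in M. \<forall>k. \<forall>\<^sub>F n in sequentially. \<bar>(\<Sum>j<n. X j \<omega>) / real n - expectation Y\<bar> < 1 / real (Suc k)"
    unfolding AE_all_countable by (intro allI close) simp
  then show ?thesis
  proof eventually_elim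
    case (elim \<omega>)
    show ?case
    proof (rule tendstoI)
      fix e :: real assume "e > 0"
      then obtain k where "1 / real (Suc k) < e" using nat_approx_posE by blast
      with elim[THEN spec, of k] show "\<forall>\<^sub>F n in sequentially. dist ((\<Sum>j<n. X j \<omega>) / real n) (expectation Y) < e"
        by (auto elim!: eventually_mono simp: dist_real_def)
    qed
  qed
qed

end

lemma Fubini_bounded:
  fixes f :: "'a \<Rightarrow> 'b \<Rightarrow> real"
  assumes "finite_measure M1" "finite_measure M2"
    and f: "(\<lambda>(x, y). f x y) \<in> borel_measurable (M1 \<Otimes>\<^sub>M M2)"
    and bdd: "\<And>x y. x \<in> space M1 \<Longrightarrow> y \<in> space M2 \<Longrightarrow> \<bar>f x y\<bar> \<le> C"
  shows "(\<integral>x. \<integral>y. f x y \<partial>M2 \<partial>M1) = (\<integral>y. \<integral>x. f x y \<partial>M1 \<partial>M2)"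
proof -
  interpret M1: finite_measure M1 by fact
  interpret M2: finite_measure M2 by fact
  interpret pair_sigma_finite M1 M2 ..
  interpret P: finite_measure "M1 \<Otimes>\<^sub>M M2"
    by (rule finite_measure_pair_measure) fact+
  have "integrable (M1 \<Otimes>\<^sub>M M2) (case_prod f)"
    by (rule P.integrable_const_bound[where B=C]) (use f bdd in \<open>auto simp: space_pair_measure intro!: AE_I2\<close>)
  from Fubini_integral[OF this] show ?thesis by simp
qed

section \<open>Rotations in real coordinates\<close>

lemma sum_UNIV_sum_type:
  fixes g :: "'a::finite + 'b::finite \<Rightarrow> 'c::comm_monoid_add"
  shows "(\<Sum>j\<in>UNIV. g j) = (\<Sum>k\<in>UNIV. g (Inl k)) + (\<Sum>k\<in>UNIV. g (Inr k))"
proof -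
  have U: "(UNIV :: ('a + 'b) set) = Inl ` UNIV \<union> Inr ` UNIV"
    by (metis UNIV_Plus_UNIV Plus_def)
  show ?thesis
    unfolding U by (subst sum.union_disjoint) (auto simp: sum.reindex)
qed

lemma rotM_nth:
  "(rotM \<theta> *v w) $ Inl k = cos \<theta> * w $ Inl k - sin \<theta> * w $ Inr k"
  "(rotM \<theta> *v w) $ Inr k = sin \<theta> * w $ Inl k + cos \<theta> * w $ Inr k"
  by (simp_all add: rotM_def matrix_vector_mult_def sum_UNIV_sum_type mat_def
      if_distrib[of "\<lambda>x. _ * x"] if_distrib[of "\<lambda>x. x * _"] cong: if_cong)

lemma vec_eq_sum_iff: "x = y \<longleftrightarrow> (\<forall>k. x $ Inl k = y $ Inl k) \<and> (\<forall>k. x $ Inr k = y $ Inr k)"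
  unfolding vec_eq_iff by (metis sum.exhaust)

lemma rotM_rotM: "rotM \<alpha> *v (rotM \<beta> *v w) = rotM (\<alpha> + \<beta>) *v w"
  by (simp add: vec_eq_sum_iff rotM_nth cos_add sin_add algebra_simps)

lemma rotM_2pi: "rotM (\<theta> + 2 * pi * of_int k) *v w = rotM \<theta> *v w"
proof -
  have "cos (\<theta> + 2 * pi * of_int k) = cos \<theta>" "sin (\<theta> + 2 * pi * of_int k) = sin \<theta>"
    by (simp_all add: cos_add sin_add cos_int_2pin sin_int_2pin)
  then show ?thesis by (simp add: vec_eq_sum_iff rotM_nth)
qed

text \<open>The quarter turn \<open>rotM (pi/2)\<close> is multiplication by the imaginary unit.
  This form makes joint continuity in the angle and the vector evident.\<close>

lemma rotM_eq: "rotM \<theta> *v w = cos \<theta> *\<^sub>R w + sin \<theta> *\<^sub>R (rotM (pi/2) *v w)"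
  by (simp add: vec_eq_sum_iff rotM_nth)

lemma continuous_on_rotM [continuous_intros]:
  assumes "continuous_on A f" "continuous_on A g"
  shows "continuous_on A (\<lambda>x. rotM (f x) *v g x)"
proof -
  have "continuous_on A (\<lambda>x. rotM (pi/2) *v g x)"
    by (rule continuous_on_compose2[OF matrix_vector_mult_linear_continuous_on assms(2) subset_UNIV])
  moreover have "continuous_on A (\<lambda>x. cos (f x))" "continuous_on A (\<lambda>x. sin (f x))"
    by (rule continuous_on_compose2[OF continuous_on_cos[OF continuous_on_id] assms(1) subset_UNIV],
        rule continuous_on_compose2[OF continuous_on_sin[OF continuous_on_id] assms(1) subset_UNIV])
  ultimately have "continuous_on A (\<lambda>x. cos (f x) *\<^sub>R g x + sin (f x) *\<^sub>R (rotM (pi/2) *v g x))"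
    by (intro continuous_on_add continuous_on_scaleR assms)
  then show ?thesis
    by (simp add: rotM_eq[of "f _"])
qed

lemma CSp_abs_le: "\<bar>CSp x\<bar> \<le> 2"
  using abs_cos_le_one[of x] abs_sin_le_one[of x] unfolding CSp_def by linarith

lemma ell_abs_le: "\<bar>ell w s \<theta>\<bar> \<le> 4"
  using CSp_abs_le[of "s \<bullet> w"] CSp_abs_le[of "s \<bullet> (rotM \<theta> *v w)"] unfolding ell_def by linarith

lemma continuous_on_ell [continuous_intros]:
  fixes w :: "'x::t2_space \<Rightarrow> real ^ ('d::finite + 'd)"
  assumes "continuous_on A w" "continuous_on A s" "continuous_on A \<theta>"
  shows "continuous_on A (\<lambda>x. ell (w x) (s x) (\<theta> x))"
  unfolding ell_def CSp_def by (intro continuous_intros assms)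

lemma RI_continuous: "continuous_on UNIV (RI :: complex ^ 'd::finite \<Rightarrow> _)"
  unfolding RI_def[abs_def]
proof (rule continuous_on_vec_lambda)
  show "continuous_on UNIV (\<lambda>z::complex ^ 'd. case i of Inl k \<Rightarrow> Re (z $ k) | Inr k \<Rightarrow> Im (z $ k))" for i :: "'d + 'd"
    by (cases i) (auto intro!: continuous_intros)
qed

section \<open>The uniform angle\<close>

abbreviation (input) unif_Theta :: "real measure" where
  "unif_Theta \<equiv> uniform_measure lborel Theta"

lemma Theta_borel [measurable]: "Theta \<in> sets borel"
  by (simp add: Theta_def)

lemma emeasure_Theta: "emeasure lborel Theta = ennreal (2 * pi)"
  by (simp add: Theta_def)

lemma prob_space_unif_Theta: "prob_space unif_Theta"
  by (rule prob_space_uniform_measure) (simp_all add: emeasure_Theta)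

lemma integral_unif_Theta:
  fixes f :: "real \<Rightarrow> real"
  assumes [measurable]: "f \<in> borel_measurable borel"
  shows "(\<integral>x. f x \<partial>unif_Theta) = (\<integral>x. indicator Theta x * f x \<partial>lborel) / (2 * pi)"
proof -
  have "unif_Theta = density lborel (\<lambda>x. ennreal (indicator Theta x / (2 * pi)))"
    unfolding uniform_measure_def emeasure_Theta
    by (intro density_cong) (auto simp: indicator_def divide_ennreal ennreal_1[symmetric] simp del: ennreal_1)
  then show ?thesis
    by (simp add: integral_density)
qed

text \<open>Full periods of the shift are removed first, leaving \<open>t\<close> between
  \<open>0\<close> and \<open>2 * pi\<close>. The part of the shifted interval that sticks out
  beyond \<open>pi\<close> is then moved back by one period and fills the gap left at
  \<open>- pi\<close>.\<close>

lemma integral_unif_Theta_shift: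
  fixes h :: "real \<Rightarrow> real"
  assumes [measurable]: "h \<in> borel_measurable borel" and bdd: "\<And>x. \<bar>h x\<bar> \<le> C"
    and periodic: "\<And>x k. h (x + 2 * pi * of_int k) = h x"
  shows "(\<integral>x. h (x + \<theta>) \<partial>unif_Theta) = (\<integral>x. h x \<partial>unif_Theta)"
proof -
  define k where "k = \<lfloor>\<theta> / (2 * pi)\<rfloor>"
  define t where "t = \<theta> - 2 * pi * of_int k"
  have "of_int k \<le> \<theta> / (2 * pi)" "\<theta> / (2 * pi) < of_int k + 1"
    by (auto simp: k_def)
  then have t: "0 \<le> t" "t \<le> 2 * pi"
    by (auto simp: t_def field_simps)
  have int: "integrable lborel (\<lambda>x. indicator {a..<b} x * h x)" for a b :: real
  proof (rule Bochner_Integration.integrable_bound)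
    show "integrable lborel (\<lambda>x. C * indicator {a..<b} x)"
      by (cases "a \<le> b") (auto intro!: integrable_real_indicator)
    show "AE x in lborel. norm (indicator {a..<b} x * h x) \<le> norm (C * indicator {a..<b} x)"
      using bdd by (auto intro!: AE_I2 order_trans[OF _ abs_ge_self] simp: indicator_def)
  qed auto
  have "(\<integral>x. indicator Theta x * h (x + \<theta>) \<partial>lborel) = (\<integral>x. indicator {-pi..<pi} x * h (t + x) \<partial>lborel)"
    using periodic[of "t + x" k for x] by (intro Bochner_Integration.integral_cong) (auto simp: Theta_def t_def algebra_simps)
  also have "\<dots> = (\<integral>x. indicator {-pi + t..<pi + t} (t + 1 * x) * h (t + 1 * x) \<partial>lborel)"
    by (intro Bochner_Integration.integral_cong) (auto simp: indicator_def)
  also have "\<dots> = (\<integral>x. indicator {-pi + t..<pi + t} x * h x \<partial>lborel)"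
    using lborel_integral_real_affine[of 1 "\<lambda>x. indicator {-pi + t..<pi + t} x * h x" t] by simp
  \<comment> \<open>The decomposition into three indicators holds for every \<open>t\<close> up to
    \<open>2 * pi\<close>, also when the two intervals are disjoint.\<close>
  also have "\<dots> = (\<integral>x. indicator {-pi..<pi} x * h x + indicator {pi..<pi + t} x * h x - indicator {-pi..<-pi + t} x * h x \<partial>lborel)"
    using t by (intro Bochner_Integration.integral_cong) (auto simp: indicator_def)
  also have "\<dots> = (\<integral>x. indicator {-pi..<pi} x * h x \<partial>lborel) + (\<integral>x. indicator {pi..<pi + t} x * h x \<partial>lborel)
      - (\<integral>x. indicator {-pi..<-pi + t} x * h x \<partial>lborel)"
    using int by simp
  also have "(\<integral>x. indicator {pi..<pi + t} x * h x \<partial>lborel) = (\<integral>x. indicator {pi..<pi + t} (2 * pi + 1 * x) * h (2 * pi + 1 * x) \<partial>lborel)"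
    using lborel_integral_real_affine[of 1 "\<lambda>x. indicator {pi..<pi + t} x * h x" "2 * pi"] by simp
  also have "\<dots> = (\<integral>x. indicator {-pi..<-pi + t} x * h x \<partial>lborel)"
    using periodic[of _ 1] by (intro Bochner_Integration.integral_cong) (auto simp: indicator_def algebra_simps)
  finally have "(\<integral>x. indicator Theta x * h (x + \<theta>) \<partial>lborel) = (\<integral>x. indicator Theta x * h x \<partial>lborel)"
    by (simp add: Theta_def)
  then show ?thesis
    by (simp add: integral_unif_Theta)
qed

text \<open>Composition of rotations adds angles, so the two terms of \<open>ell\<close> are
  \<open>h \<phi>\<close> and \<open>h (\<phi> + \<theta>)\<close> for one periodic function
  \<open>h\<close>, and shift invariance of the uniform angle gives them the same mean. This centres
  the summands for each fixed observation.\<close>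

lemma integral_ell_rotM: "(\<integral>\<phi>. ell (rotM \<phi> *v w) s \<theta> \<partial>unif_Theta) = 0"
proof -
  interpret prob_space unif_Theta by (rule prob_space_unif_Theta)
  define h where "h \<phi> = CSp (s \<bullet> (rotM \<phi> *v w))" for \<phi>
  have "continuous_on UNIV h"
    unfolding h_def CSp_def by (intro continuous_intros)
  then have h_meas [measurable]: "h \<in> borel_measurable borel"
    by (rule borel_measurable_continuous_onI)
  have bdd: "\<bar>h x\<bar> \<le> 2" for x
    unfolding h_def by (rule CSp_abs_le)
  have int: "integrable unif_Theta (\<lambda>x. h (x + a))" for a
    by (rule integrable_const_bound[where B=2]) (auto simp: bdd)
  have "ell (rotM \<phi> *v w) s \<theta> = h (\<phi> + 0) - h (\<phi> + \<theta>)" for \<phi>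
    by (simp add: ell_def h_def rotM_rotM add.commute)
  then have "(\<integral>\<phi>. ell (rotM \<phi> *v w) s \<theta> \<partial>unif_Theta) = (\<integral>\<phi>. h (\<phi> + 0) \<partial>unif_Theta) - (\<integral>\<phi>. h (\<phi> + \<theta>) \<partial>unif_Theta)"
    by (simp only:) (rule Bochner_Integration.integral_diff[OF int int])
  also have "(\<integral>\<phi>. h (\<phi> + \<theta>) \<partial>unif_Theta) = (\<integral>\<phi>. h \<phi> \<partial>unif_Theta)"
    by (rule integral_unif_Theta_shift[OF h_meas bdd]) (simp add: h_def rotM_2pi)
  finally show ?thesis by simp
qed

section \<open>The weighted measure on points and angles\<close>

lemma finite_measure_weighted_measure:
  fixes wt :: "real \<Rightarrow> real"
  assumes pos: "\<And>r. r \<ge> 0 \<Longrightarrow> wt r > 0"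
    and int: "integrable lborel (\<lambda>s :: real ^ ('d::finite + 'd). wt (norm s))"
  shows "finite_measure (weighted_measure wt :: ((real ^ ('d + 'd)) \<times> real) measure)"
proof (rule finite_measureI)
  let ?R = "restrict_space lborel Theta :: real measure"
  have R: "emeasure ?R (space ?R) = ennreal (2 * pi)"
    by (simp add: emeasure_restrict_space space_restrict_space emeasure_Theta)
  interpret R: finite_measure ?R
    by (rule finite_measureI) (simp only: R, simp)
  have [measurable]: "(\<lambda>s :: real ^ ('d + 'd). wt (norm s)) \<in> borel_measurable borel"
    using borel_measurable_integrable[OF int] by simp
  have "emeasure (weighted_measure wt) (space (weighted_measure wt :: ((real ^ ('d + 'd)) \<times> real) measure))
      = (\<integral>\<^sup>+p. ennreal (wt (norm (fst p :: real ^ ('d + 'd)))) \<partial>(lborel \<Otimes>\<^sub>M ?R))"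
    unfolding weighted_measure_def space_density
    by (subst emeasure_density[OF _ sets.top]) (auto simp: case_prod_beta intro!: nn_integral_cong)
  also have "\<dots> = (\<integral>\<^sup>+s. \<integral>\<^sup>+\<theta>. ennreal (wt (norm (s :: real ^ ('d + 'd)))) \<partial>?R \<partial>lborel)"
    by (subst R.nn_integral_fst[symmetric]) auto
  also have "\<dots> = (\<integral>\<^sup>+s. ennreal (wt (norm (s :: real ^ ('d + 'd)))) * ennreal (2 * pi) \<partial>lborel)"
    by (simp only: nn_integral_const R)
  also have "\<dots> = (\<integral>\<^sup>+s. ennreal (wt (norm (s :: real ^ ('d + 'd)))) \<partial>lborel) * ennreal (2 * pi)"
    by (rule nn_integral_multc) auto
  also have "(\<integral>\<^sup>+s. ennreal (wt (norm (s :: real ^ ('d + 'd)))) \<partial>lborel) = ennreal (\<integral>s. wt (norm (s :: real ^ ('d + 'd))) \<partial>lborel)"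
    by (rule nn_integral_eq_integral[OF int]) (auto simp: less_imp_le[OF pos])
  finally show "emeasure (weighted_measure wt) (space (weighted_measure wt :: ((real ^ ('d + 'd)) \<times> real) measure)) \<noteq> \<infinity>"
    by (simp add: ennreal_mult_eq_top_iff)
qed

lemma sets_weighted_measure [measurable_cong]:
  "sets (weighted_measure wt :: ((real ^ ('d::finite + 'd)) \<times> real) measure) = sets (lborel \<Otimes>\<^sub>M restrict_space lborel Theta)"
  by (simp add: weighted_measure_def)

lemma ident_weighted_measure:
  "(\<lambda>x. x) \<in> (weighted_measure wt :: ((real ^ ('d::finite + 'd)) \<times> real) measure) \<rightarrow>\<^sub>M borel"
proof -
  have "(\<lambda>x. x) \<in> restrict_space lborel Theta \<rightarrow>\<^sub>M (borel :: real measure)"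
    by (rule measurable_restrict_space1) simp
  then have "(\<lambda>p :: (real ^ ('d + 'd)) \<times> real. (fst p, snd p)) \<in> (lborel \<Otimes>\<^sub>M restrict_space lborel Theta) \<rightarrow>\<^sub>M (borel \<Otimes>\<^sub>M borel)"
    by (intro measurable_Pair measurable_compose[OF measurable_snd]) auto
  then have "(\<lambda>p :: (real ^ ('d + 'd)) \<times> real. p) \<in> (lborel \<Otimes>\<^sub>M restrict_space lborel Theta) \<rightarrow>\<^sub>M borel"
    by (simp add: borel_prod)
  then show ?thesis
    by (simp cong: measurable_cong_sets add: sets_weighted_measure)
qed

section \<open>Covariance kernels of rotated observations\<close>

definition ellp :: "real ^ ('d::finite + 'd) \<Rightarrow> (real ^ ('d + 'd)) \<times> real \<Rightarrow> real" where
  "ellp w x = ell w (fst x) (snd x)"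

lemma ellp_abs_le: "\<bar>ellp w x\<bar> \<le> 4"
  unfolding ellp_def by (rule ell_abs_le)

lemma ellp_mult_abs_le: "\<bar>ellp w x * ellp w' y\<bar> \<le> 16"
proof -
  have "\<bar>ellp w x * ellp w' y\<bar> \<le> 4 * 4"
    unfolding abs_mult by (intro mult_mono ellp_abs_le) auto
  then show ?thesis by simp
qed

lemma continuous_on_ellp [continuous_intros]:
  fixes w :: "'x::t2_space \<Rightarrow> real ^ ('d::finite + 'd)"
  assumes "continuous_on A w" "continuous_on A g"
  shows "continuous_on A (\<lambda>x. ellp (w x) (g x))"
  unfolding ellp_def by (intro continuous_intros assms)

text \<open>The covariance of one summand when the observation \<open>w\<close> is held fixed and
  only the angle is random.\<close>

definition rot_kernel :: "real ^ ('d::finite + 'd) \<Rightarrow> (real ^ ('d + 'd)) \<times> real \<Rightarrow> (real ^ ('d + 'd)) \<times> real \<Rightarrow> real" where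
  "rot_kernel w x y = (\<integral>\<phi>. ellp (rotM \<phi> *v w) x * ellp (rotM \<phi> *v w) y \<partial>unif_Theta)"

lemma rot_kernel_abs_le: "\<bar>rot_kernel w x y\<bar> \<le> 16"
proof -
  interpret prob_space unif_Theta by (rule prob_space_unif_Theta)
  have "continuous_on UNIV (\<lambda>\<phi>. ellp (rotM \<phi> *v w) x * ellp (rotM \<phi> *v w) y)"
    by (intro continuous_intros)
  then have meas [measurable]: "(\<lambda>\<phi>. ellp (rotM \<phi> *v w) x * ellp (rotM \<phi> *v w) y) \<in> borel_measurable borel"
    by (rule borel_measurable_continuous_onI)
  have "integrable unif_Theta (\<lambda>\<phi>. ellp (rotM \<phi> *v w) x * ellp (rotM \<phi> *v w) y)"
    by (rule integrable_const_bound[where B=16]) (auto simp: ellp_mult_abs_le)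
  then have "(\<integral>\<phi>. \<bar>ellp (rotM \<phi> *v w) x * ellp (rotM \<phi> *v w) y\<bar> \<partial>unif_Theta) \<le> (\<integral>\<phi>. 16 \<partial>unif_Theta)"
    by (intro integral_mono) (auto simp: ellp_mult_abs_le)
  then show ?thesis
    unfolding rot_kernel_def using prob_space by (intro order_trans[OF integral_abs_bound]) simp
qed

lemma rot_kernel_measurable:
  "(\<lambda>p. rot_kernel (fst p) (fst (snd p)) (snd (snd p))) \<in> borel_measurable borel"
proof -
  interpret prob_space unif_Theta by (rule prob_space_unif_Theta)
  let ?f = "\<lambda>q. ellp (rotM (snd q) *v fst (fst q)) (fst (snd (fst q))) * ellp (rotM (snd q) *v fst (fst q)) (snd (snd (fst q)))"
  have "continuous_on UNIV ?f"
    by (intro continuous_intros)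
  then have "?f \<in> borel_measurable (borel \<Otimes>\<^sub>M borel)"
    unfolding borel_prod by (rule borel_measurable_continuous_onI)
  then have "(\<lambda>(p, \<phi>). ?f (p, \<phi>)) \<in> borel_measurable (borel \<Otimes>\<^sub>M unif_Theta)"
    by (simp add: case_prod_beta' cong: measurable_cong_sets sets_pair_measure_cong)
  from borel_measurable_lebesgue_integral[OF this] show ?thesis
    by (simp add: rot_kernel_def)
qed

context prob_space
begin

definition ell_kernel :: "('a \<Rightarrow> real ^ ('d::finite + 'd)) \<Rightarrow> (real ^ ('d + 'd)) \<times> real \<Rightarrow> (real ^ ('d + 'd)) \<times> real \<Rightarrow> real" where
  "ell_kernel W x y = expectation (\<lambda>\<omega>. ellp (W \<omega>) x * ellp (W \<omega>) y)"

context
  fixes W :: "'a \<Rightarrow> real ^ ('d::finite + 'd)"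
  assumes W [measurable]: "W \<in> borel_measurable M"
begin

lemma ellp_W_measurable [measurable]: "(\<lambda>\<omega>. ellp (W \<omega>) x) \<in> borel_measurable M"
proof -
  have "continuous_on UNIV (\<lambda>w :: real ^ ('d + 'd). ellp w x)"
    by (intro continuous_intros)
  from measurable_compose[OF W borel_measurable_continuous_onI[OF this]] show ?thesis .
qed

lemma ellp_W_mult_integrable: "integrable M (\<lambda>\<omega>. ellp (W \<omega>) x * ellp (W \<omega>) y)"
  by (rule integrable_const_bound[where B=16]) (auto simp: ellp_mult_abs_le)

lemma pos_kernel_ell_kernel: "pos_kernel (ell_kernel W)"
  unfolding pos_kernel_def
proof (intro conjI allI)
  show "ell_kernel W x y = ell_kernel W y x" for x y
    by (simp add: ell_kernel_def mult.commute)
  fix n :: nat and c :: "nat \<Rightarrow> real" and x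
  have "0 \<le> expectation (\<lambda>\<omega>. (\<Sum>i<n. c i * ellp (W \<omega>) (x i))\<^sup>2)"
    by simp
  also have "\<dots> = expectation (\<lambda>\<omega>. \<Sum>i<n. \<Sum>j<n. c i * c j * (ellp (W \<omega>) (x i) * ellp (W \<omega>) (x j)))"
    by (intro Bochner_Integration.integral_cong) (simp_all add: power2_eq_square sum_product mult_ac)
  also have "\<dots> = (\<Sum>i<n. \<Sum>j<n. c i * c j * ell_kernel W (x i) (x j))"
    by (simp add: ell_kernel_def Bochner_Integration.integral_sum ellp_W_mult_integrable)
  finally show "0 \<le> (\<Sum>i<n. \<Sum>j<n. c i * c j * ell_kernel W (x i) (x j))" .
qed

lemma ell_kernel_le: "ell_kernel W x x \<le> 16"
proof -
  have "ell_kernel W x x \<le> expectation (\<lambda>_. 16)"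
    unfolding ell_kernel_def
    by (intro integral_mono ellp_W_mult_integrable order_trans[OF abs_ge_self ellp_mult_abs_le]) simp
  then show ?thesis by (simp add: prob_space)
qed

lemma continuous_on_ell_kernel: "continuous_on UNIV (\<lambda>(x, y). ell_kernel W x y)"
proof (rule continuous_on_sequentiallyI)
  fix u :: "nat \<Rightarrow> ((real ^ ('d + 'd)) \<times> real) \<times> ((real ^ ('d + 'd)) \<times> real)" and p
  assume u: "u \<longlonglongrightarrow> p"
  have "(\<lambda>n. expectation (\<lambda>\<omega>. ellp (W \<omega>) (fst (u n)) * ellp (W \<omega>) (snd (u n)))) \<longlonglongrightarrow>
      expectation (\<lambda>\<omega>. ellp (W \<omega>) (fst p) * ellp (W \<omega>) (snd p))"
  proof (rule integral_dominated_convergence[where w="\<lambda>_. 16"])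
    show "AE \<omega> in M. (\<lambda>n. ellp (W \<omega>) (fst (u n)) * ellp (W \<omega>) (snd (u n))) \<longlonglongrightarrow> ellp (W \<omega>) (fst p) * ellp (W \<omega>) (snd p)"
    proof (rule AE_I2)
      fix \<omega>
      have "continuous_on UNIV (\<lambda>x. ellp (W \<omega>) x)"
        by (intro continuous_intros)
      then have lim: "(\<lambda>n. ellp (W \<omega>) (x n)) \<longlonglongrightarrow> ellp (W \<omega>) a" if "x \<longlonglongrightarrow> a" for x a
        by (rule continuous_on_tendsto_compose[OF _ that]) auto
      show "(\<lambda>n. ellp (W \<omega>) (fst (u n)) * ellp (W \<omega>) (snd (u n))) \<longlonglongrightarrow> ellp (W \<omega>) (fst p) * ellp (W \<omega>) (snd p)"
        by (intro tendsto_mult lim tendsto_fst tendsto_snd u)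
    qed
  qed (auto simp: ellp_mult_abs_le)
  then show "(\<lambda>n. case u n of (x, y) \<Rightarrow> ell_kernel W x y) \<longlonglongrightarrow> (case p of (x, y) \<Rightarrow> ell_kernel W x y)"
    by (simp add: case_prod_beta ell_kernel_def)
qed

text \<open>The step where circular symmetry enters. After exchanging the integrals the angle is
  fixed, and \<open>W\<close> rotated by a fixed angle has the law of \<open>W\<close>; the inner
  expectation is thus the same for all angles, and averaging over them changes nothing.\<close>

lemma expectation_rot_kernel:
  assumes inv: "\<And>\<phi>. \<phi> \<in> Theta \<Longrightarrow> distr M borel (\<lambda>\<omega>. rotM \<phi> *v W \<omega>) = distr M borel W"
  shows "expectation (\<lambda>\<omega>. rot_kernel (W \<omega>) x y) = ell_kernel W x y"
proof -
  interpret U: prob_space unif_Theta by (rule prob_space_unif_Theta)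
  let ?g = "\<lambda>w :: real ^ ('d + 'd). ellp w x * ellp w y"
  have g_cont: "continuous_on UNIV ?g"
    by (intro continuous_intros)
  have g [measurable]: "?g \<in> borel_measurable borel"
    using g_cont by (rule borel_measurable_continuous_onI)
  have rot [measurable]: "(\<lambda>w. rotM \<phi> *v w) \<in> borel \<rightarrow>\<^sub>M (borel :: (real ^ ('d + 'd)) measure)" for \<phi>
    by (intro borel_measurable_continuous_onI continuous_intros)
  have inner: "expectation (\<lambda>\<omega>. ?g (rotM \<phi> *v W \<omega>)) = ell_kernel W x y" if "\<phi> \<in> Theta" for \<phi>
  proof -
    have "expectation (\<lambda>\<omega>. ?g (rotM \<phi> *v W \<omega>)) = (\<integral>w. ?g w \<partial>distr M borel (\<lambda>\<omega>. rotM \<phi> *v W \<omega>))"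
      by (rule integral_distr[symmetric]) auto
    also have "\<dots> = ell_kernel W x y"
      unfolding inv[OF that] ell_kernel_def by (rule integral_distr) auto
    finally show ?thesis .
  qed
  have joint: "(\<lambda>(\<omega>, \<phi>). ?g (rotM \<phi> *v W \<omega>)) \<in> borel_measurable (M \<Otimes>\<^sub>M unif_Theta)"
  proof -
    have "continuous_on UNIV (\<lambda>p :: (real ^ ('d + 'd)) \<times> real. ?g (rotM (snd p) *v fst p))"
      by (intro continuous_intros)
    then have "(\<lambda>p :: (real ^ ('d + 'd)) \<times> real. ?g (rotM (snd p) *v fst p)) \<in> borel_measurable (borel \<Otimes>\<^sub>M borel)"
      unfolding borel_prod by (rule borel_measurable_continuous_onI)
    moreover have "(\<lambda>p. (W (fst p), snd p)) \<in> M \<Otimes>\<^sub>M unif_Theta \<rightarrow>\<^sub>M borel \<Otimes>\<^sub>M borel"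
      by (intro measurable_Pair measurable_compose[OF measurable_fst W] measurable_compose[OF measurable_snd]) auto
    ultimately have "(\<lambda>p. ?g (rotM (snd (W (fst p), snd p)) *v fst (W (fst p), snd p))) \<in> borel_measurable (M \<Otimes>\<^sub>M unif_Theta)"
      by (rule measurable_compose[rotated])
    then show ?thesis
      by (simp add: case_prod_beta')
  qed
  have "expectation (\<lambda>\<omega>. rot_kernel (W \<omega>) x y) = (\<integral>\<phi>. expectation (\<lambda>\<omega>. ?g (rotM \<phi> *v W \<omega>)) \<partial>unif_Theta)"
    unfolding rot_kernel_def
    by (rule Fubini_bounded[OF finite_measure_axioms U.finite_measure_axioms joint ellp_mult_abs_le])
  also have "\<dots> = (\<integral>\<phi>. ell_kernel W x y \<partial>unif_Theta)"
  proof (rule integral_cong_AE)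
    \<comment> \<open>The invariance is given for angles in \<open>Theta\<close> only, and the
      uniform measure is concentrated there.\<close>
    show "AE \<phi> in unif_Theta. expectation (\<lambda>\<omega>. ?g (rotM \<phi> *v W \<omega>)) = ell_kernel W x y"
      by (rule AE_uniform_measureI) (use inner in auto)
    have "(\<lambda>(\<phi>, \<omega>). ?g (rotM \<phi> *v W \<omega>)) \<in> borel_measurable (unif_Theta \<Otimes>\<^sub>M M)"
      using measurable_pair_swap[OF joint] by (simp add: case_prod_beta)
    then show "(\<lambda>\<phi>. expectation (\<lambda>\<omega>. ?g (rotM \<phi> *v W \<omega>))) \<in> borel_measurable unif_Theta"
      by (rule borel_measurable_lebesgue_integral)
  qed simp
  also have "\<dots> = ell_kernel W x y"
    using U.prob_space by simp
  finally show ?thesis .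
qed

end

end

text \<open>Conditioning on the sample is expressed by two points of the same space:
  \<open>\<omega>\<close> freezes the observations outside the convergence statements,
  \<open>\<omega>'\<close> carries the angles and is the only variable of integration.\<close>

theorem theorem4p4:
  fixes M :: "'a measure"
    and Z :: "'a \<Rightarrow> complex ^ 'd::finite"
    and Zs :: "nat \<Rightarrow> 'a \<Rightarrow> complex ^ 'd"
    and \<Phi> :: "nat \<Rightarrow> 'a \<Rightarrow> real"
    and wt :: "real \<Rightarrow> real"
  assumes M: "prob_space M"
    and Z_indep: "prob_space.indep_vars M (\<lambda>_. borel) (case_nat Z Zs) UNIV"
    and Z_ident: "\<And>j. distr M borel (Zs j) = distr M borel Z"
    and Phi_indep: "prob_space.indep_vars M (\<lambda>_. borel) \<Phi> UNIV"
    and Phi_unif: "\<And>j. distr M lborel (\<Phi> j) = uniform_measure lborel Theta"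
    and Z_Phi_indep: "prob_space.indep_rvs M
          (Pi\<^sub>M UNIV (\<lambda>_. borel)) (\<lambda>\<omega> j. RI (case_nat Z Zs j \<omega>))
          (Pi\<^sub>M UNIV (\<lambda>_. borel)) (\<lambda>\<omega> j. \<Phi> j \<omega>)"
    and wt_pos: "\<And>r. r \<ge> 0 \<Longrightarrow> wt r > 0"
    and wt_meas: "wt \<in> borel_measurable (restrict_space borel {0..})"
    and wt_int: "integrable lborel (\<lambda>s :: real ^ ('d + 'd). wt (norm s))"
    and H0: "\<And>\<theta>. \<theta> \<in> Theta \<Longrightarrow> distr M borel (\<lambda>\<omega>. cis \<theta> *s Z \<omega>) = distr M borel Z"
  shows "\<exists>(N :: (nat \<Rightarrow> real) measure) V.
           prob_space N \<and>
           centred_gaussian_element (weighted_measure wt) N V \<and>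
           has_covariance_kernel (weighted_measure wt) N V
             (\<lambda>(s, \<theta>) (t, \<eta>). \<integral>\<omega>. ell (RI (Z \<omega>)) s \<theta> * ell (RI (Z \<omega>)) t \<eta> \<partial>M) \<and>
           (AE \<omega> in M.
              conv_in_distr (L2_topology (weighted_measure wt))
                M (\<lambda>n \<omega>'. V_star wt n (\<lambda>j. RI (Zs j \<omega>)) (\<lambda>j. \<Phi> j \<omega>'))
                N V \<and>
              weak_conv_m
                (\<lambda>n. distr M borel (\<lambda>\<omega>'. T_star wt n (\<lambda>j. RI (Zs j \<omega>)) (\<lambda>j. \<Phi> j \<omega>')))
                (distr N borel (\<lambda>\<omega>'. (L2_norm (weighted_measure wt) (V \<omega>'))\<^sup>2)))"
proof -
  interpret prob_space M by (rule M)
  interpret U: prob_space unif_Theta by (rule prob_space_unif_Theta)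
  let ?\<mu> = "weighted_measure wt :: ((real ^ ('d + 'd)) \<times> real) measure"
  define W where "W \<omega> = RI (Z \<omega>)" for \<omega>
  define Ws where "Ws j \<omega> = RI (Zs j \<omega>)" for j \<omega>
  define K where "K = ell_kernel W"
  have RI_meas [measurable]: "(RI :: complex ^ 'd \<Rightarrow> _) \<in> borel \<rightarrow>\<^sub>M borel"
    by (rule borel_measurable_continuous_onI[OF RI_continuous])
  have case_meas: "case_nat Z Zs i \<in> borel_measurable M" for i
    using Z_indep by (auto simp: indep_vars_def)
  have Z_meas [measurable]: "Z \<in> borel_measurable M" and Zs_meas [measurable]: "Zs j \<in> borel_measurable M" for j
    using case_meas[of 0] case_meas[of "Suc j"] by simp_all
  have W_meas [measurable]: "W \<in> borel_measurable M"
    unfolding W_def by measurable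
  have \<Phi>_meas [measurable]: "\<Phi> j \<in> borel_measurable M" for j
    using Phi_indep by (auto simp: indep_vars_def)
  have W_inv: "distr M borel (\<lambda>\<omega>. rotM \<phi> *v W \<omega>) = distr M borel W" if "\<phi> \<in> Theta" for \<phi>
  proof -
    have cis_meas: "(\<lambda>z. cis \<phi> *s z) \<in> borel \<rightarrow>\<^sub>M (borel :: (complex ^ 'd) measure)"
      unfolding vector_scalar_mult_def by (intro borel_measurable_continuous_onI continuous_intros)
    have "distr M borel (\<lambda>\<omega>. rotM \<phi> *v W \<omega>) = distr (distr M borel (\<lambda>\<omega>. cis \<phi> *s Z \<omega>)) borel RI"
      using measurable_compose[OF Z_meas cis_meas] by (simp add: distr_distr o_def W_def RI_cis)
    also have "\<dots> = distr M borel W"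
      unfolding H0[OF that] by (simp add: distr_distr o_def W_def[abs_def])
    finally show ?thesis .
  qed
  have slln: "AE \<omega> in M. (\<lambda>n. (\<Sum>j<n. h (Ws j \<omega>)) / real n) \<longlonglongrightarrow> expectation (\<lambda>\<omega>. h (W \<omega>))"
    if [measurable]: "h \<in> borel_measurable borel" and bdd: "\<And>w. \<bar>h w\<bar> \<le> C" for h :: "_ \<Rightarrow> real" and C
  proof (rule strong_law_bounded)
    \<comment> \<open>The shift by \<open>Suc\<close> drops \<open>Z\<close>, which only represents
      the common law, and keeps the sample itself.\<close>
    have "indep_vars (\<lambda>_. borel) (\<lambda>j. case_nat Z Zs (Suc j)) UNIV"
      by (rule indep_vars_comp_inj[OF Z_indep]) simp
    then have "indep_vars (\<lambda>_. borel) Zs UNIV" by simp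
    then show "indep_vars (\<lambda>_. borel) (\<lambda>j \<omega>. h (Ws j \<omega>)) UNIV"
      unfolding Ws_def by (rule indep_vars_compose2) measurable
    show "distr M borel (\<lambda>\<omega>. h (Ws j \<omega>)) = distr M borel (\<lambda>\<omega>. h (W \<omega>))" for j
    proof -
      have "distr M borel (\<lambda>\<omega>. h (Ws j \<omega>)) = distr (distr M borel (Zs j)) borel (\<lambda>z. h (RI z))"
        by (simp add: distr_distr o_def Ws_def)
      also have "\<dots> = distr M borel (\<lambda>\<omega>. h (W \<omega>))"
        unfolding Z_ident by (simp add: distr_distr o_def W_def)
      finally show ?thesis .
    qed
  qed (use bdd in auto)
  interpret \<mu>: finite_measure ?\<mu>
    by (rule finite_measure_weighted_measure[OF wt_pos wt_int])
  have ident: "(\<lambda>x. x) \<in> ?\<mu> \<rightarrow>\<^sub>M borel"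
    by (rule ident_weighted_measure)
  \<comment> \<open>The constant is \<open>4 * 4\<close>: \<open>CSp\<close> is bounded by
    \<open>2\<close>, hence \<open>ell\<close> by \<open>4\<close>.\<close>
  interpret CK: covariance_kernel ?\<mu> K 16
    unfolding K_def
    by unfold_locales
       (rule pos_kernel_ell_kernel[OF W_meas] continuous_on_ell_kernel[OF W_meas] ell_kernel_le[OF W_meas] ident)+
  \<comment> \<open>Chosen before any sample point. Each \<open>F m\<close> has finite range, so all
    requirements on the sample together are countably many.\<close>
  obtain F where F: "\<And>m. simple_function ?\<mu> (F m)" "\<And>x. x \<in> space ?\<mu> \<Longrightarrow> (\<lambda>m. F m x) \<longlonglongrightarrow> x"
    using borel_measurable_implies_sequence_metric[OF ident, of 0] by blast
  have F_fin: "finite (F m ` space ?\<mu>)" for m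
    using F(1)[of m] by (simp add: simple_function_def)
  have F_meas [measurable]: "F m \<in> ?\<mu> \<rightarrow>\<^sub>M borel" for m
    by (rule borel_measurable_simple_function[OF F(1)])
  note ident [measurable]
  have rot_meas: "(\<lambda>p. rot_kernel (f p) (g p) (h p)) \<in> borel_measurable R"
    if "f \<in> borel_measurable R" "g \<in> borel_measurable R" "h \<in> borel_measurable R"
    for R :: "'r measure" and f :: "'r \<Rightarrow> real ^ ('d + 'd)" and g h
    using measurable_compose[of "\<lambda>p. (f p, g p, h p)" R borel, OF _ rot_kernel_measurable] that
    by (simp add: borel_prod[symmetric])
  \<comment> \<open>The integrated squared discretisation error contributed by one observation,
    again a bounded function of it, so that the strong law applies.\<close>
  define H where "H m w = (\<integral>x. kdist (rot_kernel w) x (F m x) \<partial>?\<mu>)" for m w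
  have kdist_meas: "(\<lambda>p. kdist (rot_kernel (f (fst p))) (snd p) (F m (snd p))) \<in> borel_measurable (R \<Otimes>\<^sub>M ?\<mu>)"
    if [measurable]: "f \<in> borel_measurable R" for R :: "'r measure" and f :: "'r \<Rightarrow> real ^ ('d + 'd)" and m
    unfolding kdist_def
    by (intro borel_measurable_add borel_measurable_diff borel_measurable_times rot_meas
        measurable_compose[OF measurable_fst] measurable_compose[OF measurable_snd]) auto
  \<comment> \<open>\<open>64\<close> is \<open>16 + 2 * 16 + 16\<close>, one summand for each term
    of \<open>kdist\<close>.\<close>
  have kdist_bdd: "\<bar>kdist (rot_kernel w) x y\<bar> \<le> 64" for w :: "real ^ ('d + 'd)" and x y
    using rot_kernel_abs_le[of w x x] rot_kernel_abs_le[of w x y] rot_kernel_abs_le[of w y y]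
    by (simp add: kdist_def abs_le_iff)
  have H_meas: "H m \<in> borel_measurable borel" for m
    unfolding H_def[abs_def]
    by (rule \<mu>.borel_measurable_lebesgue_integral) (use kdist_meas[of "\<lambda>w. w" borel m] in \<open>simp add: case_prod_beta\<close>)
  have H_bdd: "\<bar>H m w\<bar> \<le> 64 * measure ?\<mu> (space ?\<mu>)" for m w
  proof -
    have "(\<lambda>x. kdist (rot_kernel w) x (F m x)) \<in> borel_measurable ?\<mu>"
      unfolding kdist_def by (intro borel_measurable_add borel_measurable_diff borel_measurable_times rot_meas) auto
    then have "integrable ?\<mu> (\<lambda>x. kdist (rot_kernel w) x (F m x))"
      by (intro \<mu>.integrable_const_bound[where B=64]) (auto simp: kdist_bdd)
    then have "(\<integral>x. \<bar>kdist (rot_kernel w) x (F m x)\<bar> \<partial>?\<mu>) \<le> (\<integral>x. 64 \<partial>?\<mu>)"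
      by (intro integral_mono) (auto simp: kdist_bdd)
    then show ?thesis
      unfolding H_def by (intro order_trans[OF integral_abs_bound]) (simp add: mult.commute)
  qed
  have rot_int: "integrable M (\<lambda>\<omega>. rot_kernel (W \<omega>) x y)" for x y
    by (rule integrable_const_bound[where B=16]) (auto intro!: rot_meas simp: rot_kernel_abs_le)
  have rot_K: "expectation (\<lambda>\<omega>. rot_kernel (W \<omega>) x y) = K x y" for x y
    unfolding K_def by (rule expectation_rot_kernel[OF W_meas W_inv])
  \<comment> \<open>Exchanging the integrals moves the mean over \<open>W\<close> inside
    \<open>kdist\<close>, which is linear in the kernel, and turns \<open>rot_kernel\<close> into
    \<open>K\<close>.\<close>
  have H_mean: "expectation (\<lambda>\<omega>. H m (W \<omega>)) = (\<integral>x. kdist K x (F m x) \<partial>?\<mu>)" for m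
  proof -
    have "expectation (\<lambda>\<omega>. H m (W \<omega>)) = (\<integral>x. expectation (\<lambda>\<omega>. kdist (rot_kernel (W \<omega>)) x (F m x)) \<partial>?\<mu>)"
      unfolding H_def
      by (rule Fubini_bounded[OF finite_measure_axioms \<mu>.finite_measure_axioms _ kdist_bdd])
         (use kdist_meas[OF W_meas, of m] in \<open>simp add: case_prod_beta\<close>)
    also have "\<dots> = (\<integral>x. kdist K x (F m x) \<partial>?\<mu>)"
      unfolding kdist_def using rot_int by (simp add: rot_K)
    finally show ?thesis .
  qed
  have Phi_int: "(\<integral>\<omega>. f (\<Phi> j \<omega>) \<partial>M) = (\<integral>\<phi>. f \<phi> \<partial>unif_Theta)" if [measurable]: "f \<in> borel_measurable borel" for f :: "real \<Rightarrow> real" and j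
    unfolding Phi_unif[of j, symmetric] by (rule integral_distr[symmetric]) auto
  \<comment> \<open>One null set for all pairs of points from the range of each \<open>F m\<close>;
    the limits of the averages are the means that \<open>rot_K\<close> identifies.\<close>
  have AE_cov: "AE \<omega> in M. \<forall>m. \<forall>x\<in>F m ` space ?\<mu>. \<forall>y\<in>F m ` space ?\<mu>.
      (\<lambda>n. (\<Sum>j<n. rot_kernel (Ws j \<omega>) x y) / real n) \<longlonglongrightarrow> K x y"
    unfolding AE_all_countable
    by (intro allI AE_finite_allI F_fin, unfold rot_K[symmetric])
       (rule slln[OF rot_meas rot_kernel_abs_le], auto)
  have AE_disc: "AE \<omega> in M. \<forall>m. (\<lambda>n. (\<Sum>j<n. H m (Ws j \<omega>)) / real n) \<longlonglongrightarrow> (\<integral>x. kdist K x (F m x) \<partial>?\<mu>)"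
    unfolding AE_all_countable H_mean[symmetric]
    by (intro allI slln[OF H_meas H_bdd])
  let ?V = "\<lambda>\<omega>. L2_class ?\<mu> (CK.v \<omega>)"
  have conv: "AE \<omega> in M. conv_in_distr (L2_topology ?\<mu>)
      M (\<lambda>n \<omega>'. V_star wt n (\<lambda>j. RI (Zs j \<omega>)) (\<lambda>j. \<Phi> j \<omega>')) gauss_seq ?V"
    using AE_cov AE_disc
  proof eventually_elim
    case (elim \<omega>)
    have "conv_in_distr (L2_topology ?\<mu>)
      M (\<lambda>n \<omega>'. L2_class ?\<mu> (\<lambda>x. 1 / sqrt (real n) * (\<Sum>j<n. ellp (rotM (\<Phi> j \<omega>') *v Ws j \<omega>) x))) gauss_seq ?V"
    proof (rule CK.field_clt[where \<kappa>="\<lambda>j. rot_kernel (Ws j \<omega>)" and F=F and C=4, OF M Phi_indep])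
      have cont: "continuous_on UNIV (\<lambda>p. ellp (rotM (fst p) *v Ws j \<omega>) (snd p))" for j
        by (intro continuous_intros)
      have "(\<lambda>p. ellp (rotM (fst p) *v Ws j \<omega>) (snd p)) \<in> borel_measurable (borel \<Otimes>\<^sub>M borel)" for j
        using borel_measurable_continuous_onI[OF cont[of j]] by (simp add: borel_prod)
      moreover have "(\<lambda>p :: real \<times> _. (fst p, snd p)) \<in> borel \<Otimes>\<^sub>M ?\<mu> \<rightarrow>\<^sub>M borel \<Otimes>\<^sub>M borel"
        by (intro measurable_Pair measurable_fst measurable_compose[OF measurable_snd ident])
      ultimately have "(\<lambda>p. ellp (rotM (fst (fst p, snd p)) *v Ws j \<omega>) (snd (fst p, snd p))) \<in> borel_measurable (borel \<Otimes>\<^sub>M ?\<mu>)" for j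
        by (rule measurable_compose[rotated])
      then show "(\<lambda>(\<phi>, x). ellp (rotM \<phi> *v Ws j \<omega>) x) \<in> borel_measurable (borel \<Otimes>\<^sub>M ?\<mu>)" for j
        by (simp add: case_prod_beta')
      show \<phi>_cont: "continuous_on UNIV (\<lambda>\<phi>. ellp (rotM \<phi> *v Ws j \<omega>) x)" for j x
        by (intro continuous_intros)
      note \<phi>_meas = borel_measurable_continuous_onI[OF \<phi>_cont]
      show "\<bar>ellp (rotM \<phi> *v Ws j \<omega>) x\<bar> \<le> 4" for j \<phi> x
        by (rule ellp_abs_le)
      show "(\<integral>\<omega>'. ellp (rotM (\<Phi> j \<omega>') *v Ws j \<omega>) x \<partial>M) = 0" for j x
        by (subst Phi_int[OF \<phi>_meas]) (simp add: ellp_def integral_ell_rotM)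
      show "(\<integral>\<omega>'. ellp (rotM (\<Phi> j \<omega>') *v Ws j \<omega>) x * ellp (rotM (\<Phi> j \<omega>') *v Ws j \<omega>) y \<partial>M) = rot_kernel (Ws j \<omega>) x y" for j x y
        unfolding rot_kernel_def by (rule Phi_int[OF borel_measurable_times[OF \<phi>_meas \<phi>_meas]])
    qed (use F elim in \<open>auto simp: H_def\<close>)
    moreover have "V_star wt n (\<lambda>j. RI (Zs j \<omega>)) (\<lambda>j. \<Phi> j \<omega>') =
        L2_class ?\<mu> (\<lambda>x. 1 / sqrt (real n) * (\<Sum>j<n. ellp (rotM (\<Phi> j \<omega>') *v Ws j \<omega>) x))" for n \<omega>'
      by (simp add: V_star_def ellp_def Ws_def case_prod_beta')
    ultimately show ?case by simp
  qed
  have norm_cont: "continuous_map (L2_topology ?\<mu>) euclideanreal (\<lambda>F. (L2_norm ?\<mu> F)\<^sup>2)"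
    by (intro continuous_map_real_pow continuous_map_L2_norm)
  show ?thesis
  proof (intro exI conjI)
    show "prob_space gauss_seq" by (rule prob_space_gauss_seq)
    show "centred_gaussian_element ?\<mu> gauss_seq ?V"
      unfolding centred_gaussian_element_def using CK.v_class_meas CK.v_inner_normal by blast
    show "has_covariance_kernel ?\<mu> gauss_seq ?V
        (\<lambda>(s, \<theta>) (t, \<eta>). \<integral>\<omega>. ell (RI (Z \<omega>)) s \<theta> * ell (RI (Z \<omega>)) t \<eta> \<partial>M)"
      unfolding has_covariance_kernel_def
    proof (intro exI conjI ballI)
      show "(\<lambda>(\<omega>, x). CK.v \<omega> x) \<in> borel_measurable (gauss_seq \<Otimes>\<^sub>M ?\<mu>)"
        by (rule CK.v_meas)
      show "CK.v \<omega> \<in> ?V \<omega>" for \<omega>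
        using CK.v_L2[of \<omega>] by (simp add: L2_class_def L2_rel_def)
      show "integrable gauss_seq (\<lambda>\<omega>. CK.v \<omega> x * CK.v \<omega> y)" for x y
        by (rule CK.v_integrable_mult)
      show "(\<integral>\<omega>. CK.v \<omega> x * CK.v \<omega> y \<partial>gauss_seq) =
          (case x of (s, \<theta>) \<Rightarrow> \<lambda>(t, \<eta>). \<integral>\<omega>. ell (RI (Z \<omega>)) s \<theta> * ell (RI (Z \<omega>)) t \<eta> \<partial>M) y" for x y
        unfolding CK.v_covariance by (simp add: K_def ell_kernel_def ellp_def W_def case_prod_beta)
    qed
    show "AE \<omega> in M.
        conv_in_distr (L2_topology ?\<mu>)
          M (\<lambda>n \<omega>'. V_star wt n (\<lambda>j. RI (Zs j \<omega>)) (\<lambda>j. \<Phi> j \<omega>')) gauss_seq ?V \<and>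
        weak_conv_m
          (\<lambda>n. distr M borel (\<lambda>\<omega>'. T_star wt n (\<lambda>j. RI (Zs j \<omega>)) (\<lambda>j. \<Phi> j \<omega>')))
          (distr gauss_seq borel (\<lambda>\<omega>'. (L2_norm ?\<mu> (?V \<omega>'))\<^sup>2))"
      using conv
    proof eventually_elim
      case (elim \<omega>)
      with conv_in_distr_continuous_map_weak_conv[OF M prob_space_gauss_seq elim norm_cont]
      show ?case by (simp add: T_star_def)
    qed
  qed
qed

end
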